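(* For any integers $k>0$ and $r\ge 2$ there is a finitely presented group $G$ with $\operatorname{rank} G=r$ which acts $k$-acylindrically on a minimal tree $T$ where each edge of $T$ has non-trivial stabiliser and $T/G$ has exactly $\left\lfloor\left(2\operatorname{rank} G-\frac{5}{2}\right)k\right\rfloor$ edges. Similarly, for any integers $k>0$ and $r\ge 2$ the free group $F_r$ of rank $r$ admits a $k$-acylindrical action on a minimal tree $T$ where each edge of $T$ has non-trivial stabiliser and $T/F_r$ has exactly $(2r-3)k$ edges.
   Context: Groups act on (simplicial) trees by automorphisms without inversions; $T/G$ is the quotient graph. $T$ is minimal if there is no proper $G$-invariant subtree. $\operatorname{rank} G$ is the minimal size of a generating set of $G$. An action of $G$ on $T$ is $k$-acylindrical if whenever a non-trivial subgroup $H\le G$ fixes every edge of a reduced edge path $p$ in $T$, then $p$ contains at most $k$ edges. *)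

theory Defs
  imports Complex_Main "HOL-Algebra.Group_Action" "HOL-Algebra.Generated_Groups"
begin

section \<open>Free groups, finite presentations, rank\<close>

text \<open>The letter \<open>(x, True)\<close> is the generator \<open>x\<close>, and \<open>(x, False)\<close> its formal inverse.\<close>

definition inv_letter :: "'a \<times> bool \<Rightarrow> 'a \<times> bool"
  where "inv_letter l = (fst l, \<not> snd l)"

definition reduced_word :: "('a \<times> bool) list \<Rightarrow> bool"
  where "reduced_word w \<longleftrightarrow> successively (\<lambda>l m. m \<noteq> inv_letter l) w"

fun push_letter :: "'a \<times> bool \<Rightarrow> ('a \<times> bool) list \<Rightarrow> ('a \<times> bool) list"
  where
    "push_letter l [] = [l]"
  | "push_letter l (m # w) = (if m = inv_letter l then w else l # m # w)"

text \<open>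
  Elements are reduced words; pushing the letters of \<open>v\<close> one by one onto a reduced
  word \<open>w\<close> yields the reduced form of the concatenation \<open>v @ w\<close>.
\<close>

definition free_group :: "'a set \<Rightarrow> ('a \<times> bool) list monoid"
  where "free_group S =
    \<lparr>carrier = {w. reduced_word w \<and> fst ` set w \<subseteq> S}, monoid.mult = foldr push_letter, one = []\<rparr>"

lemma inv_letter_simps [simp]:
  "inv_letter (inv_letter l) = l" "fst (inv_letter l) = fst l"
  "inv_letter l \<noteq> l" "l \<noteq> inv_letter l"
  by (cases l; auto simp: inv_letter_def)+

lemma reduced_push: "reduced_word w \<Longrightarrow> reduced_word (push_letter l w)"
  by (cases "(l, w)" rule: push_letter.cases) (auto simp: reduced_word_def successively_Cons)

lemma reduced_mult: "reduced_word w \<Longrightarrow> reduced_word (foldr push_letter v w)"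
  by (induction v) (auto intro: reduced_push)

lemma push_inv_push: "reduced_word w \<Longrightarrow> push_letter (inv_letter l) (push_letter l w) = w"
  by (cases "(l, w)" rule: push_letter.cases; cases "tl w")
    (auto simp: reduced_word_def successively_Cons)

lemma foldr_push:
  assumes "reduced_word w"
  shows "foldr push_letter (push_letter l v) w = push_letter l (foldr push_letter v w)"
proof (cases v)
  case (Cons m u)
  then show ?thesis
    using push_inv_push[OF reduced_mult[OF assms], of "inv_letter l" u] by auto
qed auto

lemma mult_assoc_words:
  "reduced_word w \<Longrightarrow>
    foldr push_letter (foldr push_letter u v) w = foldr push_letter u (foldr push_letter v w)"
  by (induction u) (auto simp: foldr_push)

lemma set_mult: "fst ` set (foldr push_letter v w) \<subseteq> fst ` set v \<union> fst ` set w"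
proof (induction v)
  case (Cons l v)
  have "set (push_letter l u) \<subseteq> insert l (set u)" for u
    by (cases "(l, u)" rule: push_letter.cases) auto
  with Cons show ?case by (simp, blast)
qed auto

lemma mult_one_right: "reduced_word v \<Longrightarrow> foldr push_letter v [] = v"
proof (induction v)
  case (Cons l v)
  then show ?case by (cases v) (auto simp: reduced_word_def)
qed auto

lemma mult_inv_left:
  "reduced_word w \<Longrightarrow> foldr push_letter (rev (map inv_letter v)) (foldr push_letter v w) = w"
  by (induction v) (auto simp: push_inv_push reduced_mult)

lemma group_free_group: "group (free_group S)"
proof (rule groupI)
  fix v assume v: "v \<in> carrier (free_group S)"
  let ?u = "rev (map inv_letter v)"
  have "reduced_word ?u"
    using v by (auto simp: free_group_def reduced_word_def successively_rev successively_map
        elim!: successively_mono)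
  moreover have "fst ` set ?u \<subseteq> S"
    using v by (auto simp: free_group_def)
  moreover have "foldr push_letter ?u v = []"
    using v mult_inv_left[of "[]" v] by (simp add: free_group_def mult_one_right reduced_word_def)
  ultimately show "\<exists>u\<in>carrier (free_group S). u \<otimes>\<^bsub>free_group S\<^esub> v = \<one>\<^bsub>free_group S\<^esub>"
    by (intro bexI[of _ ?u]) (simp_all add: free_group_def)
next
  fix v w assume "v \<in> carrier (free_group S)" "w \<in> carrier (free_group S)"
  then show "v \<otimes>\<^bsub>free_group S\<^esub> w \<in> carrier (free_group S)"
    by (simp add: free_group_def reduced_mult subset_trans[OF set_mult])
qed (simp_all add: free_group_def mult_assoc_words, simp add: reduced_word_def)

definition normal_closure :: "('a, 'b) monoid_scheme \<Rightarrow> 'a set \<Rightarrow> 'a set"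
  where "normal_closure G R = \<Inter> {N. N \<lhd> G \<and> R \<subseteq> N}"

definition finitely_presented :: "('a, 'b) monoid_scheme \<Rightarrow> bool"
  where "finitely_presented G \<longleftrightarrow>
    (\<exists>(n::nat) R. finite R \<and> R \<subseteq> carrier (free_group {..<n}) \<and>
      G \<cong> free_group {..<n} Mod normal_closure (free_group {..<n}) R)"

text \<open>The rank is only meaningful for finitely generated groups.\<close>

definition group_rank :: "('a, 'b) monoid_scheme \<Rightarrow> nat"
  where "group_rank G =
    (LEAST n. \<exists>S\<subseteq>carrier G. finite S \<and> card S = n \<and> generate G S = carrier G)"


section \<open>Simplicial trees\<close>

text \<open>
  A tree has no loops and no multiple edges, so it is given by its vertices and
  a set of two-element sets of vertices. A path is the nonempty list of vertices
  it passes through; it has \<open>length p - 1\<close> edges.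
\<close>

definition edge_path :: "'v set \<Rightarrow> 'v set set \<Rightarrow> 'v list \<Rightarrow> bool"
  where "edge_path V E p \<longleftrightarrow>
    p \<noteq> [] \<and> set p \<subseteq> V \<and> successively (\<lambda>u v. {u, v} \<in> E) p"

definition path_edges :: "'v list \<Rightarrow> 'v set list"
  where "path_edges p = map (\<lambda>(u, v). {u, v}) (zip p (tl p))"

text \<open>Reduced: no backtracking, i.e. consecutive edges are distinct.\<close>

definition reduced_path :: "'v set \<Rightarrow> 'v set set \<Rightarrow> 'v list \<Rightarrow> bool"
  where "reduced_path V E p \<longleftrightarrow>
    edge_path V E p \<and> successively (\<noteq>) (path_edges p)"

definition circuit :: "'v set \<Rightarrow> 'v set set \<Rightarrow> 'v list \<Rightarrow> bool"
  where "circuit V E p \<longleftrightarrow>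
    edge_path V E p \<and> distinct p \<and> length p \<ge> 3 \<and> {last p, hd p} \<in> E"

definition tree :: "'v set \<Rightarrow> 'v set set \<Rightarrow> bool"
  where "tree V E \<longleftrightarrow>
    V \<noteq> {} \<and>
    (\<forall>e\<in>E. e \<subseteq> V \<and> card e = 2) \<and>
    (\<forall>u\<in>V. \<forall>v\<in>V. \<exists>p. edge_path V E p \<and> hd p = u \<and> last p = v) \<and>
    (\<nexists>p. circuit V E p)"


section \<open>Actions on trees\<close>

text \<open>The action on edges induced by an action on vertices.\<close>

abbreviation edge_action :: "('g \<Rightarrow> 'v \<Rightarrow> 'v) \<Rightarrow> 'g \<Rightarrow> 'v set \<Rightarrow> 'v set"
  where "edge_action \<phi> \<equiv> (\<lambda>g e. \<phi> g ` e)"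

definition tree_action ::
    "('g, 'b) monoid_scheme \<Rightarrow> 'v set \<Rightarrow> 'v set set \<Rightarrow> ('g \<Rightarrow> 'v \<Rightarrow> 'v) \<Rightarrow> bool"
  where "tree_action G V E \<phi> \<longleftrightarrow>
    tree V E \<and> group_action G V \<phi> \<and>
    (\<forall>g\<in>carrier G. \<forall>e\<in>E. edge_action \<phi> g e \<in> E) \<and>
    (\<forall>g\<in>carrier G. \<forall>u v. {u, v} \<in> E \<longrightarrow> \<not> (\<phi> g u = v \<and> \<phi> g v = u))"

definition minimal_tree ::
    "('g, 'b) monoid_scheme \<Rightarrow> 'v set \<Rightarrow> 'v set set \<Rightarrow> ('g \<Rightarrow> 'v \<Rightarrow> 'v) \<Rightarrow> bool"
  where "minimal_tree G V E \<phi> \<longleftrightarrow>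
    (\<forall>V' E'. V' \<subseteq> V \<and> E' \<subseteq> E \<and> tree V' E' \<and>
        (\<forall>g\<in>carrier G. (\<forall>v\<in>V'. \<phi> g v \<in> V') \<and> (\<forall>e\<in>E'. edge_action \<phi> g e \<in> E'))
      \<longrightarrow> V' = V \<and> E' = E)"

text \<open>
  As actions are without inversions, fixing an edge as a set of endpoints and
  fixing it pointwise are the same.
\<close>

definition acylindrical ::
    "nat \<Rightarrow> ('g, 'b) monoid_scheme \<Rightarrow> 'v set \<Rightarrow> 'v set set \<Rightarrow> ('g \<Rightarrow> 'v \<Rightarrow> 'v) \<Rightarrow> bool"
  where "acylindrical k G V E \<phi> \<longleftrightarrow>
    (\<forall>H p. subgroup H G \<and> H \<noteq> {\<one>\<^bsub>G\<^esub>} \<and> reduced_path V E p \<and>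
        (\<forall>h\<in>H. \<forall>e\<in>set (path_edges p). edge_action \<phi> h e = e)
      \<longrightarrow> length (path_edges p) \<le> k)"

text \<open>
  Without inversions, the edges of the quotient graph \<open>T/G\<close> are the orbits of
  the (unoriented) edges of \<open>T\<close>; the quotient may have loops and multiple edges.
\<close>

definition quotient_edges ::
    "('g, 'b) monoid_scheme \<Rightarrow> 'v set set \<Rightarrow> ('g \<Rightarrow> 'v \<Rightarrow> 'v) \<Rightarrow> 'v set set set"
  where "quotient_edges G E \<phi> = orbits G E (edge_action \<phi>)"

end

theory Submission
  imports Defs "HOL-Algebra.Elementary_Groups" "HOL-Library.Countable"
begin

text \<open>
  Both groups are free products \<open>C * F\<close> of a cyclic group \<open>C\<close> with a free group \<open>F\<close> of rank
  \<open>r - 1\<close>: the group \<open>C\<close> is infinite for the free group, and of order 15 for the other one. Both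
  trees are built by alternating two operations, each of which keeps the action
  \<open>k\<close>-acylindrical with non-trivial edge stabilisers.

  \<^emph>\<open>Gluing\<close> adds a free generator and no edge orbit (\<open>ready_if_gluable\<close>). Let \<open>G\<close> act on a
  tree \<open>T\<close> with vertices \<open>L\<close> and \<open>L'\<close> fixed by elements \<open>a\<close> and \<open>b\<close>. Take a copy of \<open>T\<close> for
  every coset of \<open>G\<close> in \<open>G * \<langle>t\<rangle>\<close> and identify the vertex \<open>L\<close> of the copy \<open>\<gamma>G\<close> with the vertex
  \<open>L'\<close> of the copy \<open>\<gamma>tG\<close>. The copies are joined in the pattern of the Bass-Serre tree of the
  free product, so the result is again a tree. As \<open>G\<close> is malnormal in \<open>G * \<langle>t\<rangle>\<close>, a
  non-trivial element that fixes a path fixes it inside a single copy, and acylindricity is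
  inherited. The glued vertex \<open>L = tL'\<close> is fixed by \<open>\<alpha> = a t b t\<inverse>\<close> and \<open>\<beta> = a t b\<inverse> t\<inverse>\<close>. If \<open>a\<close>
  and \<open>b\<close> have non-trivial squares, then the non-trivial powers of \<open>\<alpha>\<close> and \<open>\<beta>\<close> stabilise no copy
  and hence fix no edge, the subgroups \<open>\<langle>\<alpha>\<rangle>\<close> and \<open>\<langle>\<beta>\<rangle>\<close> are malnormal, and no non-trivial power of \<open>\<alpha>\<close>
  is conjugate to a power of \<open>\<beta>\<close> (\<open>rho_malnormal\<close>).

  \<^emph>\<open>Legs\<close> add \<open>2k\<close> edge orbits (\<open>gluable_if_ready\<close>). At the translates of the glued vertex hang
  legs of length \<open>k\<close> stabilised by the conjugates of \<open>\<langle>\<alpha>\<rangle>\<close> and of \<open>\<langle>\<beta>\<rangle>\<close>. By the properties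
  above, a non-trivial power of \<open>\<alpha>\<close> or \<open>\<beta>\<close> fixes just one leg, so paths fixed by it have at most
  \<open>k\<close> edges. The ends of the two kinds of legs are the vertices \<open>L\<close> and \<open>L'\<close> of the next gluing.
  Thus every generator after the second contributes \<open>2k\<close> edges.

  It remains to find a tree for \<open>C\<close> itself. If \<open>C\<close> fixes a segment of length \<open>k\<close>, gluing its two
  ends yields \<open>k\<close> edges in rank 2, and \<open>(2r - 3)k\<close> edges in rank \<open>r\<close>. If \<open>C\<close> has order 15, torsion
  gives a better start for \<open>k \<ge> 2\<close>: \<open>C\<close> fixes a segment of length \<open>k - k div 2\<close> only, and at its two
  ends hang legs of length \<open>k div 2\<close> stabilised by the subgroups of order 3 and of order 5. As
  these subgroups meet trivially, a path fixed by a non-trivial element consists at most of two legs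
  at the same end, or of a leg and the segment, and has at most \<open>k\<close> edges. There are
  \<open>k + k div 2\<close> edge orbits.

  A tree without leaves and with finitely many edge orbits is minimal
  (\<open>minimal_if_no_leaves\<close>). The rank of \<open>C * F\<close> is \<open>r\<close>, as this group has \<open>r\<close> generators and
  \<open>3 ^ r\<close> homomorphisms to the group of order 3.
\<close>

section \<open>Rooted trees\<close>

text \<open>
  A tree given by a parent map, with the root as its own parent. Gluing and hanging legs only
  ask for the parents of the new vertices, whereas circuits would be hard to control.
\<close>

definition rooted :: "'v \<Rightarrow> ('v \<Rightarrow> 'v) \<Rightarrow> 'v set \<Rightarrow> 'v set set \<Rightarrow> bool"
  where "rooted r par V E \<longleftrightarrow>
    r \<in> V \<and> par r = r \<and> par \<in> V \<rightarrow> V \<and> (\<forall>v\<in>V. \<exists>n. (par ^^ n) v = r) \<and>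
    E = (\<lambda>v. {v, par v}) ` (V - {r})"

definition depth :: "'v \<Rightarrow> ('v \<Rightarrow> 'v) \<Rightarrow> 'v \<Rightarrow> nat"
  where "depth r par v = (LEAST n. (par ^^ n) v = r)"

lemma depth_par:
  assumes "rooted r par V E" "v \<in> V" "v \<noteq> r"
  shows "depth r par v = Suc (depth r par (par v))"
proof -
  obtain n where "(par ^^ n) v = r" using assms unfolding rooted_def by blast
  then show ?thesis
    unfolding depth_def using assms(3)
    by (subst Least_Suc[of _ n]) (auto simp: funpow_swap1)
qed

lemma rooted_edge_cases:
  assumes "rooted r par V E" "{u, v} \<in> E"
  shows "u \<in> V" "v \<in> V" "u \<noteq> v" "v \<noteq> r \<and> u = par v \<or> u \<noteq> r \<and> v = par u"
proof -
  obtain x where x: "x \<in> V" "x \<noteq> r" "{u, v} = {x, par x}" "par x \<in> V"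
    using assms unfolding rooted_def by auto
  have "par x \<noteq> x" using depth_par[OF assms(1) x(1,2)] by auto
  with x show "u \<in> V" "v \<in> V" "u \<noteq> v" "v \<noteq> r \<and> u = par v \<or> u \<noteq> r \<and> v = par u"
    by (auto simp: doubleton_eq_iff)
qed

lemma rooted_parent_edge:
  assumes "rooted r par V E" "v \<in> V" "v \<noteq> r"
  shows "{v, par v} \<in> E" "par v \<in> V" "par v \<noteq> v"
  using assms depth_par[OF assms] unfolding rooted_def by auto

lemma rooted_edge_child_eq:
  assumes "rooted r par V E" "u \<in> V" "u \<noteq> r" "v \<in> V" "v \<noteq> r" "{u, par u} = {v, par v}"
  shows "u = v"
  using assms(6) depth_par[OF assms(1-3)] depth_par[OF assms(1,4,5)]
  by (auto simp: doubleton_eq_iff)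

lemma rooted_induct [consumes 2, case_names root step]:
  assumes "rooted r par V E" "v \<in> V"
    and "P r" "\<And>v. v \<in> V \<Longrightarrow> v \<noteq> r \<Longrightarrow> P (par v) \<Longrightarrow> P v"
  shows "P v"
  using assms(2)
proof (induction "depth r par v" arbitrary: v rule: less_induct)
  case less
  then show ?case
    using assms(3,4) depth_par[OF assms(1), of v] rooted_parent_edge(2)[OF assms(1), of v]
    by (cases "v = r") auto
qed

lemma edge_pathI_rev:
  "edge_path V E p \<Longrightarrow> edge_path V E (rev p)"
  by (auto simp: edge_path_def insert_commute elim!: successively_mono)

lemma edge_path_append:
  assumes "edge_path V E p" "edge_path V E q" "last p = hd q"
  shows "edge_path V E (p @ tl q)" "hd (p @ tl q) = hd p" "last (p @ tl q) = last q"
  using assms by (cases q; auto simp: edge_path_def successively_append_iff successively_Cons hd_append)+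

lemma rooted_path_to_root:
  assumes "rooted r par V E" "v \<in> V"
  shows "\<exists>p. edge_path V E p \<and> hd p = v \<and> last p = r"
  using assms
proof (induction rule: rooted_induct)
  case root
  show ?case using assms by (intro exI[of _ "[r]"]) (auto simp: edge_path_def rooted_def)
next
  case (step v)
  then obtain p where p: "edge_path V E p" "hd p = par v" "last p = r" by blast
  then show ?case
    using step rooted_parent_edge[OF assms(1) step(1,2)]
    by (intro exI[of _ "v # p"]) (auto simp: edge_path_def successively_Cons)
qed

text \<open>
  Both neighbours of a deepest vertex of a circuit would be its parent.
\<close>

lemma tree_of_rooted:
  assumes R: "rooted r par V E"
  shows "tree V E"
  unfolding tree_def
proof (intro conjI)
  show "V \<noteq> {}" using R unfolding rooted_def by auto
  show "\<forall>e\<in>E. e \<subseteq> V \<and> card e = 2"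
    using R rooted_parent_edge[OF R] unfolding rooted_def by (auto simp: card_2_iff)
  show "\<forall>u\<in>V. \<forall>v\<in>V. \<exists>p. edge_path V E p \<and> hd p = u \<and> last p = v"
  proof (intro ballI)
    fix u v assume uv: "u \<in> V" "v \<in> V"
    obtain p where p: "edge_path V E p" "hd p = u" "last p = r"
      using rooted_path_to_root[OF R uv(1)] by blast
    obtain q where q: "edge_path V E q" "hd q = v" "last q = r"
      using rooted_path_to_root[OF R uv(2)] by blast
    have "edge_path V E (rev q)" "hd (rev q) = r" "last (rev q) = v"
      using q edge_pathI_rev[OF q(1)] by (auto simp: hd_rev last_rev)
    with edge_path_append[OF p(1), of "rev q"] p
    show "\<exists>p. edge_path V E p \<and> hd p = u \<and> last p = v" by metis
  qed
  show "\<nexists>p. circuit V E p"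
  proof
    assume "\<exists>p. circuit V E p"
    then obtain p where p: "edge_path V E p" "distinct p" "length p \<ge> 3" "{last p, hd p} \<in> E"
      unfolding circuit_def by blast
    let ?n = "length p"
    have adj: "{p ! i, p ! (Suc i mod ?n)} \<in> E" if "i < ?n" for i
    proof (cases "Suc i < ?n")
      case True
      then show ?thesis using p(1) unfolding edge_path_def
        by (auto simp: successively_conv_nth)
    next
      case False
      then have i: "Suc i = ?n" using that by simp
      have "p \<noteq> []" "?n - 1 = i" using i by auto
      then have "last p = p ! i" "hd p = p ! 0" by (simp_all add: last_conv_nth hd_conv_nth)
      then show ?thesis using p(4) i by simp
    qed
    have V: "p ! i \<in> V" if "i < ?n" for i
      using p(1) that unfolding edge_path_def by auto
    \<comment> \<open>a deepest vertex of the circuit\<close>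
    have "Max ((\<lambda>i. depth r par (p ! i)) ` {..<?n}) \<in> (\<lambda>i. depth r par (p ! i)) ` {..<?n}"
      using p(3) by (intro Max_in) (auto simp: lessThan_empty_iff)
    then obtain i where i: "i < ?n" and
      "depth r par (p ! i) = Max ((\<lambda>i. depth r par (p ! i)) ` {..<?n})"
      by auto
    then have max: "depth r par (p ! j) \<le> depth r par (p ! i)" if "j < ?n" for j
      using that by auto
    have *: "p ! j = par (p ! i)" if "j < ?n" "{p ! i, p ! j} \<in> E" for j
      using rooted_edge_cases[OF R that(2)] max[OF that(1)] depth_par[OF R, of "p ! j"]
      by auto
    define j where "j = (if i = 0 then ?n - 1 else i - 1)"
    have j: "j < ?n" "Suc j mod ?n = i" using i p(3) by (auto simp: j_def)
    have k: "Suc i mod ?n < ?n" using i by (intro mod_less_divisor) auto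
    have "p ! (Suc i mod ?n) = p ! j"
      using *[OF k adj[OF i]] *[OF j(1)] adj[OF j(1)] unfolding j(2) by (simp add: insert_commute)
    then have "Suc i mod ?n = j"
      using p(2) j(1) k nth_eq_iff_index_eq by blast
    then show False using i p(3) by (cases "Suc i = ?n") (auto simp: j_def split: if_splits)
  qed
qed

text \<open>
  When the root moves to a child \<open>c\<close> of \<open>r\<close>, only the edge between \<open>r\<close> and \<open>c\<close> is turned round.
\<close>

lemma reroot_step:
  assumes R: "rooted r par V E" and c: "c \<in> V" "c \<noteq> r" "par c = r"
  shows "rooted c (par(r := c, c := c)) V E" (is "rooted c ?p V E")
proof -
  have reach: "\<exists>n. (?p ^^ n) v = c" if "v \<in> V" for v
    using R that
  proof (induction rule: rooted_induct)
    case root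
    show ?case using c by (intro exI[of _ 1]) auto
  next
    case (step v)
    then obtain n where n: "(?p ^^ n) (par v) = c" by blast
    show ?case
    proof (cases "v = c")
      case True then show ?thesis by (intro exI[of _ 0]) auto
    next
      case False
      then have "(?p ^^ Suc n) v = c" using n step(2) by (simp add: funpow_swap1)
      then show ?thesis by blast
    qed
  qed
  have E: "E = (\<lambda>v. {v, ?p v}) ` (V - {c})"
  proof -
    have "V - {c} = insert r (V - {r, c})" "V - {r} = insert c (V - {r, c})"
      using c R unfolding rooted_def by auto
    then show ?thesis
      using R c unfolding rooted_def by (auto simp: insert_commute)
  qed
  show ?thesis using R c reach E unfolding rooted_def by auto
qed

lemma reroot:
  assumes R: "rooted r par V E" and "s \<in> V"
  shows "\<exists>par'. rooted s par' V E"
  using assms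
proof (induction rule: rooted_induct)
  case root
  then show ?case using R by blast
next
  case (step v)
  then obtain p where p: "rooted (par v) p V E" by blast
  have "{v, par v} \<in> E" "v \<noteq> par v" using rooted_parent_edge[OF R step(1,2)] by auto
  then have "p v = par v" using rooted_edge_cases(4)[OF p, of v "par v"] by auto
  then show ?case using reroot_step[OF p step(1)] \<open>v \<noteq> par v\<close> by blast
qed

text \<open>
  Reduced paths in terms of vertices: in a graph without multiple edges, two consecutive edges
  are equal just when the path returns to the vertex that it has left.
\<close>

definition no_backtrack :: "'v set set \<Rightarrow> 'v list \<Rightarrow> bool"
  where "no_backtrack E p \<longleftrightarrow>
    (\<forall>i. Suc i < length p \<longrightarrow> {p ! i, p ! Suc i} \<in> E) \<and>
    (\<forall>i. Suc (Suc i) < length p \<longrightarrow> p ! i \<noteq> p ! Suc (Suc i))"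

lemma no_backtrack_take: "no_backtrack E p \<Longrightarrow> no_backtrack E (take n p)"
  by (auto simp: no_backtrack_def)

lemma no_backtrack_drop: "no_backtrack E p \<Longrightarrow> no_backtrack E (drop n p)"
  by (auto simp: no_backtrack_def)

lemma no_backtrack_rev: "no_backtrack F p \<Longrightarrow> no_backtrack F (rev p)"
proof -
  assume p: "no_backtrack F p"
  let ?n = "length p"
  show ?thesis unfolding no_backtrack_def
  proof (intro conjI allI impI)
    fix i assume "Suc i < length (rev p)"
    then have i: "Suc i < ?n" by simp
    then have "{p ! (?n - Suc (Suc i)), p ! Suc (?n - Suc (Suc i))} \<in> F" using p by (simp add: no_backtrack_def)
    moreover have "Suc (?n - Suc (Suc i)) = ?n - Suc i" using i by simp
    ultimately show "{rev p ! i, rev p ! Suc i} \<in> F" using i by (simp add: rev_nth insert_commute)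
  next
    fix i assume "Suc (Suc i) < length (rev p)"
    then have i: "Suc (Suc i) < ?n" by simp
    let ?j = "?n - Suc (Suc (Suc i))"
    have "p ! ?j \<noteq> p ! Suc (Suc ?j)" using p i by (simp add: no_backtrack_def)
    moreover have "Suc (Suc ?j) = ?n - Suc i" using i by simp
    ultimately show "rev p ! i \<noteq> rev p ! Suc (Suc i)" using i by (auto simp: rev_nth)
  qed
qed

lemma no_backtrack_Cons2:
  "no_backtrack F (x # y # p) \<longleftrightarrow> {x, y} \<in> F \<and> (p = [] \<or> x \<noteq> hd p) \<and> no_backtrack F (y # p)"
proof
  assume n: "no_backtrack F (x # y # p)"
  have "no_backtrack F (y # p)" using no_backtrack_drop[OF n, of 1] by simp
  moreover have "{x, y} \<in> F" using n unfolding no_backtrack_def by (auto dest: spec[of _ 0])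
  moreover have "p = [] \<or> x \<noteq> hd p"
  proof (cases p)
    case (Cons z q)
    have "Suc (Suc 0) < length (x # y # p)" using Cons by simp
    then have "(x # y # p) ! 0 \<noteq> (x # y # p) ! Suc (Suc 0)" using n unfolding no_backtrack_def by blast
    then show ?thesis using Cons by simp
  qed simp
  ultimately show "{x, y} \<in> F \<and> (p = [] \<or> x \<noteq> hd p) \<and> no_backtrack F (y # p)" by simp
next
  assume a: "{x, y} \<in> F \<and> (p = [] \<or> x \<noteq> hd p) \<and> no_backtrack F (y # p)"
  show "no_backtrack F (x # y # p)" unfolding no_backtrack_def
  proof (intro conjI allI impI)
    fix i assume "Suc i < length (x # y # p)"
    then show "{(x # y # p) ! i, (x # y # p) ! Suc i} \<in> F"
      using a by (cases i) (auto simp: no_backtrack_def)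
  next
    fix i assume "Suc (Suc i) < length (x # y # p)"
    then show "(x # y # p) ! i \<noteq> (x # y # p) ! Suc (Suc i)"
      using a by (cases i; cases p) (auto simp: no_backtrack_def)
  qed
qed

lemma two_elems: "length p \<ge> 2 \<Longrightarrow> \<exists>x y q. p = x # y # q"
  by (cases p; cases "tl p") auto

text \<open>
  A path without backtracking descends from its first vertex as root: a step to the parent
  would undo the previous step.
\<close>

lemma no_backtrack_depth:
  assumes R: "rooted r par V E" and p: "no_backtrack E p" "p \<noteq> []" "hd p = r" "i < length p"
  shows "depth r par (p ! i) = i \<and> (i > 0 \<longrightarrow> p ! i \<noteq> r \<and> par (p ! i) = p ! (i - 1))"
  using p(4)
proof (induction i)
  case 0
  then show ?case using p by (auto simp: hd_conv_nth depth_def)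
next
  case (Suc i)
  then have IH: "depth r par (p ! i) = i" "i > 0 \<Longrightarrow> p ! i \<noteq> r \<and> par (p ! i) = p ! (i - 1)"
    by auto
  have e: "{p ! i, p ! Suc i} \<in> E" using p Suc(2) by (auto simp: no_backtrack_def)
  have "p ! Suc i \<noteq> r \<and> p ! i = par (p ! Suc i)"
  proof (rule ccontr)
    assume "\<not> ?thesis"
    then have *: "p ! i \<noteq> r" "p ! Suc i = par (p ! i)" using rooted_edge_cases(4)[OF R e] by auto
    then have "i > 0" using p by (cases i) (auto simp: hd_conv_nth)
    then have "p ! (i - 1) = p ! Suc (Suc (i - 1))" using IH(2) *(2) by auto
    then show False using p(1) Suc(2) \<open>i > 0\<close> unfolding no_backtrack_def
      by (cases i) auto
  qed
  then show ?case using depth_par[OF R, of "p ! Suc i"] rooted_edge_cases(2)[OF R e] IH by auto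
qed

lemma no_backtrack_closed_trivial:
  assumes R: "rooted r par V E" and p: "no_backtrack E p" "p \<noteq> []" "hd p = last p"
  shows "length p = 1"
proof (rule ccontr)
  assume "length p \<noteq> 1"
  with p have l: "length p \<ge> 2" by (cases p) (auto simp: Suc_le_eq)
  have "{p ! 0, p ! 1} \<in> E" using p(1) l by (auto simp: no_backtrack_def)
  then have "hd p \<in> V" using rooted_edge_cases(1)[OF R] p(2) by (auto simp: hd_conv_nth)
  then obtain q where q: "rooted (hd p) q V E" using reroot[OF R] by blast
  show False
    using no_backtrack_depth[OF q p(1,2) refl, of "length p - 1"] l p by (auto simp: last_conv_nth)
qed

lemma no_backtrack_distinct:
  assumes R: "rooted r par V E" and p: "no_backtrack E p"
  shows "distinct p"
proof (rule ccontr)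
  assume "\<not> distinct p"
  then obtain i j where ij: "i < j" "j < length p" "p ! i = p ! j"
    by (metis distinct_conv_nth linorder_neqE_nat)
  let ?q = "take (Suc j - i) (drop i p)"
  have "length ?q = Suc j - i" "hd ?q = p ! i" "last ?q = p ! j"
    using ij by (auto simp: hd_conv_nth last_conv_nth)
  then show False using no_backtrack_closed_trivial[OF R no_backtrack_take[OF no_backtrack_drop[OF p]], of "Suc j - i" i] ij
    by auto
qed

lemma path_edges_conv: "length (path_edges p) = length p - 1"
  "Suc i < length p \<Longrightarrow> path_edges p ! i = {p ! i, p ! Suc i}"
  by (auto simp: path_edges_def nth_tl)

lemma no_backtrack_of_reduced_path:
  assumes R: "rooted r par V E" and p: "reduced_path V E p"
  shows "no_backtrack E p"
  unfolding no_backtrack_def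
proof (intro conjI allI impI)
  fix i
  show *: "{p ! i, p ! Suc i} \<in> E" if "Suc i < length p" for i
    using p that unfolding reduced_path_def edge_path_def by (auto simp: successively_conv_nth)
  assume i: "Suc (Suc i) < length p"
  then have "path_edges p ! i \<noteq> path_edges p ! Suc i"
    using p unfolding reduced_path_def by (auto simp: successively_conv_nth path_edges_conv)
  then show "p ! i \<noteq> p ! Suc (Suc i)"
    using i by (auto simp: path_edges_conv insert_commute)
qed

section \<open>Actions with small fixed subtrees\<close>

text \<open>
  An action in elementary terms, with arbitrary values outside \<open>V\<close>, so that formulas for it
  need no case distinction.
\<close>

definition acts :: "('g, 'b) monoid_scheme \<Rightarrow> 'v set \<Rightarrow> ('g \<Rightarrow> 'v \<Rightarrow> 'v) \<Rightarrow> bool"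
  where "acts G V \<phi> \<longleftrightarrow>
    (\<forall>g\<in>carrier G. \<forall>v\<in>V. \<phi> g v \<in> V) \<and> (\<forall>v\<in>V. \<phi> \<one>\<^bsub>G\<^esub> v = v) \<and>
    (\<forall>g\<in>carrier G. \<forall>h\<in>carrier G. \<forall>v\<in>V. \<phi> (g \<otimes>\<^bsub>G\<^esub> h) v = \<phi> g (\<phi> h v))"

definition tree_acts ::
    "('g, 'b) monoid_scheme \<Rightarrow> 'v set \<Rightarrow> 'v set set \<Rightarrow> ('g \<Rightarrow> 'v \<Rightarrow> 'v) \<Rightarrow> bool"
  where "tree_acts G V E \<phi> \<longleftrightarrow>
    group G \<and> (\<exists>r par. rooted r par V E) \<and> acts G V \<phi> \<and>
    (\<forall>g\<in>carrier G. \<forall>u v. {u, v} \<in> E \<longrightarrow>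
      {\<phi> g u, \<phi> g v} \<in> E \<and> \<not> (\<phi> g u = v \<and> \<phi> g v = u))"

text \<open>
  The set \<open>R\<close> contains exactly one edge of every orbit, which is easier to follow through
  the constructions than the set of orbits.
\<close>

definition edge_transversal ::
    "('g, 'b) monoid_scheme \<Rightarrow> 'v set set \<Rightarrow> ('g \<Rightarrow> 'v \<Rightarrow> 'v) \<Rightarrow> 'v set set \<Rightarrow> bool"
  where "edge_transversal G E \<phi> R \<longleftrightarrow>
    R \<subseteq> E \<and> (\<forall>e\<in>E. \<exists>g\<in>carrier G. \<exists>d\<in>R. e = \<phi> g ` d) \<and>
    (\<forall>d\<in>R. \<forall>d'\<in>R. \<forall>g\<in>carrier G. \<phi> g ` d = d' \<longrightarrow> d = d')"

text \<open>
  A \<open>k\<close>-acylindrical action with non-trivial edge stabilisers and \<open>n\<close> edge orbits. For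
  acylindricity it suffices to consider paths fixed by a single non-trivial element, as every
  non-trivial subgroup contains one; a path with at most \<open>k\<close> edges has at most \<open>Suc k\<close> vertices.
\<close>

definition good_action ::
    "nat \<Rightarrow> nat \<Rightarrow> ('g, 'b) monoid_scheme \<Rightarrow> 'v set \<Rightarrow> 'v set set \<Rightarrow> ('g \<Rightarrow> 'v \<Rightarrow> 'v) \<Rightarrow> bool"
  where "good_action k n G V E \<phi> \<longleftrightarrow>
    tree_acts G V E \<phi> \<and>
    (\<forall>u v. {u, v} \<in> E \<longrightarrow> (\<exists>g\<in>carrier G. g \<noteq> \<one>\<^bsub>G\<^esub> \<and> \<phi> g u = u \<and> \<phi> g v = v)) \<and>
    (\<forall>h\<in>carrier G. \<forall>p. h \<noteq> \<one>\<^bsub>G\<^esub> \<longrightarrow> no_backtrack E p \<longrightarrow> (\<forall>x\<in>set p. \<phi> h x = x) \<longrightarrow> length p \<le> Suc k) \<and>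
    (\<exists>R. finite R \<and> card R = n \<and> edge_transversal G E \<phi> R)"

definition branches :: "'v set set \<Rightarrow> 'v \<Rightarrow> bool"
  where "branches E v \<longleftrightarrow> (\<exists>u w. u \<noteq> w \<and> {v, u} \<in> E \<and> {v, w} \<in> E)"

lemma actsD:
  assumes "acts G V \<phi>"
  shows "\<And>g v. g \<in> carrier G \<Longrightarrow> v \<in> V \<Longrightarrow> \<phi> g v \<in> V"
    "\<And>v. v \<in> V \<Longrightarrow> \<phi> \<one>\<^bsub>G\<^esub> v = v"
    "\<And>g h v. g \<in> carrier G \<Longrightarrow> h \<in> carrier G \<Longrightarrow> v \<in> V \<Longrightarrow> \<phi> (g \<otimes>\<^bsub>G\<^esub> h) v = \<phi> g (\<phi> h v)"
  using assms unfolding acts_def by auto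

lemma good_actionD:
  assumes "good_action k n G V E \<phi>"
  shows "tree_acts G V E \<phi>"
    "\<And>u v. {u, v} \<in> E \<Longrightarrow> \<exists>g\<in>carrier G. g \<noteq> \<one>\<^bsub>G\<^esub> \<and> \<phi> g u = u \<and> \<phi> g v = v"
    "\<And>h p. h \<in> carrier G \<Longrightarrow> h \<noteq> \<one>\<^bsub>G\<^esub> \<Longrightarrow> no_backtrack E p \<Longrightarrow> (\<And>x. x \<in> set p \<Longrightarrow> \<phi> h x = x) \<Longrightarrow>
      length p \<le> Suc k"
    "\<exists>R. finite R \<and> card R = n \<and> edge_transversal G E \<phi> R"
  using assms unfolding good_action_def by simp_all

lemma tree_actsD:
  assumes "tree_acts G V E \<phi>"
  shows "group G" "\<exists>r par. rooted r par V E" "acts G V \<phi>"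
    "\<And>g u v. g \<in> carrier G \<Longrightarrow> {u, v} \<in> E \<Longrightarrow> {\<phi> g u, \<phi> g v} \<in> E"
    "\<And>g u v. g \<in> carrier G \<Longrightarrow> {u, v} \<in> E \<Longrightarrow> \<not> (\<phi> g u = v \<and> \<phi> g v = u)"
  using assms unfolding tree_acts_def by simp_all

lemma acts_inv:
  assumes "group G" "acts G V \<phi>" "g \<in> carrier G" "v \<in> V"
  shows "\<phi> (inv\<^bsub>G\<^esub> g) (\<phi> g v) = v" "\<phi> g (\<phi> (inv\<^bsub>G\<^esub> g) v) = v"
  using assms actsD(2,3)[OF assms(2)] group.l_inv[OF assms(1)] group.r_inv[OF assms(1)]
    group.inv_closed[OF assms(1)]
  by metis+

lemma acts_inj:
  assumes "group G" "acts G V \<phi>" "g \<in> carrier G" "u \<in> V" "v \<in> V"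
  shows "\<phi> g u = \<phi> g v \<longleftrightarrow> u = v"
  using acts_inv[OF assms(1-3)] assms(4,5) by metis

text \<open>
  The path starts among the descendants of \<open>hd p\<close> and ends outside; the edge from \<open>hd p\<close>
  to its parent is the only one that leaves the set of these descendants.
\<close>

lemma path_uses_parent_edge:
  assumes R: "rooted r par V E" and p: "edge_path V E p" "last p = r" and "hd p \<noteq> r"
  shows "{hd p, par (hd p)} \<in> set (path_edges p)"
proof -
  let ?v = "hd p"
  define D where "D = {u. \<exists>n. (par ^^ n) u = ?v}"
  have ne: "p \<noteq> []" using p(1) by (auto simp: edge_path_def)
  have v: "?v \<in> V" using p(1) by (auto simp: edge_path_def)
  have "r \<notin> D"
  proof
    assume "r \<in> D"
    then obtain n where n: "(par ^^ n) r = ?v" unfolding D_def by blast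
    have "(par ^^ n) r = r" using R by (induction n) (auto simp: rooted_def)
    then show False using n assms(4) by simp
  qed
  then have "p ! (length p - 1) \<notin> D" using p(2) ne by (simp add: last_conv_nth)
  moreover have "p ! 0 \<in> D" unfolding D_def
    using ne by (auto simp: hd_conv_nth intro: exI[of _ 0])
  ultimately obtain i where i: "i < length p - 1" "p ! i \<in> D" "p ! Suc i \<notin> D"
  proof -
    assume a: "p ! (length p - 1) \<notin> D" "p ! 0 \<in> D"
      and t: "\<And>i. i < length p - 1 \<Longrightarrow> p ! i \<in> D \<Longrightarrow> p ! Suc i \<notin> D \<Longrightarrow> thesis"
    show thesis
    proof (rule ccontr)
      assume n: "\<not> thesis"
      have "p ! i \<in> D" if "i \<le> length p - 1" for i
        using that
      proof (induction i)
        case (Suc i)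
        then show ?case using t[of i] n by auto
      qed (use a in simp)
      then show False using a by auto
    qed
  qed
  have e: "{p ! i, p ! Suc i} \<in> E"
    using p(1) i(1) unfolding edge_path_def by (auto simp: successively_conv_nth)
  have "p ! Suc i = par (p ! i)"
  proof (rule ccontr)
    assume "\<not> ?thesis"
    then have "par (p ! Suc i) = p ! i" using rooted_edge_cases(4)[OF R e] by auto
    moreover obtain n where "(par ^^ n) (p ! i) = ?v" using i(2) unfolding D_def by blast
    ultimately have "(par ^^ Suc n) (p ! Suc i) = ?v" by (simp add: funpow_swap1)
    then have "p ! Suc i \<in> D" unfolding D_def by blast
    then show False using i(3) by simp
  qed
  moreover have "p ! i = ?v"
  proof -
    obtain n where n: "(par ^^ n) (p ! i) = ?v" using i(2) unfolding D_def by blast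
    show ?thesis
    proof (cases n)
      case (Suc m)
      then have "par (p ! i) \<in> D" using n unfolding D_def by (auto simp: funpow_swap1)
      then show ?thesis using i(3) calculation by simp
    qed (use n in auto)
  qed
  ultimately have "path_edges p ! i = {?v, par ?v}" using i(1) by (simp add: path_edges_conv)
  then show ?thesis using i(1) by (metis nth_mem path_edges_conv(1))
qed

lemma path_edges_subset:
  "edge_path V E p \<Longrightarrow> set (path_edges p) \<subseteq> E"
  by (auto simp: edge_path_def path_edges_conv in_set_conv_nth successively_conv_nth)

lemma edge_path_mono:
  "edge_path V' E' p \<Longrightarrow> V' \<subseteq> V \<Longrightarrow> E' \<subseteq> E \<Longrightarrow> edge_path V E p"
  by (auto simp: edge_path_def elim!: successively_mono)

lemma edge_transversalD:
  assumes "edge_transversal G E \<phi> R"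
  shows "R \<subseteq> E" "\<And>e. e \<in> E \<Longrightarrow> \<exists>g\<in>carrier G. \<exists>d\<in>R. e = \<phi> g ` d"
    "\<And>d d' g. d \<in> R \<Longrightarrow> d' \<in> R \<Longrightarrow> g \<in> carrier G \<Longrightarrow> \<phi> g ` d = d' \<Longrightarrow> d = d'"
proof -
  note D = assms[unfolded edge_transversal_def]
  show "R \<subseteq> E" using D by (elim conjE)
  show "\<And>e. e \<in> E \<Longrightarrow> \<exists>g\<in>carrier G. \<exists>d\<in>R. e = \<phi> g ` d" using D by (elim conjE) (rule bspec)
  show "\<And>d d' g. d \<in> R \<Longrightarrow> d' \<in> R \<Longrightarrow> g \<in> carrier G \<Longrightarrow> \<phi> g ` d = d' \<Longrightarrow> d = d'"
    using D[THEN conjunct2, THEN conjunct2] by metis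
qed

lemma rooted_reaches: "rooted r par V E \<Longrightarrow> v \<in> V \<Longrightarrow> \<exists>n. (par ^^ n) v = r"
  by (simp add: rooted_def)

text \<open>
  Suppose that an invariant subtree is proper. The distance to it is invariant under the group,
  so it takes finitely many values on the edges. But in a tree without leaves one can walk
  away from the subtree forever.
\<close>

lemma minimal_if_no_leaves:
  assumes T: "tree_acts G V E \<phi>"
    and fin: "finite R" "edge_transversal G E \<phi> R"
    and br: "\<And>v. v \<in> V \<Longrightarrow> branches E v"
    and sub: "V' \<subseteq> V" "E' \<subseteq> E" "tree V' E'"
    and invt: "\<And>g v. g \<in> carrier G \<Longrightarrow> v \<in> V' \<Longrightarrow> \<phi> g v \<in> V'"
  shows "V' = V \<and> E' = E"
proof -
  have G: "group G" and act: "acts G V \<phi>"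
    and edge: "\<And>g u v. g \<in> carrier G \<Longrightarrow> {u, v} \<in> E \<Longrightarrow> {\<phi> g u, \<phi> g v} \<in> E"
    using tree_actsD[OF T] by auto
  have "V' \<noteq> {}" and E': "\<And>e. e \<in> E' \<Longrightarrow> e \<subseteq> V'"
    and conn: "\<And>u v. u \<in> V' \<Longrightarrow> v \<in> V' \<Longrightarrow> \<exists>p. edge_path V' E' p \<and> hd p = u \<and> last p = v"
    using sub(3) unfolding tree_def by blast+
  then obtain q where q: "q \<in> V'" by blast
  obtain r\<^sub>0 par\<^sub>0 where "rooted r\<^sub>0 par\<^sub>0 V E" using tree_actsD(2)[OF T] by blast
  then obtain par where R: "rooted q par V E" using reroot sub(1) q by (metis subsetD)
  have par_edge: "{v, par v} \<in> E'" if v: "v \<in> V'" "v \<noteq> q" for v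
  proof -
    obtain p where p: "edge_path V' E' p" "hd p = v" "last p = q"
      using conn[OF v(1) q] by blast
    then show ?thesis
      using path_uses_parent_edge[OF R edge_path_mono[OF p(1) sub(1,2)]] v(2)
        path_edges_subset[OF p(1)] by auto
  qed
  have par_V': "par v \<in> V'" if "v \<in> V'" for v
  proof (cases "v = q")
    case True
    then show ?thesis using R q by (simp add: rooted_def)
  next
    case False
    then show ?thesis using E'[OF par_edge[OF that]] by simp
  qed
  have "V' = V"
  proof (rule ccontr)
    assume "V' \<noteq> V"
    then obtain x where x: "x \<in> V - V'" using sub(1) by blast
    define h where "h v = (LEAST n. (par ^^ n) v \<in> V')" for v
    have h0: "h v = 0" if "v \<in> V'" for v using that by (simp add: h_def Least_eq_0)
    have hS: "h v = Suc (h (par v))" if v: "v \<in> V" "v \<notin> V'" for v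
    proof -
      obtain n where "(par ^^ n) v = q" using rooted_reaches[OF R v(1)] by blast
      then have "(par ^^ n) v \<in> V'" using q by simp
      then show ?thesis unfolding h_def using v(2)
        by (subst Least_Suc[of _ n]) (auto simp: funpow_swap1)
    qed
    have hstep: "h u \<le> Suc (h v)" if e: "{u, v} \<in> E" for u v
      using rooted_edge_cases[OF R e] hS[of u] hS[of v] h0[of u] h0[of v] par_V' by fastforce
    have hpath: "h (hd p) < length p" if "edge_path V E p" "last p \<in> V'" for p
      using that
    proof (induction p)
      case (Cons a p)
      show ?case
      proof (cases "p = []")
        case True
        then show ?thesis using Cons h0 by auto
      next
        case False
        then have "edge_path V E p" "last p \<in> V'" "{a, hd p} \<in> E"
          using Cons(2,3) by (auto simp: edge_path_def successively_Cons)
        then show ?thesis using Cons(1) hstep[of a "hd p"] by auto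
      qed
    qed (auto simp: edge_path_def)
    have hex: "\<exists>p. edge_path V E p \<and> hd p = v \<and> last p \<in> V' \<and> length p = Suc (h v)"
      if "v \<in> V" for v
      using R that
    proof (induction rule: rooted_induct)
      case root
      show ?case using q sub(1) h0[OF q]
        by (intro exI[of _ "[q]"]) (auto simp: edge_path_def)
    next
      case (step v)
      then obtain p where p: "edge_path V E p" "hd p = par v" "last p \<in> V'"
        "length p = Suc (h (par v))" by blast
      show ?case
      proof (cases "v \<in> V'")
        case True
        then show ?thesis using step(1) h0[OF True]
          by (intro exI[of _ "[v]"]) (auto simp: edge_path_def)
      next
        case False
        then show ?thesis using p step rooted_parent_edge[OF R step(1,2)] hS[OF step(1)]
          by (intro exI[of _ "v # p"]) (auto simp: edge_path_def successively_Cons)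
      qed
    qed
    have hle: "h (\<phi> g v) \<le> h v" if g: "g \<in> carrier G" and v: "v \<in> V" for g v
    proof -
      obtain p where p: "edge_path V E p" "hd p = v" "last p \<in> V'" "length p = Suc (h v)"
        using hex[OF v] by blast
      have "edge_path V E (map (\<phi> g) p)"
        using p(1) edge[OF g] actsD(1)[OF act g]
        by (auto simp: edge_path_def successively_map elim!: successively_mono)
      moreover have "hd (map (\<phi> g) p) = \<phi> g v" "last (map (\<phi> g) p) \<in> V'"
        using p invt[OF g] by (cases p; auto simp: last_map)+
      ultimately show ?thesis using hpath p(4) by fastforce
    qed
    have heq: "h (\<phi> g v) = h v" if g: "g \<in> carrier G" and v: "v \<in> V" for g v
      using hle[OF g v] hle[of "inv\<^bsub>G\<^esub> g" "\<phi> g v"] group.inv_closed[OF G g]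
        acts_inv(1)[OF G act g v] actsD(1)[OF act g v] by auto
    have child: "\<exists>y. y \<in> V - V' \<and> par y = z" if z: "z \<in> V - V'" for z
    proof -
      obtain u w where uw: "u \<noteq> w" "{z, u} \<in> E" "{z, w} \<in> E"
        using br[of z] z unfolding branches_def by blast
      then obtain y where y: "{z, y} \<in> E" "y \<noteq> par z" by metis
      then have "par y = z" "y \<in> V" using rooted_edge_cases[OF R y(1)] by auto
      then show ?thesis using par_V' z by blast
    qed
    \<comment> \<open>a walk away from the subtree, increasing the distance by 1 in every step\<close>
    define f where "f = rec_nat x (\<lambda>_ z. SOME y. y \<in> V - V' \<and> par y = z)"
    have f: "f n \<in> V - V' \<and> (n > 0 \<longrightarrow> par (f n) = f (n - 1))" for n
    proof (induction n)
      case (Suc n)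
      then show ?case using someI_ex[OF child[of "f n"]] by (simp add: f_def)
    qed (use x in \<open>simp add: f_def\<close>)
    have hf: "h (f n) = h x + n" for n
    proof (induction n)
      case (Suc n)
      have "par (f (Suc n)) = f n" using f[of "Suc n"] by simp
      then show ?case using Suc hS[of "f (Suc n)"] f[of "Suc n"] by simp
    qed (simp add: f_def)
    have "h x + n \<in> (\<lambda>d. Min (h ` d)) ` R" for n
    proof -
      have "{f (Suc n), f n} \<in> E"
        using rooted_parent_edge(1)[OF R, of "f (Suc n)"] f[of "Suc n"] q by auto
      then obtain g d where gd: "g \<in> carrier G" "d \<in> R" "{f (Suc n), f n} = \<phi> g ` d"
        using edge_transversalD(2)[OF fin(2)] by blast
      have "d \<subseteq> V" using gd(2) fin(2) R rooted_parent_edge(2)[OF R]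
        unfolding edge_transversal_def rooted_def by blast
      then have "h ` \<phi> g ` d = h ` d" unfolding image_image using heq[OF gd(1)] by (intro image_cong) auto
      then have "h ` d = {h x + Suc n, h x + n}" using gd(3) hf[of n] hf[of "Suc n"]
        by (metis image_empty image_insert)
      then have "Min (h ` d) = h x + n" by simp
      then show ?thesis using gd(2) by force
    qed
    then have "(\<lambda>n. h x + n) ` UNIV \<subseteq> (\<lambda>d. Min (h ` d)) ` R" by blast
    moreover have "infinite (range (\<lambda>n. h x + n))"
      using finite_imageD[of "\<lambda>n. h x + n" UNIV] by (auto simp: inj_on_def)
    ultimately show False using fin(1) finite_subset by blast
  qed
  moreover from this have "E \<subseteq> E'" using R par_edge unfolding rooted_def by auto
  ultimately show ?thesis using sub(2) by blast
qed

text \<open>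
  The translation into the notions of the theorem. The isomorphism \<open>\<theta>\<close> allows the free
  group of words to act in place of a group that has been constructed differently.
\<close>

lemma realise:
  assumes g: "good_action k n G V E \<phi>" and br: "\<And>v. v \<in> V \<Longrightarrow> branches E v"
    and H: "group H" and \<theta>: "\<theta> \<in> iso H G"
  defines "\<psi> \<equiv> \<lambda>h. restrict (\<phi> (\<theta> h)) V"
  shows "tree_action H V E \<psi>" "acylindrical k H V E \<psi>" "minimal_tree H V E \<psi>"
    "\<forall>e\<in>E. stabilizer H (edge_action \<psi>) e \<noteq> {\<one>\<^bsub>H\<^esub>}"
    "finite (quotient_edges H E \<psi>)" "card (quotient_edges H E \<psi>) = n"
proof -
  have T: "tree_acts G V E \<phi>" by (rule good_actionD(1)[OF g])
  have G: "group G" and act: "acts G V \<phi>"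
    and edge: "\<And>g u v. g \<in> carrier G \<Longrightarrow> {u, v} \<in> E \<Longrightarrow> {\<phi> g u, \<phi> g v} \<in> E"
    and noinv: "\<And>g u v. g \<in> carrier G \<Longrightarrow> {u, v} \<in> E \<Longrightarrow> \<not> (\<phi> g u = v \<and> \<phi> g v = u)"
    using tree_actsD[OF T] by auto
  obtain r par where R: "rooted r par V E" using tree_actsD(2)[OF T] by blast
  obtain D where D: "finite D" "card D = n" "edge_transversal G E \<phi> D"
    using good_actionD(4)[OF g] by blast
  have hom: "\<theta> \<in> hom H G" and bij: "bij_betw \<theta> (carrier H) (carrier G)"
    using \<theta> by (auto simp: iso_def)
  interpret \<theta>: group_hom H G \<theta> using H G hom by (simp add: group_hom_def group_hom_axioms_def)
  have surj: "\<exists>h\<in>carrier H. \<theta> h = g" if "g \<in> carrier G" for g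
    using bij that unfolding bij_betw_def by (metis imageE)
  have one: "\<theta> h = \<one>\<^bsub>G\<^esub> \<longleftrightarrow> h = \<one>\<^bsub>H\<^esub>" if "h \<in> carrier H" for h
    using bij that \<theta>.hom_one monoid.one_closed[OF group.is_monoid[OF H]] unfolding bij_betw_def inj_on_def by metis
  have EV: "e \<subseteq> V" "\<exists>u v. e = {u, v}" if "e \<in> E" for e
    using that R rooted_parent_edge(2)[OF R] unfolding rooted_def by auto
  have im: "\<psi> h ` e = \<phi> (\<theta> h) ` e" if "e \<in> E" for h e
    using EV(1)[OF that] unfolding \<psi>_def by (auto simp: image_iff)
  have \<psi>E: "\<psi> h ` e \<in> E" if h: "h \<in> carrier H" and "e \<in> E" for h e
    using im[OF that(2)] EV(2)[OF that(2)] edge[OF \<theta>.hom_closed[OF h]] that(2) by fastforce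
  have \<psi>act: "acts H V \<psi>"
    unfolding acts_def \<psi>_def using actsD[OF act] by simp
  have "\<psi> \<in> hom H (BijGroup V)"
  proof (rule homI)
    have B: "\<psi> h \<in> Bij V" if h: "h \<in> carrier H" for h
    proof -
      have "bij_betw (\<psi> h) V V"
        by (rule bij_betw_byWitness[where f' = "\<psi> (inv\<^bsub>H\<^esub> h)"])
          (use acts_inv[OF H \<psi>act h] actsD(1)[OF \<psi>act] h group.inv_closed[OF H h] in auto)
      then show ?thesis by (simp add: Bij_def \<psi>_def)
    qed
    fix h assume h: "h \<in> carrier H"
    show "\<psi> h \<in> carrier (BijGroup V)" using B[OF h] by (simp add: BijGroup_def)
    fix h' assume h': "h' \<in> carrier H"
    have "\<psi> (h \<otimes>\<^bsub>H\<^esub> h') = compose V (\<psi> h) (\<psi> h')"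
    proof (rule extensionalityI[where A = V])
      fix v assume "v \<in> V"
      then show "\<psi> (h \<otimes>\<^bsub>H\<^esub> h') v = compose V (\<psi> h) (\<psi> h') v"
        using actsD(3)[OF \<psi>act h h'] by (simp add: compose_def)
    qed (simp_all add: \<psi>_def)
    then show "\<psi> (h \<otimes>\<^bsub>H\<^esub> h') = \<psi> h \<otimes>\<^bsub>BijGroup V\<^esub> \<psi> h'"
      using B[OF h] B[OF h'] by (simp add: BijGroup_def)
  qed
  then have ga: "group_action H V \<psi>"
    using H group_BijGroup[of V] by (simp add: group_action_def group_hom_def group_hom_axioms_def)
  have ends: "\<psi> h u = \<phi> (\<theta> h) u \<and> \<psi> h v = \<phi> (\<theta> h) v" if "{u, v} \<in> E" for h u v
    using EV(1)[OF that] by (auto simp: \<psi>_def)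
  show "tree_action H V E \<psi>"
    unfolding tree_action_def
  proof (intro conjI ballI allI impI)
    fix h u v assume h: "h \<in> carrier H" and e: "{u, v} \<in> E"
    show "\<not> (\<psi> h u = v \<and> \<psi> h v = u)"
      using noinv[OF \<theta>.hom_closed[OF h] e] ends[OF e, of h] by simp
  qed (use tree_of_rooted[OF R] ga \<psi>E in auto)
  show "acylindrical k H V E \<psi>"
    unfolding acylindrical_def
  proof (intro allI impI, elim conjE)
    fix K p
    assume K: "subgroup K H" "K \<noteq> {\<one>\<^bsub>H\<^esub>}" and p: "reduced_path V E p"
      and fixp: "\<forall>h\<in>K. \<forall>e\<in>set (path_edges p). edge_action \<psi> h e = e"
    obtain h where h: "h \<in> K" "h \<noteq> \<one>\<^bsub>H\<^esub>" "h \<in> carrier H"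
      using K subgroup.one_closed[OF K(1)] subgroup.subset[OF K(1)] by blast
    have N: "no_backtrack E p" by (rule no_backtrack_of_reduced_path[OF R p])
    have e: "{p ! i, p ! Suc i} \<in> E" if "Suc i < length p" for i
      using N that by (auto simp: no_backtrack_def)
    have f: "\<phi> (\<theta> h) (p ! i) = p ! i \<and> \<phi> (\<theta> h) (p ! Suc i) = p ! Suc i"
      if i: "Suc i < length p" for i
    proof -
      have "{p ! i, p ! Suc i} \<in> set (path_edges p)"
        using i nth_mem[of i "path_edges p"] by (simp add: path_edges_conv)
      then have "\<psi> h ` {p ! i, p ! Suc i} = {p ! i, p ! Suc i}" using fixp h(1) by (metis)
      then have "{\<phi> (\<theta> h) (p ! i), \<phi> (\<theta> h) (p ! Suc i)} = {p ! i, p ! Suc i}"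
        using im[OF e[OF i]] by auto
      then show ?thesis using noinv[OF \<theta>.hom_closed[OF h(3)] e[OF i]]
        by (auto simp: doubleton_eq_iff)
    qed
    show "length (path_edges p) \<le> k"
    proof (cases "length p \<le> 1")
      case False
      have "\<phi> (\<theta> h) x = x" if x: "x \<in> set p" for x
      proof -
        obtain i where i: "i < length p" "x = p ! i" using x by (auto simp: in_set_conv_nth)
        show ?thesis using f[of i] f[of "i - 1"] i False by (cases "Suc i < length p") auto
      qed
      moreover have "\<theta> h \<in> carrier G" "\<theta> h \<noteq> \<one>\<^bsub>G\<^esub>" using h one by auto
      ultimately have "length p \<le> Suc k" using good_actionD(3)[OF g] N by simp
      then show ?thesis by (simp add: path_edges_conv)
    qed (simp add: path_edges_conv)
  qed
  show "minimal_tree H V E \<psi>"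
    unfolding minimal_tree_def
  proof (intro allI impI, elim conjE)
    fix V' E' assume V': "V' \<subseteq> V" "E' \<subseteq> E" "tree V' E'"
      "\<forall>g\<in>carrier H. (\<forall>v\<in>V'. \<psi> g v \<in> V') \<and> (\<forall>e\<in>E'. edge_action \<psi> g e \<in> E')"
    show "V' = V \<and> E' = E"
    proof (rule minimal_if_no_leaves[OF T D(1,3) br V'(1-3)])
      fix g v assume gv: "g \<in> carrier G" "v \<in> V'"
      obtain h where "h \<in> carrier H" "\<theta> h = g" using surj[OF gv(1)] by blast
      then show "\<phi> g v \<in> V'" using V' gv(2) by (force simp: \<psi>_def)
    qed
  qed
  show "\<forall>e\<in>E. stabilizer H (edge_action \<psi>) e \<noteq> {\<one>\<^bsub>H\<^esub>}"
  proof
    fix e assume e: "e \<in> E"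
    obtain u v where uv: "e = {u, v}" using EV(2)[OF e] by blast
    obtain x where x: "x \<in> carrier G" "x \<noteq> \<one>\<^bsub>G\<^esub>" "\<phi> x u = u" "\<phi> x v = v"
      using good_actionD(2)[OF g, of u v] e uv by blast
    obtain h where h: "h \<in> carrier H" "\<theta> h = x" using surj[OF x(1)] by blast
    have "\<psi> h ` e = e" using im[OF e] h x uv by simp
    then have "h \<in> stabilizer H (edge_action \<psi>) e" using h by (simp add: stabilizer_def)
    moreover have "h \<noteq> \<one>\<^bsub>H\<^esub>" using h x one by auto
    ultimately show "stabilizer H (edge_action \<psi>) e \<noteq> {\<one>\<^bsub>H\<^esub>}" by blast
  qed
  define O' where "O' d = orbit H (edge_action \<psi>) d" for d
  have DE: "D \<subseteq> E" using edge_transversalD(1)[OF D(3)] .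
  have O': "O' d = {\<phi> g ` d | g. g \<in> carrier G}" if "d \<in> E" for d
    unfolding O'_def orbit_def using im[OF that] surj \<theta>.hom_closed by (auto; metis)
  have trans: "\<phi> g ` \<phi> g' ` d = \<phi> (g \<otimes>\<^bsub>G\<^esub> g') ` d"
    if "g \<in> carrier G" "g' \<in> carrier G" "d \<in> E" for g g' d
    using actsD(3)[OF act that(1,2)] EV(1)[OF that(3)] by (auto simp: image_iff; force)
  have same: "O' (\<phi> g ` d) = O' d" if g: "g \<in> carrier G" and d: "d \<in> E" for g d
  proof -
    have gd: "\<phi> g ` d \<in> E" using EV(2)[OF d] edge[OF g] d by fastforce
    show ?thesis
    proof (intro equalityI subsetI)
      fix e assume "e \<in> O' (\<phi> g ` d)"
      then obtain g' where "g' \<in> carrier G" "e = \<phi> g' ` \<phi> g ` d" using O'[OF gd] by auto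
      then show "e \<in> O' d" using O'[OF d] trans[OF _ g d] group.is_monoid[OF G] g
        monoid.m_closed by fastforce
    next
      fix e assume "e \<in> O' d"
      then obtain g' where g': "g' \<in> carrier G" "e = \<phi> g' ` d" using O'[OF d] by auto
      have "\<phi> (g' \<otimes>\<^bsub>G\<^esub> inv\<^bsub>G\<^esub> g) ` \<phi> g ` d = e"
        using g' g d trans[of "g' \<otimes>\<^bsub>G\<^esub> inv\<^bsub>G\<^esub> g" g d] G
        by (simp add: group.inv_closed group.is_monoid monoid.m_closed monoid.m_assoc group.l_inv)
      then show "e \<in> O' (\<phi> g ` d)"
        using O'[OF gd] g' g G by (auto intro!: exI[of _ "g' \<otimes>\<^bsub>G\<^esub> inv\<^bsub>G\<^esub> g"]
          simp: group.inv_closed group.is_monoid monoid.m_closed)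
    qed
  qed
  have "quotient_edges H E \<psi> = O' ` D"
  proof (intro equalityI subsetI)
    fix q assume "q \<in> quotient_edges H E \<psi>"
    then obtain e where e: "e \<in> E" "q = O' e"
      unfolding quotient_edges_def orbits_def O'_def by auto
    then obtain g d where gd: "g \<in> carrier G" "d \<in> D" "e = \<phi> g ` d"
      using edge_transversalD(2)[OF D(3)] e(1) by metis
    then show "q \<in> O' ` D" using e same[OF gd(1), of d] DE by auto
  qed (use DE in \<open>auto simp: quotient_edges_def orbits_def O'_def\<close>)
  moreover have "inj_on O' D"
  proof (rule inj_onI)
    fix d d' assume d: "d \<in> D" "d' \<in> D" "O' d = O' d'"
    have "\<phi> \<one>\<^bsub>G\<^esub> ` d' = d'" using actsD(2)[OF act] EV(1)[of d'] d DE by (auto simp: image_iff; force)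
    then have "d' \<in> O' d'" using O'[of d'] d DE group.is_monoid[OF G] monoid.one_closed by blast
    then obtain g where "g \<in> carrier G" "d' = \<phi> g ` d" using O'[of d] d DE by auto
    then show "d = d'" using d edge_transversalD(3)[OF D(3)] by metis
  qed
  ultimately show "finite (quotient_edges H E \<psi>)" "card (quotient_edges H E \<psi>) = n"
    using D(1,2) by (simp_all add: card_image)
qed

section \<open>The free product with an infinite cyclic group\<close>

text \<open>
  Normal forms for the free product of \<open>G\<close> with an infinite cyclic group \<open>\<langle>t\<rangle>\<close>: the word
  \<open>[(a\<^sub>1, e\<^sub>1), \<dots>, (a\<^sub>n, e\<^sub>n)]\<close> stands for the product of the syllables \<open>a\<^sub>i t\<close> (if \<open>e\<^sub>i\<close>) or
  \<open>a\<^sub>i t\<inverse>\<close> (otherwise), and no factor \<open>t 1 t\<inverse>\<close> or \<open>t\<inverse> 1 t\<close> occurs. These products represent the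
  cosets of \<open>G\<close>, each once.
\<close>

definition syllable_words :: "('g, 'b) monoid_scheme \<Rightarrow> ('g \<times> bool) list set"
  where "syllable_words G =
    {w. fst ` set w \<subseteq> carrier G \<and> successively (\<lambda>x y. y \<noteq> (\<one>\<^bsub>G\<^esub>, \<not> snd x)) w}"

text \<open>
  The pairs \<open>(w, x)\<close> with \<open>x\<close> in a \<open>G\<close>-set \<open>X\<close> form the \<open>(G * \<langle>t\<rangle>)\<close>-set induced from \<open>X\<close>. For
  \<open>X = G\<close> they are the elements of the free product, and for a tree \<open>X\<close> they are the points of
  disjoint copies of it, one for every coset of \<open>G\<close>. The functions \<open>left_mul\<close>, \<open>letter_mul\<close> and
  \<open>word_act\<close> are the actions of elements of \<open>G\<close>, of \<open>t\<close> or \<open>t\<inverse>\<close>, and of arbitrary elements.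
\<close>

fun left_mul :: "('g, 'b) monoid_scheme \<Rightarrow> ('g \<Rightarrow> 'x \<Rightarrow> 'x) \<Rightarrow> 'g \<Rightarrow>
    ('g \<times> bool) list \<times> 'x \<Rightarrow> ('g \<times> bool) list \<times> 'x"
  where
    "left_mul G \<phi> g ([], x) = ([], \<phi> g x)"
  | "left_mul G \<phi> g ((a, e) # w, x) = ((g \<otimes>\<^bsub>G\<^esub> a, e) # w, x)"

fun letter_mul :: "('g, 'b) monoid_scheme \<Rightarrow> bool \<Rightarrow>
    ('g \<times> bool) list \<times> 'x \<Rightarrow> ('g \<times> bool) list \<times> 'x"
  where
    "letter_mul G e ([], x) = ([(\<one>\<^bsub>G\<^esub>, e)], x)"
  | "letter_mul G e (y # w, x) = (if y = (\<one>\<^bsub>G\<^esub>, \<not> e) then (w, x) else ((\<one>\<^bsub>G\<^esub>, e) # y # w, x))"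

definition word_act :: "('g, 'b) monoid_scheme \<Rightarrow> ('g \<Rightarrow> 'x \<Rightarrow> 'x) \<Rightarrow>
    ('g \<times> bool) list \<times> 'g \<Rightarrow> ('g \<times> bool) list \<times> 'x \<Rightarrow> ('g \<times> bool) list \<times> 'x"
  where "word_act G \<phi> \<gamma> z =
    foldr (\<lambda>(a, e) z. left_mul G \<phi> a (letter_mul G e z)) (fst \<gamma>) (left_mul G \<phi> (snd \<gamma>) z)"

definition adjoin :: "('g, 'b) monoid_scheme \<Rightarrow> (('g \<times> bool) list \<times> 'g) monoid"
  where "adjoin G =
    \<lparr>carrier = syllable_words G \<times> carrier G, monoid.mult = word_act G (monoid.mult G), one = ([], \<one>\<^bsub>G\<^esub>)\<rparr>"

lemma syllable_words_Cons:
  "(a, e) # w \<in> syllable_words G \<longleftrightarrow>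
    a \<in> carrier G \<and> w \<in> syllable_words G \<and> (w = [] \<or> hd w \<noteq> (\<one>\<^bsub>G\<^esub>, \<not> e))"
  by (auto simp: syllable_words_def successively_Cons)

lemma syllable_words_Nil [simp]: "[] \<in> syllable_words G"
  by (simp add: syllable_words_def)

lemma syllable_words_append:
  assumes "w \<in> syllable_words G" "u \<in> syllable_words G" "w = [] \<or> u = [] \<or> hd u \<noteq> (\<one>\<^bsub>G\<^esub>, \<not> snd (last w))"
  shows "w @ u \<in> syllable_words G"
  using assms by (auto simp: syllable_words_def successively_append_iff)

lemma syllable_words_appendD: "w @ u \<in> syllable_words G \<Longrightarrow> w \<in> syllable_words G \<and> u \<in> syllable_words G"
  by (auto simp: syllable_words_def successively_append_iff)

lemma syl_pair_cases [case_names Nil Cons]: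
  obtains x where "z = ([], x)" | a e w x where "z = ((a, e) # w, x)"
  by (cases z; cases "fst z") auto

lemma word_act_Nil: "word_act G \<phi> ([], g) z = left_mul G \<phi> g z"
  by (simp add: word_act_def)

lemma word_act_Cons: "word_act G \<phi> ((a, e) # w, g) z = left_mul G \<phi> a (letter_mul G e (word_act G \<phi> (w, g) z))"
  by (simp add: word_act_def)

context group
begin

lemma acts_self: "acts G (carrier G) (monoid.mult G)"
  by (simp add: acts_def m_assoc)

lemma left_mul_closed:
  assumes "acts G X \<phi>" "g \<in> carrier G" "z \<in> syllable_words G \<times> X"
  shows "left_mul G \<phi> g z \<in> syllable_words G \<times> X"
  using assms(3) actsD(1)[OF assms(1,2)] assms(2)
  by (cases z rule: syl_pair_cases) (auto simp: syllable_words_Cons)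

lemma letter_mul_closed:
  assumes "z \<in> syllable_words G \<times> X"
  shows "letter_mul G e z \<in> syllable_words G \<times> X"
  using assms
  by (cases z rule: syl_pair_cases) (auto simp: syllable_words_Cons split: prod.splits)

lemma left_mul_one:
  assumes "acts G X \<phi>" "z \<in> syllable_words G \<times> X"
  shows "left_mul G \<phi> \<one> z = z"
  using assms(2) actsD(2)[OF assms(1)]
  by (cases z rule: syl_pair_cases) (auto simp: syllable_words_Cons)

lemma left_mul_mult:
  assumes "acts G X \<phi>" "g \<in> carrier G" "h \<in> carrier G" "z \<in> syllable_words G \<times> X"
  shows "left_mul G \<phi> (g \<otimes> h) z = left_mul G \<phi> g (left_mul G \<phi> h z)"
  using assms(2-4) actsD(3)[OF assms(1)]
  by (cases z rule: syl_pair_cases) (auto simp: syllable_words_Cons m_assoc)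

lemma letter_mul_letter_mul:
  assumes "z \<in> syllable_words G \<times> X"
  shows "letter_mul G (\<not> e) (letter_mul G e z) = z" "letter_mul G e (letter_mul G (\<not> e) z) = z"
proof -
  have *: "letter_mul G (\<not> e) (letter_mul G e z) = z" for e
  proof (cases z rule: syl_pair_cases)
    case (Cons a f w x)
    then show ?thesis using assms by (cases w) (auto simp: syllable_words_Cons)
  qed auto
  from *[of e] *[of "\<not> e"] show "letter_mul G (\<not> e) (letter_mul G e z) = z" "letter_mul G e (letter_mul G (\<not> e) z) = z"
    by auto
qed

lemma word_act_closed:
  assumes "acts G X \<phi>" "\<gamma> \<in> syllable_words G \<times> carrier G" "z \<in> syllable_words G \<times> X"
  shows "word_act G \<phi> \<gamma> z \<in> syllable_words G \<times> X"
proof (cases \<gamma>)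
  case (Pair w g)
  have "w \<in> syllable_words G \<Longrightarrow> g \<in> carrier G \<Longrightarrow> word_act G \<phi> (w, g) z \<in> syllable_words G \<times> X"
  proof (induction w)
    case Nil
    then show ?case using left_mul_closed[OF assms(1) _ assms(3)] by (simp add: word_act_Nil)
  next
    case (Cons y w)
    then show ?case
      by (cases y) (simp add: word_act_Cons syllable_words_Cons left_mul_closed[OF assms(1)] letter_mul_closed)
  qed
  then show ?thesis using assms(2) Pair by auto
qed

lemma word_act_normal_form:
  assumes "w \<in> syllable_words G" "g \<in> carrier G" "x \<in> X" "acts G X \<phi>"
  shows "word_act G \<phi> (w, g) ([], x) = (w, \<phi> g x)"
  using assms(1)
proof (induction w)
  case (Cons y w)
  then show ?case
    by (cases y; cases w) (auto simp: word_act_Cons syllable_words_Cons)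
qed (simp add: word_act_Nil)

lemma word_act_left_mul:
  assumes "acts G X \<phi>" "a \<in> carrier G" "\<gamma> \<in> syllable_words G \<times> carrier G" "z \<in> syllable_words G \<times> X"
  shows "word_act G \<phi> (left_mul G (monoid.mult G) a \<gamma>) z = left_mul G \<phi> a (word_act G \<phi> \<gamma> z)"
proof (cases \<gamma>)
  case (Pair w g)
  show ?thesis
  proof (cases w)
    case Nil
    then show ?thesis using Pair assms by (simp add: word_act_Nil left_mul_mult)
  next
    case (Cons y u)
    obtain b e where y: "y = (b, e)" by fastforce
    have "letter_mul G e (word_act G \<phi> (u, g) z) \<in> syllable_words G \<times> X"
      using assms Pair Cons y by (intro letter_mul_closed word_act_closed) (auto simp: syllable_words_Cons)
    then show ?thesis using Pair Cons y assms by (simp add: word_act_Cons left_mul_mult syllable_words_Cons)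
  qed
qed

lemma word_act_letter_mul:
  assumes "acts G X \<phi>" "\<gamma> \<in> syllable_words G \<times> carrier G" "z \<in> syllable_words G \<times> X"
  shows "word_act G \<phi> (letter_mul G e \<gamma>) z = letter_mul G e (word_act G \<phi> \<gamma> z)"
proof (cases \<gamma>)
  case (Pair w g)
  have one: "left_mul G \<phi> \<one> (letter_mul G e' (word_act G \<phi> (u, g) z)) = letter_mul G e' (word_act G \<phi> (u, g) z)"
    if "u \<in> syllable_words G" for u e'
    using assms Pair that by (intro left_mul_one[OF assms(1)] letter_mul_closed word_act_closed) auto
  show ?thesis
  proof (cases "w \<noteq> [] \<and> hd w = (\<one>, \<not> e)")
    case True
    then obtain u where u: "w = (\<one>, \<not> e) # u" by (cases w) auto
    then have us: "u \<in> syllable_words G" using assms(2) Pair by (simp add: syllable_words_Cons)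
    then have "letter_mul G e (letter_mul G (\<not> e) (word_act G \<phi> (u, g) z)) = word_act G \<phi> (u, g) z"
      using assms Pair by (intro letter_mul_letter_mul(2)[where X = X] word_act_closed) auto
    then show ?thesis using Pair u one[OF us] by (simp add: word_act_Cons)
  next
    case False
    then have "letter_mul G e (w, g) = ((\<one>, e) # w, g)" by (cases w) auto
    then show ?thesis using Pair one[of w e] assms(2) by (simp add: word_act_Cons)
  qed
qed

text \<open>
  For \<open>X = G\<close> this is associativity in the free product, in general the law of an action; it
  holds since multiplications by syllables commute with the action of the right factor.
\<close>

lemma word_act_word_act:
  assumes "acts G X \<phi>" "\<gamma> \<in> syllable_words G \<times> carrier G" "\<delta> \<in> syllable_words G \<times> carrier G"
    "z \<in> syllable_words G \<times> X"
  shows "word_act G \<phi> (word_act G (monoid.mult G) \<gamma> \<delta>) z = word_act G \<phi> \<gamma> (word_act G \<phi> \<delta> z)"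
proof (cases \<gamma>)
  case (Pair w g)
  have "w \<in> syllable_words G \<Longrightarrow> ?thesis" unfolding Pair
  proof (induction w)
    case Nil
    then show ?case using assms Pair by (simp add: word_act_Nil word_act_left_mul)
  next
    case (Cons y w)
    obtain a e where y: "y = (a, e)" by fastforce
    have "word_act G (monoid.mult G) (w, g) \<delta> \<in> syllable_words G \<times> carrier G"
      using Cons Pair y assms by (intro word_act_closed acts_self) (auto simp: syllable_words_Cons)
    then show ?case using Cons y assms
      by (simp add: word_act_Cons word_act_left_mul[OF assms(1)] word_act_letter_mul[OF assms(1)] letter_mul_closed syllable_words_Cons)
  qed
  then show ?thesis using assms(2) Pair by auto
qed

lemma carrier_adjoin: "carrier (adjoin G) = syllable_words G \<times> carrier G"
  by (simp add: adjoin_def)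

lemma one_adjoin: "\<one>\<^bsub>adjoin G\<^esub> = ([], \<one>)"
  by (simp add: adjoin_def)

lemma mult_adjoin: "\<gamma> \<otimes>\<^bsub>adjoin G\<^esub> \<delta> = word_act G (monoid.mult G) \<gamma> \<delta>"
  by (simp add: adjoin_def)

lemma one_in_adjoin: "([], \<one>) \<in> syllable_words G \<times> carrier G"
  by simp

lemma word_act_one_right:
  assumes "\<gamma> \<in> syllable_words G \<times> carrier G"
  shows "word_act G (monoid.mult G) \<gamma> ([], \<one>) = \<gamma>"
  using assms word_act_normal_form[OF _ _ one_closed acts_self] by (cases \<gamma>) auto

lemma adjoin_induct [consumes 1, case_names base syl]:
  assumes "\<gamma> \<in> syllable_words G \<times> carrier G"
    and "\<And>g. g \<in> carrier G \<Longrightarrow> P ([], g)"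
    and "\<And>a e \<gamma>. a \<in> carrier G \<Longrightarrow> \<gamma> \<in> syllable_words G \<times> carrier G \<Longrightarrow> P \<gamma> \<Longrightarrow>
      P (left_mul G (monoid.mult G) a (letter_mul G e \<gamma>))"
  shows "P \<gamma>"
proof (cases \<gamma>)
  case (Pair w g)
  have "w \<in> syllable_words G \<Longrightarrow> P (w, g)"
  proof (induction w)
    case Nil
    then show ?case using assms(1,2) Pair by auto
  next
    case (Cons y w)
    obtain a e where y: "y = (a, e)" by fastforce
    have "left_mul G (monoid.mult G) a (letter_mul G e (w, g)) = ((a, e) # w, g)"
      using Cons(2) y by (cases w) (auto simp: syllable_words_Cons)
    then show ?case using assms(3)[of a "(w, g)" e] Cons y assms(1) Pair
      by (auto simp: syllable_words_Cons)
  qed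
  then show ?thesis using assms(1) Pair by auto
qed

lemma group_adjoin: "group (adjoin G)"
proof (rule groupI; unfold carrier_adjoin mult_adjoin one_adjoin)
  note self = acts_self
  fix \<gamma> assume \<gamma>: "\<gamma> \<in> syllable_words G \<times> carrier G"
  show "word_act G (\<otimes>) ([], \<one>) \<gamma> = \<gamma>" using left_mul_one[OF self \<gamma>] by (simp add: word_act_Nil)
  show "\<exists>\<delta>\<in>syllable_words G \<times> carrier G. word_act G (\<otimes>) \<delta> \<gamma> = ([], \<one>)" using \<gamma>
  proof (induction rule: adjoin_induct)
    case (base g)
    then show ?case by (intro bexI[of _ "([], inv g)"]) (auto simp: word_act_Nil)
  next
    case (syl a e \<gamma>)
    then obtain \<delta> where \<delta>: "\<delta> \<in> syllable_words G \<times> carrier G" "word_act G (\<otimes>) \<delta> \<gamma> = ([], \<one>)" by blast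
    let ?l = "letter_mul G (\<not> e) (left_mul G (\<otimes>) (inv a) ([], \<one>))"
    let ?z = "left_mul G (\<otimes>) a (letter_mul G e \<gamma>)"
    have t: "letter_mul G e \<gamma> \<in> syllable_words G \<times> carrier G" by (rule letter_mul_closed[OF syl(2)])
    have z: "?z \<in> syllable_words G \<times> carrier G" by (rule left_mul_closed[OF self syl(1) t])
    have l: "left_mul G (\<otimes>) (inv a) ([], \<one>) \<in> syllable_words G \<times> carrier G" using syl(1) by simp
    have "word_act G (\<otimes>) (word_act G (\<otimes>) \<delta> ?l) ?z = word_act G (\<otimes>) \<delta> (word_act G (\<otimes>) ?l ?z)"
      by (rule word_act_word_act[OF self \<delta>(1) letter_mul_closed[OF l] z])
    also have "word_act G (\<otimes>) ?l ?z = letter_mul G (\<not> e) (left_mul G (\<otimes>) (inv a) (word_act G (\<otimes>) ([], \<one>) ?z))"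
      unfolding word_act_letter_mul[OF self l z] word_act_left_mul[OF self inv_closed[OF syl(1)] one_in_adjoin z] ..
    also have "\<dots> = letter_mul G (\<not> e) (left_mul G (\<otimes>) (inv a \<otimes> a) (letter_mul G e \<gamma>))"
      using left_mul_mult[OF self _ _ t, of "inv a" a] left_mul_one[OF self z] syl(1) by (simp add: word_act_Nil)
    also have "\<dots> = \<gamma>" using left_mul_one[OF self t] syl(1) letter_mul_letter_mul(1)[OF syl(2)] by simp
    finally show ?case using \<delta> word_act_closed[OF self \<delta>(1) letter_mul_closed[OF l]] by metis
  qed
next
  fix \<gamma> \<delta> assume "\<gamma> \<in> syllable_words G \<times> carrier G" "\<delta> \<in> syllable_words G \<times> carrier G"
  then show "word_act G (\<otimes>) \<gamma> \<delta> \<in> syllable_words G \<times> carrier G" by (rule word_act_closed[OF acts_self])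
next
  fix \<gamma> \<delta> \<epsilon>
  assume "\<gamma> \<in> syllable_words G \<times> carrier G" "\<delta> \<in> syllable_words G \<times> carrier G" "\<epsilon> \<in> syllable_words G \<times> carrier G"
  then show "word_act G (\<otimes>) (word_act G (\<otimes>) \<gamma> \<delta>) \<epsilon> = word_act G (\<otimes>) \<gamma> (word_act G (\<otimes>) \<delta> \<epsilon>)"
    by (rule word_act_word_act[OF acts_self])
qed simp

lemma acts_adjoin:
  assumes "acts G X \<phi>"
  shows "acts (adjoin G) (syllable_words G \<times> X) (word_act G \<phi>)"
  unfolding acts_def carrier_adjoin mult_adjoin one_adjoin
  using word_act_closed[OF assms] left_mul_one[OF assms] word_act_word_act[OF assms] by (auto simp: word_act_Nil)

lemma word_act_stable_letter:
  assumes "acts G X \<phi>" "z \<in> syllable_words G \<times> X"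
  shows "word_act G \<phi> ([(\<one>, e)], \<one>) z = letter_mul G e z"
  using left_mul_one[OF assms] left_mul_one[OF assms(1) letter_mul_closed[OF assms(2)]]
  by (simp add: word_act_Cons word_act_Nil)

lemma stable_letter_cancel:
  "([(\<one>, False)], \<one>) \<otimes>\<^bsub>adjoin G\<^esub> ([(\<one>, True)], \<one>) = \<one>\<^bsub>adjoin G\<^esub>"
  by (simp add: mult_adjoin one_adjoin word_act_Cons word_act_Nil)

text \<open>
  The word \<open>w\<close> is the coset of \<open>(w, \<one>)\<close>, so an equation \<open>h \<otimes>\<^bsub>adjoin G\<^esub> (w, \<one>) = (w', g)\<close> says
  that \<open>h\<close> maps the coset \<open>w\<close> to the coset \<open>w'\<close>, moving its points by \<open>g\<close>.
\<close>

lemma base_copy: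
  assumes "w \<in> syllable_words G" "g \<in> carrier G"
  shows "(w, g) \<otimes>\<^bsub>adjoin G\<^esub> ([], \<one>) = (w, g)" "(w, \<one>) \<otimes>\<^bsub>adjoin G\<^esub> ([], g) = (w, g)"
  using word_act_one_right[of "(w, g)"] word_act_normal_form[OF assms(1) one_closed assms(2) acts_self] assms
  by (auto simp: mult_adjoin)

text \<open>
  A conjugate of \<open>h\<close> lies in \<open>G\<close> and fixes a coset with non-empty normal form; but it multiplies
  the first syllable of this normal form, so it is trivial.
\<close>

lemma base_malnormal:
  assumes h: "h \<in> carrier (adjoin G)" and w: "w\<^sub>1 \<in> syllable_words G" "w\<^sub>2 \<in> syllable_words G" "w\<^sub>1 \<noteq> w\<^sub>2"
    and g: "g\<^sub>1 \<in> carrier G" "g\<^sub>2 \<in> carrier G"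
    and e: "h \<otimes>\<^bsub>adjoin G\<^esub> (w\<^sub>1, \<one>) = (w\<^sub>1, g\<^sub>1)" "h \<otimes>\<^bsub>adjoin G\<^esub> (w\<^sub>2, \<one>) = (w\<^sub>2, g\<^sub>2)"
  shows "h = \<one>\<^bsub>adjoin G\<^esub>"
proof -
  interpret K: group "adjoin G" by (rule group_adjoin)
  have c: "(w\<^sub>1, \<one>) \<in> carrier (adjoin G)" "(w\<^sub>2, \<one>) \<in> carrier (adjoin G)"
    "([], g\<^sub>1) \<in> carrier (adjoin G)" "([], g\<^sub>2) \<in> carrier (adjoin G)"
    using w g by (auto simp: carrier_adjoin)
  \<comment> \<open>conjugation by the first coset moves it to the coset of the unit\<close>
  define \<delta> where "\<delta> = inv\<^bsub>adjoin G\<^esub> (w\<^sub>1, \<one>) \<otimes>\<^bsub>adjoin G\<^esub> (w\<^sub>2, \<one>)"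
  have \<delta>: "\<delta> \<in> carrier (adjoin G)" using c by (simp add: \<delta>_def)
  have w2: "(w\<^sub>2, \<one>) = (w\<^sub>1, \<one>) \<otimes>\<^bsub>adjoin G\<^esub> \<delta>" unfolding \<delta>_def using c by (simp add: K.m_assoc[symmetric])
  have e1: "h \<otimes>\<^bsub>adjoin G\<^esub> (w\<^sub>1, \<one>) = (w\<^sub>1, \<one>) \<otimes>\<^bsub>adjoin G\<^esub> ([], g\<^sub>1)"
    using e(1) base_copy(2)[OF w(1) g(1)] by simp
  have e2: "h \<otimes>\<^bsub>adjoin G\<^esub> (w\<^sub>2, \<one>) = (w\<^sub>2, \<one>) \<otimes>\<^bsub>adjoin G\<^esub> ([], g\<^sub>2)"
    using e(2) base_copy(2)[OF w(2) g(2)] by simp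
  have "(w\<^sub>1, \<one>) \<otimes>\<^bsub>adjoin G\<^esub> (([], g\<^sub>1) \<otimes>\<^bsub>adjoin G\<^esub> \<delta>) = (w\<^sub>1, \<one>) \<otimes>\<^bsub>adjoin G\<^esub> (\<delta> \<otimes>\<^bsub>adjoin G\<^esub> ([], g\<^sub>2))"
    using e2 e1 w2 c \<delta> h by (metis K.m_assoc)
  then have eq: "([], g\<^sub>1) \<otimes>\<^bsub>adjoin G\<^esub> \<delta> = \<delta> \<otimes>\<^bsub>adjoin G\<^esub> ([], g\<^sub>2)"
    by (rule iffD1[OF K.Units_l_cancel, rotated 3]) (use c \<delta> in simp_all)
  obtain u x where u: "\<delta> = (u, x)" "u \<in> syllable_words G" "x \<in> carrier G"
    using \<delta> by (auto simp: carrier_adjoin)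
  have "left_mul G (\<otimes>) g\<^sub>1 (u, x) = (u, x \<otimes> g\<^sub>2)"
    using eq u g word_act_normal_form[OF u(2,3) g(2) acts_self] by (simp add: mult_adjoin word_act_Nil)
  moreover have "u \<noteq> []"
  proof
    assume "u = []"
    then have "(w\<^sub>2, \<one>) = (w\<^sub>1, x)" using w2 u base_copy(2)[OF w(1) u(3)] by simp
    then show False using w(3) by simp
  qed
  ultimately have "g\<^sub>1 = \<one>" using u(2) g by (cases u) (auto simp: syllable_words_Cons)
  then have "h \<otimes>\<^bsub>adjoin G\<^esub> (w\<^sub>1, \<one>) = \<one>\<^bsub>adjoin G\<^esub> \<otimes>\<^bsub>adjoin G\<^esub> (w\<^sub>1, \<one>)" using e(1) c by simp
  then show ?thesis by (rule iffD1[OF K.right_cancel[OF c(1) h K.one_closed]])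
qed

lemma embed_hom: "(\<lambda>g. ([], g)) \<in> hom G (adjoin G)"
  by (rule homI) (simp_all add: carrier_adjoin mult_adjoin word_act_Nil)

end

text \<open>
  The homomorphism from the free product that extends \<open>\<psi>\<close> and maps \<open>t\<close> to \<open>q\<close>.
\<close>

definition lift :: "('q, 'b) monoid_scheme \<Rightarrow> ('g \<Rightarrow> 'q) \<Rightarrow> 'q \<Rightarrow> ('g \<times> bool) list \<times> 'g \<Rightarrow> 'q"
  where "lift Q \<psi> q \<gamma> =
    foldr (\<lambda>(a, e) y. \<psi> a \<otimes>\<^bsub>Q\<^esub> ((if e then q else inv\<^bsub>Q\<^esub> q) \<otimes>\<^bsub>Q\<^esub> y)) (fst \<gamma>) (\<psi> (snd \<gamma>))"

lemma lift_simps: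
  "lift Q \<psi> q ([], g) = \<psi> g"
  "lift Q \<psi> q ((a, e) # w, g) =
    \<psi> a \<otimes>\<^bsub>Q\<^esub> ((if e then q else inv\<^bsub>Q\<^esub> q) \<otimes>\<^bsub>Q\<^esub> lift Q \<psi> q (w, g))"
  by (simp_all add: lift_def)

lemma lift_hom:
  fixes G (structure)
  assumes G: "group G" and Q: "group Q" and \<psi>: "\<psi> \<in> hom G Q" and q: "q \<in> carrier Q"
  shows "lift Q \<psi> q \<in> hom (adjoin G) Q"
proof -
  interpret G: group G by fact
  interpret Q: group Q by fact
  interpret \<psi>: group_hom G Q \<psi> by unfold_locales (rule \<psi>)
  let ?t = "\<lambda>e. if e then q else inv\<^bsub>Q\<^esub> q"
  have t: "?t e \<in> carrier Q" for e using q by simp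
  have cl: "lift Q \<psi> q \<gamma> \<in> carrier Q" if "\<gamma> \<in> syllable_words G \<times> carrier G" for \<gamma>
  proof (cases \<gamma>)
    case (Pair w g)
    have "w \<in> syllable_words G \<Longrightarrow> g \<in> carrier G \<Longrightarrow> lift Q \<psi> q (w, g) \<in> carrier Q"
    proof (induction w)
      case (Cons y w)
      then show ?case using t by (cases y) (simp add: lift_simps syllable_words_Cons q)
    qed (simp add: lift_simps)
    then show ?thesis using that Pair by auto
  qed
  have L: "lift Q \<psi> q (left_mul G (\<otimes>) a \<gamma>) = \<psi> a \<otimes>\<^bsub>Q\<^esub> lift Q \<psi> q \<gamma>"
    if a: "a \<in> carrier G" and \<gamma>: "\<gamma> \<in> syllable_words G \<times> carrier G" for a \<gamma>
  proof (cases \<gamma> rule: syl_pair_cases)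
    case (Cons b e w g)
    then have "lift Q \<psi> q (w, g) \<in> carrier Q" using \<gamma> by (intro cl) (auto simp: syllable_words_Cons)
    then show ?thesis using Cons \<gamma> a q by (simp add: lift_simps syllable_words_Cons Q.m_assoc)
  qed (use a \<gamma> in \<open>simp add: lift_simps\<close>)
  have T: "lift Q \<psi> q (letter_mul G e \<gamma>) = ?t e \<otimes>\<^bsub>Q\<^esub> lift Q \<psi> q \<gamma>"
    if \<gamma>: "\<gamma> \<in> syllable_words G \<times> carrier G" for e \<gamma>
  proof (cases \<gamma> rule: syl_pair_cases)
    case (Nil x)
    then show ?thesis using \<gamma> q by (simp add: lift_simps)
  next
    case (Cons a f w g)
    show ?thesis
    proof (cases "(a, f) = (\<one>, \<not> e)")
      case True
      have w: "lift Q \<psi> q (w, g) \<in> carrier Q"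
        using Cons True \<gamma> by (intro cl) (auto simp: syllable_words_Cons)
      have "lift Q \<psi> q \<gamma> = ?t (\<not> e) \<otimes>\<^bsub>Q\<^esub> lift Q \<psi> q (w, g)"
        using Cons True w q by (simp add: lift_simps)
      moreover have "?t e \<otimes>\<^bsub>Q\<^esub> (?t (\<not> e) \<otimes>\<^bsub>Q\<^esub> z) = z" if "z \<in> carrier Q" for z
        using that q by (simp add: Q.m_assoc[symmetric])
      moreover have "letter_mul G e \<gamma> = (w, g)" using Cons True by simp
      ultimately show ?thesis using w by metis
    next
      case False
      have "lift Q \<psi> q ((a, f) # w, g) \<in> carrier Q" using cl[OF \<gamma>] Cons by simp
      moreover have "letter_mul G e \<gamma> = ((\<one>, e) # (a, f) # w, g)" using Cons False by auto
      ultimately show ?thesis using Cons t[of e] by (simp add: lift_simps(2)[of _ _ _ "\<one>"])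
    qed
  qed
  show ?thesis
  proof (rule homI; unfold G.carrier_adjoin G.mult_adjoin)
    fix \<gamma> \<delta> assume \<gamma>: "\<gamma> \<in> syllable_words G \<times> carrier G" and \<delta>: "\<delta> \<in> syllable_words G \<times> carrier G"
    obtain w g where wg: "\<gamma> = (w, g)" by fastforce
    have "w \<in> syllable_words G \<Longrightarrow>
      lift Q \<psi> q (word_act G (\<otimes>) (w, g) \<delta>) = lift Q \<psi> q (w, g) \<otimes>\<^bsub>Q\<^esub> lift Q \<psi> q \<delta>"
    proof (induction w)
      case Nil
      then show ?case using \<gamma> \<delta> wg L by (auto simp: word_act_Nil lift_simps)
    next
      case (Cons y w)
      obtain a e where y: "y = (a, e)" by fastforce
      have w: "(w, g) \<in> syllable_words G \<times> carrier G" using Cons(2) y \<gamma> wg by (auto simp: syllable_words_Cons)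
      have p: "word_act G (\<otimes>) (w, g) \<delta> \<in> syllable_words G \<times> carrier G"
        by (rule G.word_act_closed[OF G.acts_self w \<delta>])
      have "a \<in> carrier G" using Cons(2) y by (simp add: syllable_words_Cons)
      then have "lift Q \<psi> q (word_act G (\<otimes>) (y # w, g) \<delta>) =
          \<psi> a \<otimes>\<^bsub>Q\<^esub> (?t e \<otimes>\<^bsub>Q\<^esub> (lift Q \<psi> q (w, g) \<otimes>\<^bsub>Q\<^esub> lift Q \<psi> q \<delta>))"
        unfolding y word_act_Cons using L G.letter_mul_closed[OF p] T[OF p] Cons w by simp
      moreover have "lift Q \<psi> q (y # w, g) = \<psi> a \<otimes>\<^bsub>Q\<^esub> (?t e \<otimes>\<^bsub>Q\<^esub> lift Q \<psi> q (w, g))"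
        by (simp add: lift_simps y)
      ultimately show ?case using \<open>a \<in> carrier G\<close> cl[OF w] cl[OF \<delta>] t[of e]
        by (simp add: Q.m_assoc del: if_split)
    qed
    then show "lift Q \<psi> q (word_act G (\<otimes>) \<gamma> \<delta>) = lift Q \<psi> q \<gamma> \<otimes>\<^bsub>Q\<^esub> lift Q \<psi> q \<delta>"
      using \<gamma> wg by auto
  qed (rule cl)
qed

lemma adjoin_generate:
  fixes G (structure)
  assumes "group G" "S \<subseteq> carrier G" "generate G S = carrier G"
  shows "generate (adjoin G) ((\<lambda>g. ([], g)) ` S \<union> {([(\<one>, True)], \<one>)}) = carrier (adjoin G)"
    (is "generate _ ?S = _")
proof -
  interpret G: group G by fact
  interpret K: group "adjoin G" by (rule G.group_adjoin)
  have S: "?S \<subseteq> carrier (adjoin G)" using assms(2) by (auto simp: G.carrier_adjoin syllable_words_Cons)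
  interpret H: subgroup "generate (adjoin G) ?S" "adjoin G" by (rule K.generate_is_subgroup[OF S])
  interpret e: group_hom G "adjoin G" "\<lambda>g. ([], g)" by unfold_locales (rule G.embed_hom)
  have emb: "([], g) \<in> generate (adjoin G) ?S" if "g \<in> carrier G" for g
  proof -
    have "(\<lambda>g. ([], g)) ` carrier G = generate (adjoin G) ((\<lambda>g. ([], g)) ` S)"
      using e.generate_img[OF assms(2)] assms(3) by simp
    also have "\<dots> \<subseteq> generate (adjoin G) ?S" by (rule K.mono_generate) auto
    finally show ?thesis using that by blast
  qed
  have t: "([(\<one>, e)], \<one>) \<in> generate (adjoin G) ?S" for e
  proof -
    let ?t = "\<lambda>e. ([(\<one>, e)], \<one>)"
    have c: "?t e \<in> carrier (adjoin G)" for e by (auto simp: G.carrier_adjoin syllable_words_Cons)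
    have T: "?t True \<in> generate (adjoin G) ?S" by (rule generate.incl) simp
    have "?t False \<otimes>\<^bsub>adjoin G\<^esub> ?t True = \<one>\<^bsub>adjoin G\<^esub>"
      by (rule G.stable_letter_cancel)
    then have "?t False = inv\<^bsub>adjoin G\<^esub> ?t True"
      by (rule K.inv_equality[OF _ c c, symmetric])
    then show ?thesis using T H.m_inv_closed[OF T] by (cases e) simp_all
  qed
  show ?thesis
  proof (intro equalityI subsetI)
    fix \<gamma> assume "\<gamma> \<in> carrier (adjoin G)"
    then show "\<gamma> \<in> generate (adjoin G) ?S" unfolding G.carrier_adjoin
    proof (induction rule: G.adjoin_induct)
      case (syl a e \<gamma>)
      have "([], a) \<otimes>\<^bsub>adjoin G\<^esub> (([(\<one>, e)], \<one>) \<otimes>\<^bsub>adjoin G\<^esub> \<gamma>) = left_mul G (\<otimes>) a (letter_mul G e \<gamma>)"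
        using G.word_act_stable_letter[OF G.acts_self syl(2)] by (simp add: G.mult_adjoin word_act_Nil)
      then show ?case using H.m_closed[OF emb[OF syl(1)] H.m_closed[OF t[of e] syl(3)]] by simp
    qed (rule emb)
  qed (use K.generate_incl[OF S] in blast)
qed

section \<open>Gluing copies of a tree\<close>

lemma branches_image:
  assumes T: "tree_acts G V E \<phi>" and g: "g \<in> carrier G" and b: "branches E v"
  shows "branches E (\<phi> g v)"
proof -
  obtain u w where uw: "u \<noteq> w" "{v, u} \<in> E" "{v, w} \<in> E" using b unfolding branches_def by blast
  obtain r par where R: "rooted r par V E" using tree_actsD(2)[OF T] by blast
  have "u \<in> V" "w \<in> V" using rooted_edge_cases(2)[OF R] uw by auto
  then have "\<phi> g u \<noteq> \<phi> g w" using acts_inj[OF tree_actsD(1,3)[OF T] g] uw by simp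
  then show ?thesis using tree_actsD(4)[OF T g] uw unfolding branches_def by blast
qed

text \<open>
  The pair \<open>(w, v)\<close> is the vertex \<open>v\<close> in the copy \<open>w\<close> of the tree. Vertex \<open>L\<close> of the copy
  \<open>\<gamma>G\<close> is glued to vertex \<open>L'\<close> of the copy \<open>\<gamma>tG\<close>. Accordingly the copy \<open>w @ [(a, e)]\<close>
  hangs on the shorter copy \<open>w\<close>: its vertex \<open>att e\<close> is the vertex \<open>\<phi> a (att (\<not> e))\<close> of \<open>w\<close>.
\<close>

locale gluing = group G for G (structure) +
  fixes V :: "'v set" and E :: "'v set set" and \<phi> :: "'a \<Rightarrow> 'v \<Rightarrow> 'v" and L L' :: 'v
  assumes T: "tree_acts G V E \<phi>" and L: "L \<in> V" and L': "L' \<in> V"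
begin

definition att :: "bool \<Rightarrow> 'v"
  where "att e = (if e then L' else L)"

fun rep_rev :: "('a \<times> bool) list \<Rightarrow> 'v \<Rightarrow> ('a \<times> bool) list \<times> 'v"
  where
    "rep_rev [] v = ([], v)"
  | "rep_rev ((a, e) # w) v =
      (if v = att e then rep_rev w (\<phi> a (att (\<not> e))) else (rev ((a, e) # w), v))"

text \<open>
  A vertex of the glued tree is represented in the shortest copy that contains it.
\<close>

definition rep :: "('a \<times> bool) list \<times> 'v \<Rightarrow> ('a \<times> bool) list \<times> 'v"
  where "rep z = rep_rev (rev (fst z)) (snd z)"

definition glued_vertices :: "(('a \<times> bool) list \<times> 'v) set"
  where "glued_vertices = {(w, v). w \<in> syllable_words G \<and> v \<in> V \<and> (w = [] \<or> v \<noteq> att (snd (last w)))}"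

definition glued_edges :: "(('a \<times> bool) list \<times> 'v) set set"
  where "glued_edges = {{rep (w, u), rep (w, v)} | w u v. w \<in> syllable_words G \<and> {u, v} \<in> E}"

definition glued_act :: "('a \<times> bool) list \<times> 'a \<Rightarrow> ('a \<times> bool) list \<times> 'v \<Rightarrow> ('a \<times> bool) list \<times> 'v"
  where "glued_act \<gamma> z = rep (word_act G \<phi> \<gamma> z)"

lemma act: "acts G V \<phi>"
  by (rule tree_actsD(3)[OF T])

lemma att_V [simp]: "att e \<in> V"
  by (simp add: att_def L L')

lemma rep_Nil [simp]: "rep ([], v) = ([], v)"
  by (simp add: rep_def)

lemma rep_snoc:
  "rep (w @ [(a, e)], v) = (if v = att e then rep (w, \<phi> a (att (\<not> e))) else (w @ [(a, e)], v))"
  by (simp add: rep_def)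

lemma rep_vertex: "z \<in> glued_vertices \<Longrightarrow> rep z = z"
  by (cases z; cases "fst z" rule: rev_cases) (auto simp: glued_vertices_def rep_snoc)

lemma vert_pairs: "z \<in> glued_vertices \<Longrightarrow> z \<in> syllable_words G \<times> V"
  by (auto simp: glued_vertices_def)

lemma rep_in_vertices: "z \<in> syllable_words G \<times> V \<Longrightarrow> rep z \<in> glued_vertices"
proof -
  have "w \<in> syllable_words G \<Longrightarrow> v \<in> V \<Longrightarrow> rep (w, v) \<in> glued_vertices" for w v
  proof (induction w arbitrary: v rule: rev_induct)
    case Nil
    then show ?case by (auto simp: glued_vertices_def)
  next
    case (snoc y w)
    obtain a e where y: "y = (a, e)" by fastforce
    have "a \<in> carrier G" "w \<in> syllable_words G"
      using snoc(2) syllable_words_appendD[of w "[y]"] y by (auto simp: syllable_words_Cons)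
    then show ?case using snoc y actsD(1)[OF act, of a] by (auto simp: rep_snoc glued_vertices_def)
  qed
  then show "z \<in> syllable_words G \<times> V \<Longrightarrow> rep z \<in> glued_vertices" by (cases z) auto
qed

lemma rep_rep: "z \<in> syllable_words G \<times> V \<Longrightarrow> rep (rep z) = rep z"
  by (rule rep_vertex[OF rep_in_vertices])

lemma rep_shorter: "length (fst (rep (w, v))) \<le> length w"
proof (induction w arbitrary: v rule: rev_induct)
  case (snoc y w)
  then show ?case by (cases y) (auto simp: rep_snoc le_SucI)
qed simp

lemma rep_inj:
  assumes "rep (w, u) = rep (w, v)"
  shows "u = v"
proof (cases w rule: rev_cases)
  case Nil
  then show ?thesis using assms by simp
next
  case (snoc w' y)
  obtain a e where y: "y = (a, e)" by fastforce
  have ne: "rep (w', x) \<noteq> (w' @ [(a, e)], z)" for x z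
    using rep_shorter[of w' x] by (auto simp: prod_eq_iff)
  then show ?thesis using assms snoc y ne[symmetric] by (auto simp: rep_snoc split: if_splits)
qed

lemma left_mul_snoc:
  assumes "w \<noteq> []"
  shows "left_mul G \<psi> g (w @ [y], v) = (fst (left_mul G \<psi> g (w, u)) @ [y], v)"
    "left_mul G \<psi> g (w, v) = (fst (left_mul G \<psi> g (w, u)), v)"
  using assms by (cases w; auto)+

lemma rep_left_mul:
  assumes "g \<in> carrier G" "z \<in> syllable_words G \<times> V"
  shows "rep (left_mul G \<phi> g z) = left_mul G \<phi> g (rep z)"
proof -
  have "w \<in> syllable_words G \<Longrightarrow> v \<in> V \<Longrightarrow> rep (left_mul G \<phi> g (w, v)) = left_mul G \<phi> g (rep (w, v))" for w v
  proof (induction w arbitrary: v rule: rev_induct)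
    case (snoc y w)
    obtain a e where y: "y = (a, e)" by fastforce
    have aw: "a \<in> carrier G" "w \<in> syllable_words G"
      using snoc(2) syllable_words_appendD[of w "[y]"] y by (auto simp: syllable_words_Cons)
    show ?case
    proof (cases "w = []")
      case True
      then show ?thesis using y aw assms(1) actsD(3)[OF act assms(1), of a]
        rep_snoc[of "[]" a e v] rep_snoc[of "[]" "g \<otimes> a" e v] by auto
    next
      case False
      let ?w = "fst (left_mul G \<phi> g (w, v))"
      have *: "left_mul G \<phi> g (w @ [y], v) = (?w @ [y], v)" "left_mul G \<phi> g (w, u) = (?w, u)" for u
        using left_mul_snoc[OF False] by metis+
      show ?thesis
      proof (cases "v = att e")
        case True
        then have "rep (left_mul G \<phi> g (w @ [y], v)) = rep (left_mul G \<phi> g (w, \<phi> a (att (\<not> e))))"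
          unfolding *(1) *(2)[of "\<phi> a (att (\<not> e))"] by (simp add: y rep_snoc)
        then show ?thesis using snoc(1)[OF aw(2), of "\<phi> a (att (\<not> e))"] actsD(1)[OF act aw(1)] True
          by (simp add: y rep_snoc)
      next
        case ne: False
        then show ?thesis unfolding *(1) using *(1) by (simp add: y rep_snoc)
      qed
    qed
  qed simp
  then show ?thesis using assms(2) by (cases z) auto
qed

lemma rep_letter_mul:
  assumes "z \<in> syllable_words G \<times> V"
  shows "rep (letter_mul G e (rep z)) = rep (letter_mul G e z)"
proof -
  have "w \<in> syllable_words G \<Longrightarrow> v \<in> V \<Longrightarrow> rep (letter_mul G e (rep (w, v))) = rep (letter_mul G e (w, v))" for w v
  proof (induction w arbitrary: v rule: rev_induct)
    case (snoc y w)
    obtain a f where y: "y = (a, f)" by fastforce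
    have aw: "a \<in> carrier G" "w \<in> syllable_words G"
      using snoc(2) syllable_words_appendD[of w "[y]"] y by (auto simp: syllable_words_Cons)
    show ?case
    proof (cases "v = att f")
      case False
      then show ?thesis by (simp add: y rep_snoc)
    next
      case True
      let ?v = "\<phi> a (att (\<not> f))"
      have v: "?v \<in> V" using actsD(1)[OF act aw(1)] by simp
      have "rep (letter_mul G e (rep (w @ [y], v))) = rep (letter_mul G e (w, ?v))"
        using True snoc(1)[OF aw(2) v] by (simp add: y rep_snoc)
      also have "\<dots> = rep (letter_mul G e (w @ [y], v))"
      proof (cases w)
        case Nil
        show ?thesis
        proof (cases "(a, f) = (\<one>, \<not> e)")
          case t: True
          then show ?thesis using Nil True y actsD(2)[OF act] rep_snoc[of "[]" \<one> e "att e"]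
            by simp
        next
          case False
          then have "letter_mul G e (w @ [y], v) = ([(\<one>, e)] @ [(a, f)], v)" using Nil y by auto
          then show ?thesis using True Nil rep_snoc[of "[(\<one>, e)]" a f v] by simp
        qed
      next
        case (Cons x w')
        show ?thesis
        proof (cases "x = (\<one>, \<not> e)")
          case t: True
          then show ?thesis using Cons True y by (simp add: rep_snoc)
        next
          case False
          then have "letter_mul G e (w @ [y], v) = (((\<one>, e) # w) @ [(a, f)], v)"
            "letter_mul G e (w, ?v) = ((\<one>, e) # w, ?v)" using Cons y by auto
          then show ?thesis using True rep_snoc[of "(\<one>, e) # w" a f v] by simp
        qed
      qed
      finally show ?thesis .
    qed
  qed simp
  then show ?thesis using assms by (cases z) auto
qed

text \<open>
  The identification of vertices is respected by the group, which therefore acts on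
  representatives.
\<close>

lemma rep_word_act:
  assumes "\<gamma> \<in> syllable_words G \<times> carrier G" "z \<in> syllable_words G \<times> V"
  shows "rep (word_act G \<phi> \<gamma> (rep z)) = rep (word_act G \<phi> \<gamma> z)"
proof -
  have rz: "rep z \<in> syllable_words G \<times> V" by (rule vert_pairs[OF rep_in_vertices[OF assms(2)]])
  obtain w g where wg: "\<gamma> = (w, g)" by fastforce
  have "w \<in> syllable_words G \<Longrightarrow> rep (word_act G \<phi> (w, g) (rep z)) = rep (word_act G \<phi> (w, g) z)"
  proof (induction w)
    case Nil
    then show ?case using assms wg rz rep_left_mul rep_rep by (simp add: word_act_Nil)
  next
    case (Cons y w)
    obtain a e where y: "y = (a, e)" by fastforce
    have aw: "a \<in> carrier G" "w \<in> syllable_words G" using Cons(2) y by (auto simp: syllable_words_Cons)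
    have cl: "word_act G \<phi> (w, g) x \<in> syllable_words G \<times> V" if "x \<in> syllable_words G \<times> V" for x
      using assms wg aw that by (intro word_act_closed[OF act]) auto
    have "rep (word_act G \<phi> (y # w, g) x) = left_mul G \<phi> a (rep (letter_mul G e (rep (word_act G \<phi> (w, g) x))))"
      if "x \<in> syllable_words G \<times> V" for x
      using rep_left_mul[OF aw(1) letter_mul_closed[OF cl[OF that]]] rep_letter_mul[OF cl[OF that]]
      by (simp add: y word_act_Cons)
    then show ?case using Cons(1)[OF aw(2)] rz assms(2) by simp
  qed
  then show ?thesis using assms(1) wg by auto
qed

lemma acts_glued_act: "acts (adjoin G) glued_vertices glued_act"
  unfolding acts_def carrier_adjoin
proof (intro conjI ballI)
  note K = acts_adjoin[OF act, unfolded acts_def carrier_adjoin]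
  fix \<gamma> z assume \<gamma>: "\<gamma> \<in> syllable_words G \<times> carrier G" and z: "z \<in> glued_vertices"
  have cl: "word_act G \<phi> \<gamma> z \<in> syllable_words G \<times> V" if "\<gamma> \<in> syllable_words G \<times> carrier G" for \<gamma>
    by (rule word_act_closed[OF act that vert_pairs[OF z]])
  show "glued_act \<gamma> z \<in> glued_vertices" unfolding glued_act_def by (rule rep_in_vertices[OF cl[OF \<gamma>]])
  fix \<delta> assume \<delta>: "\<delta> \<in> syllable_words G \<times> carrier G"
  show "glued_act (\<gamma> \<otimes>\<^bsub>adjoin G\<^esub> \<delta>) z = glued_act \<gamma> (glued_act \<delta> z)"
    using rep_word_act[OF \<gamma> cl[OF \<delta>]] word_act_word_act[OF act \<gamma> \<delta> vert_pairs[OF z]]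
    by (simp add: glued_act_def mult_adjoin)
next
  fix z assume "z \<in> glued_vertices"
  then show "glued_act \<one>\<^bsub>adjoin G\<^esub> z = z"
    using left_mul_one[OF act vert_pairs] rep_vertex by (simp add: glued_act_def one_adjoin word_act_Nil)
qed

lemma glued_act_copy:
  assumes "\<gamma> \<in> carrier (adjoin G)" "w \<in> syllable_words G" "v \<in> V"
    "\<gamma> \<otimes>\<^bsub>adjoin G\<^esub> (w, \<one>) = (w', g)"
  shows "glued_act \<gamma> (rep (w, v)) = rep (w', \<phi> g v)" "w' \<in> syllable_words G" "g \<in> carrier G"
proof -
  have \<gamma>: "\<gamma> \<in> syllable_words G \<times> carrier G" and w1: "(w, \<one>) \<in> syllable_words G \<times> carrier G"
    using assms by (auto simp: carrier_adjoin)
  have e: "word_act G (\<otimes>) \<gamma> (w, \<one>) = (w', g)" using assms(4) by (simp add: mult_adjoin)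
  then show w': "w' \<in> syllable_words G" "g \<in> carrier G" using word_act_closed[OF acts_self \<gamma> w1] by auto
  have "word_act G \<phi> \<gamma> (w, v) = word_act G \<phi> \<gamma> (word_act G \<phi> (w, \<one>) ([], v))"
    using word_act_normal_form[OF assms(2) one_closed assms(3) act] actsD(2)[OF act assms(3)] by simp
  also have "\<dots> = word_act G \<phi> (w', g) ([], v)"
    using word_act_word_act[OF act \<gamma> w1, of "([], v)"] assms(3) e by simp
  also have "\<dots> = (w', \<phi> g v)" by (rule word_act_normal_form[OF w' assms(3) act])
  finally show "glued_act \<gamma> (rep (w, v)) = rep (w', \<phi> g v)"
    using rep_word_act[OF \<gamma>, of "(w, v)"] assms by (simp add: glued_act_def)
qed

lemma edgeI: "w \<in> syllable_words G \<Longrightarrow> {u, v} \<in> E \<Longrightarrow> {rep (w, u), rep (w, v)} \<in> glued_edges"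
  unfolding glued_edges_def by blast

lemma E_in_V: "{u, v} \<in> E \<Longrightarrow> u \<in> V \<and> v \<in> V \<and> u \<noteq> v"
  using tree_actsD(2)[OF T] rooted_edge_cases(1-3) by metis

text \<open>
  Every copy is rooted at the vertex by which it hangs on a shorter copy, so that the parent
  maps of the copies fit together. An edge of the glued tree joins a vertex \<open>(w, c)\<close> to its parent,
  with \<open>c\<close> not the root of the copy \<open>w\<close>; this determines \<open>w\<close>.
\<close>

lemma edges_rooted: 
  obtains r par where "rooted r par glued_vertices glued_edges"
    and "\<And>w u v w' u' v'. w \<in> syllable_words G \<Longrightarrow> w' \<in> syllable_words G \<Longrightarrow> {u, v} \<in> E \<Longrightarrow> {u', v'} \<in> E \<Longrightarrow>
      {rep (w, u), rep (w, v)} = {rep (w', u'), rep (w', v')} \<Longrightarrow> w = w' \<and> {u, v} = {u', v'}"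
proof -
  obtain q p\<^sub>0 where R0: "rooted q p\<^sub>0 V E" using tree_actsD(2)[OF T] by blast
  have "\<forall>e. \<exists>p. rooted (att e) p V E" using reroot[OF R0] by simp
  then obtain P where P: "\<And>e. rooted (att e) (P e) V E" by metis
  define rt where "rt w = (if w = [] then q else att (snd (last w)))" for w :: "('a \<times> bool) list"
  define pr where "pr w = (if w = [] then p\<^sub>0 else P (snd (last w)))" for w :: "('a \<times> bool) list"
  have R: "rooted (rt w) (pr w) V E" for w using R0 P by (simp add: rt_def pr_def)
  have rep_nr: "rep (w, v) = (w, v)" if "v \<noteq> rt w" for w v
    using that by (cases w rule: rev_cases) (auto simp: rt_def rep_snoc)
  have vert_nr: "z = ([], q) \<or> snd z \<noteq> rt (fst z)" if "z \<in> glued_vertices" for z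
    using that by (cases "fst z = []") (auto simp: glued_vertices_def rt_def prod_eq_iff)
  define par where "par z = rep (fst z, pr (fst z) (snd z))" for z
  have clos: "par z \<in> glued_vertices" if "z \<in> glued_vertices" for z
    unfolding par_def using that R[of "fst z"] by (intro rep_in_vertices) (auto simp: glued_vertices_def rooted_def)
  have par_rep: "par (rep (w, v)) = rep (w, pr w v)" if "v \<noteq> rt w" for w v
    using rep_nr[OF that] by (simp add: par_def)
  have reach: "\<exists>n. (par ^^ n) (rep (w, v)) = ([], q)" if "w \<in> syllable_words G" "v \<in> V" for w v
    using that
  proof (induction w arbitrary: v rule: rev_induct)
    case Nil
    show ?case using R[of "[]"] Nil(2)
    proof (induction rule: rooted_induct)
      case root
      show ?case by (intro exI[of _ 0]) (simp add: rt_def)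
    next
      case (step v)
      then obtain n where "(par ^^ n) (rep ([], pr [] v)) = ([], q)" by blast
      then have "(par ^^ Suc n) (rep ([], v)) = ([], q)"
        using par_rep[OF step(2)] by (simp only: funpow_Suc_right o_apply)
      then show ?case by blast
    qed
  next
    case (snoc y w)
    obtain a e where y: "y = (a, e)" by fastforce
    have aw: "a \<in> carrier G" "w \<in> syllable_words G"
      using snoc(2) syllable_words_appendD[of w "[y]"] y by (auto simp: syllable_words_Cons)
    show ?case using R[of "w @ [y]"] snoc(3)
    proof (induction rule: rooted_induct)
      case root
      then show ?case using snoc(1)[OF aw(2), of "\<phi> a (att (\<not> e))"] actsD(1)[OF act aw(1)]
        by (simp add: rt_def y rep_snoc)
    next
      case (step v)
      then obtain n where "(par ^^ n) (rep (w @ [y], pr (w @ [y]) v)) = ([], q)" by blast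
      then have "(par ^^ Suc n) (rep (w @ [y], v)) = ([], q)"
        using par_rep[OF step(2)] by (simp only: funpow_Suc_right o_apply)
      then show ?case by blast
    qed
  qed
  have child: "\<exists>c\<in>V. c \<noteq> rt w \<and> {u, v} = {c, pr w c} \<and>
      {rep (w, u), rep (w, v)} = {(w, c), par (w, c)}"
    if e: "{u, v} \<in> E" for w u v
    using rooted_edge_cases[OF R[of w] e]
  proof (elim disjE conjE)
    assume "v \<in> V" "v \<noteq> rt w" "u = pr w v"
    then show ?thesis using rep_nr[of v w] by (intro bexI[of _ v]) (auto simp: par_def insert_commute)
  next
    assume "u \<in> V" "u \<noteq> rt w" "v = pr w u"
    then show ?thesis using rep_nr[of u w] by (intro bexI[of _ u]) (auto simp: par_def insert_commute)
  qed
  have child_vert: "(w, c) \<in> glued_vertices - {([], q)}" if "w \<in> syllable_words G" "c \<in> V" "c \<noteq> rt w" for w c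
    using that by (auto simp: glued_vertices_def rt_def split: if_splits)
  have Rt: "rooted ([], q) par glued_vertices glued_edges"
    unfolding rooted_def
  proof (intro conjI ballI)
    show "([], q) \<in> glued_vertices" using R0 by (auto simp: glued_vertices_def rooted_def)
    show "par ([], q) = ([], q)" using R0 by (auto simp: par_def pr_def rooted_def)
    show "par \<in> glued_vertices \<rightarrow> glued_vertices" using clos by blast
    fix z assume z: "z \<in> glued_vertices"
    show "\<exists>n. (par ^^ n) z = ([], q)"
      using reach[of "fst z" "snd z"] vert_pairs[OF z] rep_vertex[OF z] by auto
  next
    show "glued_edges = (\<lambda>z. {z, par z}) ` (glued_vertices - {([], q)})"
    proof (intro equalityI subsetI)
      fix e assume "e \<in> glued_edges"
      then obtain w u v where w: "w \<in> syllable_words G" "{u, v} \<in> E" "e = {rep (w, u), rep (w, v)}"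
        unfolding glued_edges_def by blast
      obtain c where "c \<in> V" "c \<noteq> rt w" "e = {(w, c), par (w, c)}"
        using child[OF w(2), of w] w(3) by blast
      then show "e \<in> (\<lambda>z. {z, par z}) ` (glued_vertices - {([], q)})" using child_vert[OF w(1)] by blast
    next
      fix e assume "e \<in> (\<lambda>z. {z, par z}) ` (glued_vertices - {([], q)})"
      then obtain w c where z: "(w, c) \<in> glued_vertices" "(w, c) \<noteq> ([], q)" "e = {(w, c), par (w, c)}" by auto
      have c: "c \<noteq> rt w" using vert_nr[OF z(1)] z(2) by auto
      have "{c, pr w c} \<in> E" using rooted_parent_edge(1)[OF R _ c] vert_pairs[OF z(1)] by auto
      then have "{rep (w, c), rep (w, pr w c)} \<in> glued_edges"
        using vert_pairs[OF z(1)] by (intro edgeI) auto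
      then show "e \<in> glued_edges" using z(3) rep_nr[OF c] by (simp add: par_def)
    qed
  qed
  show thesis
  proof (rule that[OF Rt])
    fix w u v w' u' v'
    assume w: "w \<in> syllable_words G" "w' \<in> syllable_words G" and e: "{u, v} \<in> E" "{u', v'} \<in> E"
      and eq: "{rep (w, u), rep (w, v)} = {rep (w', u'), rep (w', v')}"
    obtain c where c: "c \<in> V" "c \<noteq> rt w" "{u, v} = {c, pr w c}"
      "{rep (w, u), rep (w, v)} = {(w, c), par (w, c)}" using child[OF e(1), of w] by (elim bexE conjE)
    obtain c' where c': "c' \<in> V" "c' \<noteq> rt w'" "{u', v'} = {c', pr w' c'}"
      "{rep (w', u'), rep (w', v')} = {(w', c'), par (w', c')}" using child[OF e(2), of w'] by (elim bexE conjE)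
    have "(w, c) = (w', c')"
      using rooted_edge_child_eq[OF Rt, of "(w, c)" "(w', c')"] child_vert[OF w(1) c(1,2)]
        child_vert[OF w(2) c'(1,2)] c(4) c'(4) eq by auto
    then show "w = w' \<and> {u, v} = {u', v'}" using c(3) c'(3) by auto
  qed
qed

lemma edge_copy_unique:
  assumes "w \<in> syllable_words G" "w' \<in> syllable_words G" "{u, v} \<in> E" "{u', v'} \<in> E"
    "{rep (w, u), rep (w, v)} = {rep (w', u'), rep (w', v')}"
  shows "w = w'" "{u, v} = {u', v'}"
proof -
  obtain r par where *: "\<And>w u v w' u' v'. w \<in> syllable_words G \<Longrightarrow> w' \<in> syllable_words G \<Longrightarrow> {u, v} \<in> E \<Longrightarrow>
      {u', v'} \<in> E \<Longrightarrow> {rep (w, u), rep (w, v)} = {rep (w', u'), rep (w', v')} \<Longrightarrow>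
      w = w' \<and> {u, v} = {u', v'}" using edges_rooted by metis
  show "w = w'" "{u, v} = {u', v'}" using *[OF assms] by simp_all
qed

lemma move_edge:
  assumes \<gamma>: "\<gamma> \<in> carrier (adjoin G)" and w: "w \<in> syllable_words G" and e: "{u, v} \<in> E"
  obtains w' g where "\<gamma> \<otimes>\<^bsub>adjoin G\<^esub> (w, \<one>) = (w', g)" "w' \<in> syllable_words G" "g \<in> carrier G"
    "glued_act \<gamma> (rep (w, u)) = rep (w', \<phi> g u)" "glued_act \<gamma> (rep (w, v)) = rep (w', \<phi> g v)"
    "{\<phi> g u, \<phi> g v} \<in> E"
proof -
  obtain w' g where *: "\<gamma> \<otimes>\<^bsub>adjoin G\<^esub> (w, \<one>) = (w', g)" by fastforce
  show thesis
    using that[OF *] glued_act_copy[OF \<gamma> w _ *, of u] glued_act_copy(1)[OF \<gamma> w _ *, of v] E_in_V[OF e]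
      tree_actsD(4)[OF T _ e] by simp
qed

text \<open>
  Each edge lies in only one copy, so its stabiliser is conjugate to a stabiliser in \<open>G\<close>.
\<close>

lemma edge_stabiliser:
  assumes \<gamma>: "\<gamma> \<in> carrier (adjoin G)" and w: "w \<in> syllable_words G" and e: "{u, v} \<in> E"
    and fix_edge: "{glued_act \<gamma> (rep (w, u)), glued_act \<gamma> (rep (w, v))} = {rep (w, u), rep (w, v)}"
  obtains g where "g \<in> carrier G" "\<gamma> \<otimes>\<^bsub>adjoin G\<^esub> (w, \<one>) = (w, g)" "\<phi> g u = u" "\<phi> g v = v"
proof -
  obtain w' g where *: "\<gamma> \<otimes>\<^bsub>adjoin G\<^esub> (w, \<one>) = (w', g)" "w' \<in> syllable_words G" "g \<in> carrier G"
    "glued_act \<gamma> (rep (w, u)) = rep (w', \<phi> g u)" "glued_act \<gamma> (rep (w, v)) = rep (w', \<phi> g v)"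
    "{\<phi> g u, \<phi> g v} \<in> E" by (rule move_edge[OF \<gamma> w e])
  have "w' = w" "{\<phi> g u, \<phi> g v} = {u, v}"
    using edge_copy_unique[OF *(2) w *(6) e] fix_edge *(4,5) by auto
  then show thesis
    using that[of g] * tree_actsD(5)[OF T *(3) e] by (auto simp: doubleton_eq_iff)
qed

lemma tree_acts_gluing: "tree_acts (adjoin G) glued_vertices glued_edges glued_act"
  unfolding tree_acts_def
proof (intro conjI ballI allI impI)
  show "group (adjoin G)" by (rule group_adjoin)
  show "acts (adjoin G) glued_vertices glued_act" by (rule acts_glued_act)
  obtain r par where R: "rooted r par glued_vertices glued_edges" using edges_rooted by metis
  then show "\<exists>r par. rooted r par glued_vertices glued_edges" by blast
  fix \<gamma> x y assume \<gamma>: "\<gamma> \<in> carrier (adjoin G)" and "{x, y} \<in> glued_edges"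
  then obtain w u v where w: "w \<in> syllable_words G" and e: "{u, v} \<in> E" and
    xy: "{x, y} = {rep (w, u), rep (w, v)}" unfolding glued_edges_def by blast
  obtain w' g where *: "\<gamma> \<otimes>\<^bsub>adjoin G\<^esub> (w, \<one>) = (w', g)" "w' \<in> syllable_words G" "g \<in> carrier G"
    "glued_act \<gamma> (rep (w, u)) = rep (w', \<phi> g u)" "glued_act \<gamma> (rep (w, v)) = rep (w', \<phi> g v)"
    "{\<phi> g u, \<phi> g v} \<in> E" by (rule move_edge[OF \<gamma> w e])
  have im: "{glued_act \<gamma> x, glued_act \<gamma> y} = {rep (w', \<phi> g u), rep (w', \<phi> g v)}"
    using xy * by (auto simp: doubleton_eq_iff)
  then show "{glued_act \<gamma> x, glued_act \<gamma> y} \<in> glued_edges" using edgeI[OF *(2,6)] by simp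
  show "\<not> (glued_act \<gamma> x = y \<and> glued_act \<gamma> y = x)"
  proof
    assume a: "glued_act \<gamma> x = y \<and> glued_act \<gamma> y = x"
    then have "{glued_act \<gamma> (rep (w, u)), glued_act \<gamma> (rep (w, v))} = {rep (w, u), rep (w, v)}"
      using xy by (auto simp: doubleton_eq_iff)
    then obtain h where h: "h \<in> carrier G" "\<gamma> \<otimes>\<^bsub>adjoin G\<^esub> (w, \<one>) = (w, h)" "\<phi> h u = u" "\<phi> h v = v"
      by (rule edge_stabiliser[OF \<gamma> w e])
    then have "glued_act \<gamma> (rep (w, u)) = rep (w, u)" "glued_act \<gamma> (rep (w, v)) = rep (w, v)"
      using glued_act_copy(1)[OF \<gamma> w _ h(2)] E_in_V[OF e] by simp_all
    then have "rep (w, u) = rep (w, v)" using a xy by (auto simp: doubleton_eq_iff)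
    then show False using rep_inj E_in_V[OF e] by blast
  qed
qed

text \<open>
  The stabilisers of two different copies meet trivially. Hence all edges of a path that is
  fixed by a non-trivial element lie in one copy, and the bound for the tree of \<open>G\<close> applies.
\<close>

lemma acylindrical_gluing:
  assumes acyl: "\<And>h p. h \<in> carrier G \<Longrightarrow> h \<noteq> \<one> \<Longrightarrow> no_backtrack E p \<Longrightarrow> (\<And>x. x \<in> set p \<Longrightarrow> \<phi> h x = x) \<Longrightarrow>
      length p \<le> Suc k"
    and h: "h \<in> carrier (adjoin G)" "h \<noteq> \<one>\<^bsub>adjoin G\<^esub>" and p: "no_backtrack glued_edges p"
    and fixp: "\<And>x. x \<in> set p \<Longrightarrow> glued_act h x = x"
  shows "length p \<le> Suc k"
proof (cases "length p \<le> 1")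
  case False
  interpret K: group "adjoin G" by (rule group_adjoin)
  have ex: "\<exists>w u v. w \<in> syllable_words G \<and> {u, v} \<in> E \<and> {p ! i, p ! Suc i} = {rep (w, u), rep (w, v)}"
    if "Suc i < length p" for i
    using p that unfolding no_backtrack_def glued_edges_def by blast
  have stab: "\<exists>g\<in>carrier G. h \<otimes>\<^bsub>adjoin G\<^esub> (w, \<one>) = (w, g)"
    if "Suc i < length p" "w \<in> syllable_words G" "{u, v} \<in> E" "{p ! i, p ! Suc i} = {rep (w, u), rep (w, v)}"
    for i w u v
  proof -
    have "glued_act h (p ! i) = p ! i" "glued_act h (p ! Suc i) = p ! Suc i" using fixp that(1) by auto
    then have "{glued_act h (rep (w, u)), glued_act h (rep (w, v))} = {rep (w, u), rep (w, v)}"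
      using that(4) by (auto simp: doubleton_eq_iff)
    from edge_stabiliser[OF h(1) that(2,3) this] show ?thesis by blast
  qed
  obtain w u\<^sub>0 v\<^sub>0 where w: "w \<in> syllable_words G" "{u\<^sub>0, v\<^sub>0} \<in> E" "{p ! 0, p ! Suc 0} = {rep (w, u\<^sub>0), rep (w, v\<^sub>0)}"
    using ex[of 0] False by auto
  obtain g where g: "g \<in> carrier G" "h \<otimes>\<^bsub>adjoin G\<^esub> (w, \<one>) = (w, g)" using stab[OF _ w] False by auto
  have same: "\<exists>u v. {u, v} \<in> E \<and> {p ! i, p ! Suc i} = {rep (w, u), rep (w, v)}"
    if i: "Suc i < length p" for i
  proof -
    obtain w' u v where w': "w' \<in> syllable_words G" "{u, v} \<in> E" "{p ! i, p ! Suc i} = {rep (w', u), rep (w', v)}"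
      using ex[OF i] by blast
    obtain g' where "g' \<in> carrier G" "h \<otimes>\<^bsub>adjoin G\<^esub> (w', \<one>) = (w', g')" using stab[OF i w'] by blast
    then have "w' = w" using base_malnormal[OF h(1) w'(1) w(1) _ _ g(1) _ g(2)] h(2) by blast
    then show ?thesis using w' by blast
  qed
  \<comment> \<open>the path read in the common copy \<open>w\<close>\<close>
  define f where "f = inv_into V (\<lambda>v. rep (w, v))"
  have inj: "inj_on (\<lambda>v. rep (w, v)) V" using rep_inj by (auto intro: inj_onI)
  have frep: "f (rep (w, v)) = v" if "v \<in> V" for v
    unfolding f_def by (rule inv_into_f_f[OF inj that])
  have pf: "\<exists>v\<in>V. p ! i = rep (w, v)" if i: "i < length p" for i
  proof -
    define j where "j = (if Suc i < length p then i else i - 1)"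
    have j: "Suc j < length p" "i = j \<or> i = Suc j" using i False by (auto simp: j_def)
    obtain u v where uv: "{u, v} \<in> E" "{p ! j, p ! Suc j} = {rep (w, u), rep (w, v)}"
      using same[OF j(1)] by blast
    have "p ! i \<in> {p ! j, p ! Suc j}" using j(2) by auto
    then show ?thesis using E_in_V[OF uv(1)] unfolding uv(2) by blast
  qed
  have pf': "rep (w, f (p ! i)) = p ! i" "f (p ! i) \<in> V" if "i < length p" for i
    using pf[OF that] frep by auto
  let ?q = "map f p"
  have "no_backtrack E ?q" unfolding no_backtrack_def
  proof (intro conjI allI impI)
    fix i assume "Suc i < length ?q"
    then have i: "Suc i < length p" by simp
    obtain u v where uv: "{u, v} \<in> E" "{p ! i, p ! Suc i} = {rep (w, u), rep (w, v)}"
      using same[OF i] by blast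
    have "f ` {p ! i, p ! Suc i} = {u, v}" using uv E_in_V[OF uv(1)] frep by simp
    then show "{?q ! i, ?q ! Suc i} \<in> E" using i uv(1) by simp
  next
    fix i assume "Suc (Suc i) < length ?q"
    then have i: "Suc (Suc i) < length p" by simp
    then have "p ! i \<noteq> p ! Suc (Suc i)" using p by (simp add: no_backtrack_def)
    then have "f (p ! i) \<noteq> f (p ! Suc (Suc i))"
      using pf'(1)[of i] pf'(1)[OF i] i by (metis Suc_lessD)
    then show "?q ! i \<noteq> ?q ! Suc (Suc i)" using i by simp
  qed
  moreover have "\<phi> g x = x" if x: "x \<in> set ?q" for x
  proof -
    obtain i where i: "i < length p" "x = f (p ! i)" using x by (auto simp: in_set_conv_nth)
    have x: "x \<in> V" "rep (w, x) = p ! i" using pf'[OF i(1)] i(2) by auto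
    have "glued_act h (rep (w, x)) = rep (w, x)" using fixp i(1) x by simp
    then have "rep (w, \<phi> g x) = rep (w, x)" using glued_act_copy(1)[OF h(1) w(1) x(1) g(2)] by simp
    then show ?thesis by (rule rep_inj)
  qed
  moreover have "g \<noteq> \<one>"
  proof
    assume "g = \<one>"
    then have "h \<otimes>\<^bsub>adjoin G\<^esub> (w, \<one>) = \<one>\<^bsub>adjoin G\<^esub> \<otimes>\<^bsub>adjoin G\<^esub> (w, \<one>)"
      using g w by (simp add: carrier_adjoin)
    moreover have "(w, \<one>) \<in> carrier (adjoin G)" using w(1) by (simp add: carrier_adjoin)
    ultimately show False using K.right_cancel[OF _ h(1) K.one_closed] h(2) by blast
  qed
  ultimately have "length ?q \<le> Suc k" using acyl[OF g(1)] by blast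
  then show ?thesis by simp
qed simp

lemma good_action_gluing:
  assumes g: "good_action k n G V E \<phi>"
  shows "good_action k n (adjoin G) glued_vertices glued_edges glued_act"
  unfolding good_action_def
proof (intro conjI allI impI ballI)
  interpret K: group "adjoin G" by (rule group_adjoin)
  show "tree_acts (adjoin G) glued_vertices glued_edges glued_act" by (rule tree_acts_gluing)
  show "length p \<le> Suc k" if "h \<in> carrier (adjoin G)" "h \<noteq> \<one>\<^bsub>adjoin G\<^esub>" "no_backtrack glued_edges p" "\<forall>x\<in>set p. glued_act h x = x"
    for h p
    by (rule acylindrical_gluing[OF good_actionD(3)[OF g] that(1-3)]) (use that(4) in auto)
  show "\<exists>\<gamma>\<in>carrier (adjoin G). \<gamma> \<noteq> \<one>\<^bsub>adjoin G\<^esub> \<and> glued_act \<gamma> x = x \<and> glued_act \<gamma> y = y"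
    if xy\<^sub>0: "{x, y} \<in> glued_edges" for x y
  proof -
    obtain w u v where w: "w \<in> syllable_words G" and e: "{u, v} \<in> E" and
      xy: "{x, y} = {rep (w, u), rep (w, v)}" using xy\<^sub>0 unfolding glued_edges_def by blast
    obtain s where s: "s \<in> carrier G" "s \<noteq> \<one>" "\<phi> s u = u" "\<phi> s v = v"
      using good_actionD(2)[OF g e] by blast
    have c: "(w, \<one>) \<in> carrier (adjoin G)" "([], s) \<in> carrier (adjoin G)"
      using w s by (auto simp: carrier_adjoin)
    define \<gamma> where "\<gamma> = (w, \<one>) \<otimes>\<^bsub>adjoin G\<^esub> ([], s) \<otimes>\<^bsub>adjoin G\<^esub> inv\<^bsub>adjoin G\<^esub> (w, \<one>)"
    have \<gamma>: "\<gamma> \<in> carrier (adjoin G)" unfolding \<gamma>_def using c by simp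
    have "\<gamma> \<otimes>\<^bsub>adjoin G\<^esub> (w, \<one>) =
        (w, \<one>) \<otimes>\<^bsub>adjoin G\<^esub> ([], s) \<otimes>\<^bsub>adjoin G\<^esub> (inv\<^bsub>adjoin G\<^esub> (w, \<one>) \<otimes>\<^bsub>adjoin G\<^esub> (w, \<one>))"
      unfolding \<gamma>_def by (rule K.m_assoc) (use c in auto)
    also have "\<dots> = (w, s)" using c base_copy(2)[OF w s(1)] K.m_closed[OF c] by simp
    finally have eq: "\<gamma> \<otimes>\<^bsub>adjoin G\<^esub> (w, \<one>) = (w, s)" .
    have "\<gamma> \<noteq> \<one>\<^bsub>adjoin G\<^esub>" using eq c s(2) by auto
    moreover have "glued_act \<gamma> (rep (w, u)) = rep (w, u)" "glued_act \<gamma> (rep (w, v)) = rep (w, v)"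
      using glued_act_copy(1)[OF \<gamma> w _ eq] E_in_V[OF e] s by simp_all
    then have "glued_act \<gamma> x = x \<and> glued_act \<gamma> y = y" using xy by (auto simp: doubleton_eq_iff)
    ultimately show ?thesis using \<gamma> by blast
  qed
  obtain R where R: "finite R" "card R = n" "edge_transversal G E \<phi> R"
    using good_actionD(4)[OF g] by blast
  have RE: "R \<subseteq> E" by (rule edge_transversalD(1)[OF R(3)])
  have pair: "\<exists>u v. d = {u, v} \<and> {u, v} \<in> E" if d: "d \<in> E" for d
  proof -
    obtain r par where "rooted r par V E" using tree_actsD(2)[OF T] by blast
    then obtain v where "d = {v, par v}" using d by (auto simp: rooted_def)
    then show ?thesis using d by blast
  qed
  define \<iota> where "\<iota> d = Pair ([] :: ('a \<times> bool) list) ` d" for d :: "'v set"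
  have "edge_transversal (adjoin G) glued_edges glued_act (\<iota> ` R)"
    unfolding edge_transversal_def
  proof (intro conjI ballI impI)
    show "\<iota> ` R \<subseteq> glued_edges"
    proof
      fix x assume "x \<in> \<iota> ` R"
      then obtain d where d: "d \<in> R" "x = \<iota> d" by blast
      obtain u v where "d = {u, v}" "{u, v} \<in> E" using pair d(1) RE by blast
      then show "x \<in> glued_edges" using edgeI[OF syllable_words_Nil, of u v] d by (simp add: \<iota>_def)
    qed
  next
    fix x assume "x \<in> glued_edges"
    then obtain w u v where w: "w \<in> syllable_words G" and e: "{u, v} \<in> E" and
      x: "x = {rep (w, u), rep (w, v)}" unfolding glued_edges_def by blast
    obtain s d where s: "s \<in> carrier G" "d \<in> R" "{u, v} = \<phi> s ` d"
      using edge_transversalD(2)[OF R(3) e] by blast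
    obtain u' v' where d: "d = {u', v'}" "{u', v'} \<in> E" using pair s(2) RE by blast
    have ws: "(w, s) \<in> carrier (adjoin G)" using w s by (simp add: carrier_adjoin)
    have "glued_act (w, s) ([], y) = rep (w, \<phi> s y)" if "y \<in> V" for y
      using glued_act_copy(1)[OF ws syllable_words_Nil that base_copy(1)[OF w s(1)]] by simp
    then have "glued_act (w, s) ` \<iota> d = (\<lambda>y. rep (w, y)) ` \<phi> s ` d"
      using d E_in_V[OF d(2)] by (simp add: \<iota>_def)
    moreover have "x = (\<lambda>y. rep (w, y)) ` {u, v}" using x by simp
    ultimately have "x = glued_act (w, s) ` \<iota> d" unfolding s(3) by simp
    then show "\<exists>\<gamma>\<in>carrier (adjoin G). \<exists>d\<in>\<iota> ` R. x = glued_act \<gamma> ` d"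
      using ws s(2) by blast
  next
    fix x x' \<gamma> assume x: "x \<in> \<iota> ` R" "x' \<in> \<iota> ` R"
      and \<gamma>: "\<gamma> \<in> carrier (adjoin G)" "glued_act \<gamma> ` x = x'"
    obtain d d' where d: "d \<in> R" "x = \<iota> d" "d' \<in> R" "x' = \<iota> d'" using x by blast
    obtain u v where e: "d = {u, v}" "{u, v} \<in> E" using pair d(1) RE by blast
    obtain u' v' where e': "d' = {u', v'}" "{u', v'} \<in> E" using pair d(3) RE by blast
    obtain w' s where *: "\<gamma> \<otimes>\<^bsub>adjoin G\<^esub> ([], \<one>) = (w', s)" "w' \<in> syllable_words G" "s \<in> carrier G"
      "glued_act \<gamma> (rep ([], u)) = rep (w', \<phi> s u)" "glued_act \<gamma> (rep ([], v)) = rep (w', \<phi> s v)"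
      "{\<phi> s u, \<phi> s v} \<in> E" by (rule move_edge[OF \<gamma>(1) syllable_words_Nil e(2)])
    have "{\<phi> s u, \<phi> s v} = {u', v'}"
      using edge_copy_unique(2)[OF *(2) syllable_words_Nil *(6) e'(2)] * \<gamma>(2) d e e' by (simp add: \<iota>_def)
    then have "d = d'" using edge_transversalD(3)[OF R(3) d(1,3) *(3)] e e' by simp
    then show "x = x'" using d by simp
  qed
  moreover have "inj_on \<iota> R"
    by (intro inj_onI) (auto simp: \<iota>_def inj_image_eq_iff inj_on_def)
  then have "card (\<iota> ` R) = n" using card_image R(2) by metis
  ultimately show "\<exists>R. finite R \<and> card R = n \<and> edge_transversal (adjoin G) glued_edges glued_act R"
    using R(1) by (intro exI[of _ "\<iota> ` R"]) simp
qed


text \<open>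
  A leaf of a copy that is glued lies in two copies, and has a neighbour in each of them.
\<close>

lemma branches_gluing:
  assumes br: "\<And>v. v \<in> V \<Longrightarrow> branches E v \<or> (\<exists>g\<in>carrier G. \<exists>e. v = \<phi> g (att e))"
    and nb: "\<And>e. \<exists>u. {att e, u} \<in> E" and z: "z \<in> glued_vertices"
  shows "branches glued_edges z"
proof -
  obtain w v where wv: "z = (w, v)" "w \<in> syllable_words G" "v \<in> V" using vert_pairs[OF z] by blast
  from br[OF wv(3)] show ?thesis
  proof (elim disjE bexE exE)
    assume "branches E v"
    then obtain x y where xy: "x \<noteq> y" "{v, x} \<in> E" "{v, y} \<in> E" unfolding branches_def by blast
    then have "{z, rep (w, x)} \<in> glued_edges" "{z, rep (w, y)} \<in> glued_edges" "rep (w, x) \<noteq> rep (w, y)"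
      using edgeI[OF wv(2) xy(2)] edgeI[OF wv(2) xy(3)] rep_vertex[OF z] wv rep_inj by auto
    then show ?thesis unfolding branches_def by blast
  next
    fix g e assume g: "g \<in> carrier G" "v = \<phi> g (att e)"
    obtain x where x: "{att e, x} \<in> E" using nb by blast
    obtain y where y: "{att (\<not> e), y} \<in> E" using nb by blast
    have w1: "[(\<one>, \<not> e)] \<in> syllable_words G" by (simp add: syllable_words_Cons)
    have r: "rep ([(\<one>, \<not> e)], att (\<not> e)) = ([], att e)"
      "y \<noteq> att (\<not> e) \<Longrightarrow> rep ([(\<one>, \<not> e)], y) = ([(\<one>, \<not> e)], y)"
      using rep_snoc[of "[]" \<one> "\<not> e"] actsD(2)[OF act] by simp_all
    have "{([], att e), ([], x)} \<in> glued_edges" using edgeI[OF syllable_words_Nil x] by simp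
    moreover have "{([], att e), ([(\<one>, \<not> e)], y)} \<in> glued_edges"
      using edgeI[OF w1 y] E_in_V[OF y] r(1) r(2) by metis
    ultimately have b: "branches glued_edges ([], att e)" unfolding branches_def by blast
    have ws: "(w, g) \<in> carrier (adjoin G)" using wv g by (simp add: carrier_adjoin)
    have "glued_act (w, g) ([], att e) = z"
      using glued_act_copy(1)[OF ws syllable_words_Nil att_V base_copy(1)[OF wv(2) g(1)]] g wv rep_vertex[OF z]
      by simp
    then show ?thesis using branches_image[OF tree_acts_gluing ws b] by simp
  qed
qed

end

section \<open>Malnormal cyclic subgroups\<close>

context group
begin

lemma conj_int_pow:
  assumes "g \<in> carrier G" "x \<in> carrier G" "y \<in> carrier G" "g \<otimes> x = y \<otimes> g"
  shows "g \<otimes> x [^] (n::int) = y [^] n \<otimes> g"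
proof -
  have nat: "g \<otimes> x [^] m = y [^] m \<otimes> g" if "x \<in> carrier G" "y \<in> carrier G" "g \<otimes> x = y \<otimes> g"
    for x y and m :: nat
  proof (induction m)
    case (Suc m)
    have "g \<otimes> x [^] Suc m = y [^] m \<otimes> g \<otimes> x"
      using Suc that assms(1) by (simp add: m_assoc[symmetric])
    also have "\<dots> = y [^] Suc m \<otimes> g" using that assms(1) by (simp add: m_assoc)
    finally show ?case .
  qed (use assms in simp)
  have "y \<otimes> (g \<otimes> inv x) = g \<otimes> x \<otimes> inv x"
    unfolding assms(4) using assms(1-3) by (simp add: m_assoc)
  also have "\<dots> = g" using assms(1,2) by (simp add: m_assoc)
  finally have "inv y \<otimes> g = inv y \<otimes> (y \<otimes> (g \<otimes> inv x))" by simp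
  also have "\<dots> = g \<otimes> inv x" using assms(1-3) by (simp add: m_assoc[symmetric])
  finally have "g \<otimes> inv x = inv y \<otimes> g" ..
  then have "g \<otimes> inv x [^] m = inv y [^] m \<otimes> g" for m :: nat using nat assms by simp
  then show ?thesis using nat[OF assms(2-4)] assms(2,3)
    by (cases n rule: int_cases2) (simp_all add: int_pow_neg_int int_pow_int nat_pow_inv)
qed

lemma foldr_syllables:
  assumes "w @ u \<in> syllable_words G"
  shows "foldr (\<lambda>(a, e) z. left_mul G \<phi> a (letter_mul G e z)) w (u, h) = (w @ u, h)"
  using assms
proof (induction w)
  case (Cons y w)
  then show ?case by (cases y; cases "w @ u") (auto simp: syllable_words_Cons)
qed simp

lemma mult_no_cancel:
  assumes "(w @ [(c, e)], x) \<in> carrier (adjoin G)" "((c', e') # u, h) \<in> carrier (adjoin G)"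
    "e' = e \<or> x \<otimes> c' \<noteq> \<one>"
  shows "(w @ [(c, e)], x) \<otimes>\<^bsub>adjoin G\<^esub> ((c', e') # u, h) = (w @ [(c, e), (x \<otimes> c', e')] @ u, h)"
proof -
  have "(w @ [(c, e)]) @ ((x \<otimes> c', e') # u) \<in> syllable_words G"
    using assms by (intro syllable_words_append[of "w @ [(c, e)]"]) (auto simp: carrier_adjoin syllable_words_Cons)
  from foldr_syllables[OF this] show ?thesis
    by (simp add: mult_adjoin word_act_def del: foldr_append foldr_Cons)
qed

lemma rho_expand:
  assumes "z \<in> carrier (adjoin G)" "c \<in> carrier G" "d \<in> carrier G" "f \<in> carrier G"
  shows "([(c, True), (d, False)], f) \<otimes>\<^bsub>adjoin G\<^esub> z =
    left_mul G (\<otimes>) c (letter_mul G True (left_mul G (\<otimes>) d (letter_mul G False (left_mul G (\<otimes>) f z))))"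
  by (simp add: mult_adjoin word_act_def)

text \<open>
  Let \<open>\<delta> = c t d t\<inverse> f\<close>. If the normal form of \<open>y\<close> does not begin with the syllable \<open>c t\<close>, then
  either that of \<open>\<delta>y\<close> does or it is shorter than that of \<open>y\<close>. Once the normal form begins with
  \<open>c t\<close>, nothing cancels any more: this is where \<open>d \<noteq> \<one>\<close> and \<open>f \<otimes> c \<noteq> \<one>\<close> are needed.
\<close>

lemma attract_eventually:
  assumes c: "c \<in> carrier G" "d \<in> carrier G" "f \<in> carrier G" "d \<noteq> \<one>" "f \<otimes> c \<noteq> \<one>"
    and z: "z \<in> carrier (adjoin G)"
  defines "\<delta> \<equiv> ([(c, True), (d, False)], f)"
  shows "\<exists>N. \<forall>m\<ge>N. \<exists>u. fst (\<delta> [^]\<^bsub>adjoin G\<^esub> (m::nat) \<otimes>\<^bsub>adjoin G\<^esub> z) = (c, True) # (d, False) # u"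
proof -
  interpret K: group "adjoin G" by (rule group_adjoin)
  have \<delta>: "\<delta> \<in> carrier (adjoin G)" using c by (simp add: \<delta>_def carrier_adjoin syllable_words_Cons)
  have A: "\<exists>u. fst (\<delta> \<otimes>\<^bsub>adjoin G\<^esub> y) = (c, True) # (d, False) # u"
    if y: "y \<in> carrier (adjoin G)" "fst y = (c, True) # w" for y w
  proof -
    obtain h where "y = ((c, True) # w, h)" using y(2) by (cases y) auto
    then show ?thesis unfolding \<delta>_def rho_expand[OF y(1) c(1-3)] using c by simp
  qed
  have B: "(\<exists>u. fst (\<delta> \<otimes>\<^bsub>adjoin G\<^esub> y) = (c, True) # u) \<or> length (fst (\<delta> \<otimes>\<^bsub>adjoin G\<^esub> y)) < length (fst y)"
    if y: "y \<in> carrier (adjoin G)" for y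
  proof -
    have *: "(\<exists>u. fst (left_mul G (\<otimes>) c (letter_mul G True (left_mul G (\<otimes>) d x))) = (c, True) # u) \<or>
      length (fst (left_mul G (\<otimes>) c (letter_mul G True (left_mul G (\<otimes>) d x)))) < length (fst x)"
      for x :: "('a \<times> bool) list \<times> 'a"
    proof (cases x rule: syl_pair_cases)
      case (Cons b e w h)
      then show ?thesis using c by (cases w) auto
    qed (use c in auto)
    show ?thesis
    proof (cases y rule: syl_pair_cases)
      case (Nil h)
      then show ?thesis unfolding \<delta>_def rho_expand[OF y c(1-3)] using c by simp
    next
      case (Cons b e w h)
      then show ?thesis unfolding \<delta>_def rho_expand[OF y c(1-3)]
        using *[of "(w, h)"] c by auto
    qed
  qed
  have pow: "\<delta> [^]\<^bsub>adjoin G\<^esub> Suc m \<otimes>\<^bsub>adjoin G\<^esub> y = \<delta> \<otimes>\<^bsub>adjoin G\<^esub> (\<delta> [^]\<^bsub>adjoin G\<^esub> m \<otimes>\<^bsub>adjoin G\<^esub> y)"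
    if "y \<in> carrier (adjoin G)" for y and m :: nat
    using that \<delta> by (simp only: K.nat_pow_Suc2 K.m_assoc K.nat_pow_closed)
  have "\<exists>m u. fst (\<delta> [^]\<^bsub>adjoin G\<^esub> (m::nat) \<otimes>\<^bsub>adjoin G\<^esub> z) = (c, True) # u"
    using z
  proof (induction "length (fst z)" arbitrary: z rule: less_induct)
    case less
    from B[OF less(2)] show ?case
    proof
      assume "\<exists>u. fst (\<delta> \<otimes>\<^bsub>adjoin G\<^esub> z) = (c, True) # u"
      then show ?case using \<delta> by (intro exI[of _ 1]) simp
    next
      assume "length (fst (\<delta> \<otimes>\<^bsub>adjoin G\<^esub> z)) < length (fst z)"
      then obtain m u where "fst (\<delta> [^]\<^bsub>adjoin G\<^esub> (m::nat) \<otimes>\<^bsub>adjoin G\<^esub> (\<delta> \<otimes>\<^bsub>adjoin G\<^esub> z)) = (c, True) # u"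
        using less(1) less(2) \<delta> by blast
      moreover have "\<delta> [^]\<^bsub>adjoin G\<^esub> m \<otimes>\<^bsub>adjoin G\<^esub> (\<delta> \<otimes>\<^bsub>adjoin G\<^esub> z) = \<delta> [^]\<^bsub>adjoin G\<^esub> Suc m \<otimes>\<^bsub>adjoin G\<^esub> z"
        using \<delta> less(2) by (simp add: K.m_assoc)
      ultimately show ?case by metis
    qed
  qed
  then obtain m u where m: "fst (\<delta> [^]\<^bsub>adjoin G\<^esub> (m::nat) \<otimes>\<^bsub>adjoin G\<^esub> z) = (c, True) # u" by blast
  have "\<exists>u. fst (\<delta> [^]\<^bsub>adjoin G\<^esub> n \<otimes>\<^bsub>adjoin G\<^esub> z) = (c, True) # (d, False) # u" if "Suc m \<le> n" for n
    using that
  proof (induction n rule: dec_induct)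
    case base
    show ?case unfolding pow[OF z] using A[OF _ m] \<delta> z by simp
  next
    case (step n)
    then show ?case unfolding pow[OF z] using A[of "\<delta> [^]\<^bsub>adjoin G\<^esub> n \<otimes>\<^bsub>adjoin G\<^esub> z"] \<delta> z by auto
  qed
  then show ?thesis by blast
qed

text \<open>
  The element \<open>a t b t\<inverse>\<close>.
\<close>

definition rho :: "'a \<Rightarrow> 'a \<Rightarrow> ('a \<times> bool) list \<times> 'a"
  where "rho a b = ([(a, True), (b, False)], \<one>)"

lemma rho_closed: "a \<in> carrier G \<Longrightarrow> b \<in> carrier G \<Longrightarrow> b \<noteq> \<one> \<Longrightarrow> rho a b \<in> carrier (adjoin G)"
  by (simp add: rho_def carrier_adjoin syllable_words_Cons)

lemma inv_rho:
  assumes "a \<in> carrier G" "b \<in> carrier G" "b \<noteq> \<one>"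
  shows "inv\<^bsub>adjoin G\<^esub> rho a b = ([(\<one>, True), (inv b, False)], inv a)"
proof -
  interpret K: group "adjoin G" by (rule group_adjoin)
  have *: "([(\<one>, True), (inv b, False)], inv a) \<in> carrier (adjoin G)"
    using assms by (simp add: carrier_adjoin syllable_words_Cons)
  show ?thesis
    by (rule K.inv_equality[OF _ rho_closed[OF assms] *])
      (use assms in \<open>simp add: mult_adjoin one_adjoin word_act_def rho_def\<close>)
qed

text \<open>
  The normal forms of large powers reveal the ends of the axis of \<open>a t b t\<inverse>\<close>. The inverse of
  this element is \<open>t b\<inverse> t\<inverse> a\<inverse>\<close>, so the two ends differ in the first syllable.
\<close>

lemma rho_pow_starts:
  assumes ab: "a \<in> carrier G" "a \<noteq> \<one>" "b \<in> carrier G" "b \<noteq> \<one>" and z: "z \<in> carrier (adjoin G)"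
  shows "\<exists>N. \<forall>m\<ge>N. (\<exists>u. fst (rho a b [^]\<^bsub>adjoin G\<^esub> int m \<otimes>\<^bsub>adjoin G\<^esub> z) = (a, True) # (b, False) # u) \<and>
    (\<exists>u. fst (rho a b [^]\<^bsub>adjoin G\<^esub> (- int m) \<otimes>\<^bsub>adjoin G\<^esub> z) = (\<one>, True) # (inv b, False) # u)"
proof -
  interpret K: group "adjoin G" by (rule group_adjoin)
  have r: "rho a b \<in> carrier (adjoin G)" using ab by (intro rho_closed)
  obtain N where N: "\<forall>m\<ge>N. \<exists>u. fst (rho a b [^]\<^bsub>adjoin G\<^esub> (m::nat) \<otimes>\<^bsub>adjoin G\<^esub> z) = (a, True) # (b, False) # u"
    using attract_eventually[of a b \<one>, OF _ _ _ _ _ z] ab unfolding rho_def by auto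
  have "inv b \<noteq> \<one>" "inv a \<noteq> \<one>" using ab by auto
  then obtain N' where N': "\<forall>m\<ge>N'. \<exists>u. fst ((inv\<^bsub>adjoin G\<^esub> rho a b) [^]\<^bsub>adjoin G\<^esub> (m::nat) \<otimes>\<^bsub>adjoin G\<^esub> z) =
      (\<one>, True) # (inv b, False) # u"
    using attract_eventually[of \<one> "inv b" "inv a", OF _ _ _ _ _ z] ab
    unfolding inv_rho[OF ab(1,3,4)] by auto
  show ?thesis
    using N N' r by (intro exI[of _ "max N N'"]) (simp add: K.int_pow_neg_int int_pow_int K.nat_pow_inv)
qed

text \<open>
  If a power stabilised the coset \<open>w\<close>, then so would all its powers, and \<open>w\<close> would begin with
  the syllables of both ends of the axis.
\<close>

lemma rho_moves_copies:
  assumes ab: "a \<in> carrier G" "a \<noteq> \<one>" "b \<in> carrier G" "b \<noteq> \<one>"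
    and w: "w \<in> syllable_words G" "g \<in> carrier G"
    and e: "rho a b [^]\<^bsub>adjoin G\<^esub> (p::int) \<otimes>\<^bsub>adjoin G\<^esub> (w, \<one>) = (w, g)"
  shows "p = 0"
proof (rule ccontr)
  assume p: "p \<noteq> 0"
  interpret K: group "adjoin G" by (rule group_adjoin)
  interpret e: group_hom G "adjoin G" "\<lambda>g. ([], g)" by unfold_locales (rule embed_hom)
  have r: "rho a b \<in> carrier (adjoin G)" using ab by (intro rho_closed)
  have c: "(w, \<one>) \<in> carrier (adjoin G)" "([], g) \<in> carrier (adjoin G)"
    using w by (auto simp: carrier_adjoin)
  have "(w, \<one>) \<otimes>\<^bsub>adjoin G\<^esub> ([], g) = rho a b [^]\<^bsub>adjoin G\<^esub> p \<otimes>\<^bsub>adjoin G\<^esub> (w, \<one>)"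
    unfolding e by (rule base_copy(2)[OF w])
  then have "(w, \<one>) \<otimes>\<^bsub>adjoin G\<^esub> ([], g) [^]\<^bsub>adjoin G\<^esub> n =
      (rho a b [^]\<^bsub>adjoin G\<^esub> p) [^]\<^bsub>adjoin G\<^esub> n \<otimes>\<^bsub>adjoin G\<^esub> (w, \<one>)" for n :: int
    using K.conj_int_pow[OF c(1,2)] r by simp
  moreover have "([], g) [^]\<^bsub>adjoin G\<^esub> n = ([], g [^] n)" for n :: int
    using hom_int_pow[OF embed_hom _ group_axioms K.group_axioms] w(2) by metis
  ultimately have fixw: "fst (rho a b [^]\<^bsub>adjoin G\<^esub> (p * n) \<otimes>\<^bsub>adjoin G\<^esub> (w, \<one>)) = w" for n :: int
    using base_copy(2)[OF w(1), of "g [^] n"] w(2) r by (simp add: K.int_pow_pow)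
  obtain N where N: "\<forall>m\<ge>N. (\<exists>u. fst (rho a b [^]\<^bsub>adjoin G\<^esub> int m \<otimes>\<^bsub>adjoin G\<^esub> (w, \<one>)) = (a, True) # (b, False) # u) \<and>
    (\<exists>u. fst (rho a b [^]\<^bsub>adjoin G\<^esub> (- int m) \<otimes>\<^bsub>adjoin G\<^esub> (w, \<one>)) = (\<one>, True) # (inv b, False) # u)"
    using rho_pow_starts[OF ab c(1)] by blast
  \<comment> \<open>exponents \<open>\<plusminus>m\<close> that are large and are multiples of \<open>p\<close>\<close>
  let ?m = "nat \<bar>p\<bar> * N"
  have m: "N \<le> ?m" "int ?m = p * (sgn p * int N)" "- int ?m = p * (- sgn p * int N)"
    using p by (auto simp: abs_if sgn_if)
  obtain u u' where u: "fst (rho a b [^]\<^bsub>adjoin G\<^esub> int ?m \<otimes>\<^bsub>adjoin G\<^esub> (w, \<one>)) = (a, True) # u"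
    "fst (rho a b [^]\<^bsub>adjoin G\<^esub> (- int ?m) \<otimes>\<^bsub>adjoin G\<^esub> (w, \<one>)) = (\<one>, True) # u'"
    using N m(1) by blast
  have "w = (a, True) # u"
    by (rule trans[OF sym[OF fixw[of "sgn p * int N", folded m(2)]] u(1)])
  moreover have "w = (\<one>, True) # u'"
    by (rule trans[OF sym[OF fixw[of "- sgn p * int N", folded m(3)]] u(2)])
  ultimately show False using ab(2) by simp
qed

text \<open>
  Conjugation by \<open>g\<close> maps a power of \<open>\<rho>\<^sub>1 = a t b\<^sub>1 t\<inverse>\<close> to a power of \<open>\<rho>\<^sub>2 = a t b\<^sub>2 t\<inverse>\<close>, so \<open>g\<close> maps
  the axis of \<open>\<rho>\<^sub>1\<close> to that of \<open>\<rho>\<^sub>2\<close>. By \<open>rho_pow_starts\<close> the normal forms of \<open>g \<rho>\<^sub>1\<^sup>n\<close> begin, for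
  large multiples \<open>n\<close> of \<open>p\<close> of either sign, with the syllables of an end of the second axis. If
  \<open>g\<close> has at least two syllables, the first two are therefore those of \<open>\<rho>\<^sub>2\<close> or \<open>\<rho>\<^sub>2\<inverse>\<close>, which can
  be split off. Length
  one is excluded by the signs of the syllables. If \<open>g\<close> lies in \<open>G\<close>, comparing both ends
  gives \<open>g = \<one>\<close> and \<open>b\<^sub>1 = b\<^sub>2\<close>, or else \<open>g = a\<close> and \<open>g \<otimes> a = \<one>\<close>, which contradicts \<open>a \<otimes> a \<noteq> \<one>\<close>.
\<close>

lemma rho_malnormal:
  assumes a: "a \<in> carrier G" "a \<otimes> a \<noteq> \<one>"
    and b: "b\<^sub>1 \<in> carrier G" "b\<^sub>1 \<noteq> \<one>" "b\<^sub>2 \<in> carrier G" "b\<^sub>2 \<noteq> \<one>"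
    and g: "g \<in> carrier (adjoin G)" and pq: "(p::int) > 0" "(q::int) \<noteq> 0"
    and e: "g \<otimes>\<^bsub>adjoin G\<^esub> rho a b\<^sub>1 [^]\<^bsub>adjoin G\<^esub> p = rho a b\<^sub>2 [^]\<^bsub>adjoin G\<^esub> q \<otimes>\<^bsub>adjoin G\<^esub> g"
  shows "b\<^sub>1 = b\<^sub>2 \<and> (\<exists>i::int. g = rho a b\<^sub>2 [^]\<^bsub>adjoin G\<^esub> i)"
  using g e
proof (induction "length (fst g)" arbitrary: g rule: less_induct)
  case less
  note g = less(2) and e = less(3)
  interpret K: group "adjoin G" by (rule group_adjoin)
  have a1: "a \<noteq> \<one>" using a by auto
  let ?r = "rho a b\<^sub>1" let ?s = "rho a b\<^sub>2"
  have r: "?r \<in> carrier (adjoin G)" and s: "?s \<in> carrier (adjoin G)" using a b by (auto intro: rho_closed)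
  have conj: "g \<otimes>\<^bsub>adjoin G\<^esub> ?r [^]\<^bsub>adjoin G\<^esub> (p * n) = ?s [^]\<^bsub>adjoin G\<^esub> (q * n) \<otimes>\<^bsub>adjoin G\<^esub> g" for n :: int
    using K.conj_int_pow[OF g _ _ e, of n] r s by (simp add: K.int_pow_pow)
  obtain N where N: "\<forall>m\<ge>N. (\<exists>u. fst (?s [^]\<^bsub>adjoin G\<^esub> int m \<otimes>\<^bsub>adjoin G\<^esub> g) = (a, True) # (b\<^sub>2, False) # u) \<and>
    (\<exists>u. fst (?s [^]\<^bsub>adjoin G\<^esub> (- int m) \<otimes>\<^bsub>adjoin G\<^esub> g) = (\<one>, True) # (inv b\<^sub>2, False) # u)"
    using rho_pow_starts[OF a(1) a1 b(3,4) g] by blast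
  obtain M where M: "\<forall>m\<ge>M. (\<exists>u. fst (?r [^]\<^bsub>adjoin G\<^esub> int m \<otimes>\<^bsub>adjoin G\<^esub> \<one>\<^bsub>adjoin G\<^esub>) = (a, True) # (b\<^sub>1, False) # u) \<and>
    (\<exists>u. fst (?r [^]\<^bsub>adjoin G\<^esub> (- int m) \<otimes>\<^bsub>adjoin G\<^esub> \<one>\<^bsub>adjoin G\<^esub>) = (\<one>, True) # (inv b\<^sub>1, False) # u)"
    using rho_pow_starts[OF a(1) a1 b(1,2) K.one_closed] by blast
  \<comment> \<open>exponents \<open>l = p n\<close> and \<open>m = \<bar>q\<bar> n\<close> that correspond under conjugation and are both large\<close>
  define n where "n = N + M"
  define m where "m = nat \<bar>q\<bar> * n" 
  define l where "l = nat p * n"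
  have "1 \<le> nat \<bar>q\<bar>" "1 \<le> nat p" using pq by auto
  then have "n \<le> m" "n \<le> l" unfolding m_def l_def by auto
  then have "N \<le> m" "M \<le> l" by (auto simp: n_def)
  moreover have "p * int n = int l" "q * int n = sgn q * int m"
    using pq by (auto simp: m_def l_def abs_if sgn_if)
  ultimately have lm: "N \<le> m" "M \<le> l" "p * int n = int l" "p * (- int n) = - int l"
    "q * int n = sgn q * int m" "q * (- int n) = - (sgn q * int m)"
    by (simp_all only: mult_minus_right)
  obtain y\<^sub>1 y\<^sub>2 where y: "?r [^]\<^bsub>adjoin G\<^esub> int l = y\<^sub>1" "?r [^]\<^bsub>adjoin G\<^esub> (- int l) = y\<^sub>2"
    "y\<^sub>1 \<in> carrier (adjoin G)" "y\<^sub>2 \<in> carrier (adjoin G)" using r by simp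
  obtain u\<^sub>1 u\<^sub>2 where u: "fst y\<^sub>1 = (a, True) # (b\<^sub>1, False) # u\<^sub>1" "fst y\<^sub>2 = (\<one>, True) # (inv b\<^sub>1, False) # u\<^sub>2"
    using M lm(2) y by auto
  have c1: "g \<otimes>\<^bsub>adjoin G\<^esub> y\<^sub>1 = ?s [^]\<^bsub>adjoin G\<^esub> (sgn q * int m) \<otimes>\<^bsub>adjoin G\<^esub> g"
    and c2: "g \<otimes>\<^bsub>adjoin G\<^esub> y\<^sub>2 = ?s [^]\<^bsub>adjoin G\<^esub> (- (sgn q * int m)) \<otimes>\<^bsub>adjoin G\<^esub> g"
    using conj[of "int n"] conj[of "- int n"] unfolding lm y by simp_all
  have ends: "q > 0 \<Longrightarrow> \<exists>v. fst (g \<otimes>\<^bsub>adjoin G\<^esub> y\<^sub>1) = (a, True) # (b\<^sub>2, False) # v"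
    "q > 0 \<Longrightarrow> \<exists>v. fst (g \<otimes>\<^bsub>adjoin G\<^esub> y\<^sub>2) = (\<one>, True) # (inv b\<^sub>2, False) # v"
    "q < 0 \<Longrightarrow> \<exists>v. fst (g \<otimes>\<^bsub>adjoin G\<^esub> y\<^sub>2) = (a, True) # (b\<^sub>2, False) # v"
    "q < 0 \<Longrightarrow> \<exists>v. fst (g \<otimes>\<^bsub>adjoin G\<^esub> y\<^sub>1) = (\<one>, True) # (inv b\<^sub>2, False) # v"
    unfolding c1 c2 using N lm(1) by simp_all
  obtain w x where gw: "g = (w, x)" "w \<in> syllable_words G" "x \<in> carrier G"
    using g by (auto simp: carrier_adjoin)
  have yc: "\<exists>h. y\<^sub>1 = ((a, True) # (b\<^sub>1, False) # u\<^sub>1, h)" "\<exists>h. y\<^sub>2 = ((\<one>, True) # (inv b\<^sub>1, False) # u\<^sub>2, h)"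
    using u by (auto simp: prod_eq_iff)
  show ?case
  proof (cases w rule: rev_cases)
    case Nil
    then have f: "fst (g \<otimes>\<^bsub>adjoin G\<^esub> y\<^sub>1) = (x \<otimes> a, True) # (b\<^sub>1, False) # u\<^sub>1"
      "fst (g \<otimes>\<^bsub>adjoin G\<^esub> y\<^sub>2) = (x, True) # (inv b\<^sub>1, False) # u\<^sub>2"
      using yc gw by (auto simp: mult_adjoin word_act_Nil)
    show ?thesis
    proof (cases "q > 0")
      case True
      then have "x \<otimes> a = a" "b\<^sub>1 = b\<^sub>2" using ends(1) f by auto
      then have "x = \<one>" using gw a by simp
      then have "g = ?s [^]\<^bsub>adjoin G\<^esub> (0::int)" using gw Nil by (simp add: one_adjoin)
      then show ?thesis using \<open>b\<^sub>1 = b\<^sub>2\<close> by blast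
    next
      case False
      then have "x = a" "x \<otimes> a = \<one>" using ends(3,4) f pq by auto
      then show ?thesis using a by simp
    qed
  next
    case (snoc w' ce)
    obtain c f where ce: "ce = (c, f)" by fastforce
    \<comment> \<open>on the right of \<open>g\<close> nothing cancels for at least one sign of the exponent, as \<open>x \<otimes> a = \<one>\<close> and \<open>x = \<one>\<close> exclude each other\<close>
    have "\<exists>c' v. fst (g \<otimes>\<^bsub>adjoin G\<^esub> y\<^sub>1) = w @ (c', True) # v \<or> fst (g \<otimes>\<^bsub>adjoin G\<^esub> y\<^sub>2) = w @ (c', True) # v"
    proof (cases "f = True \<or> x \<otimes> a \<noteq> \<one>")
      case True
      obtain h where h: "y\<^sub>1 = ((a, True) # (b\<^sub>1, False) # u\<^sub>1, h)" using yc by blast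
      show ?thesis
        using mult_no_cancel[of w' c f x a True "(b\<^sub>1, False) # u\<^sub>1" h] True g y(3) snoc ce gw h by auto
    next
      case False
      then have "x \<noteq> \<one>" using a a1 by auto
      obtain h where h: "y\<^sub>2 = ((\<one>, True) # (inv b\<^sub>1, False) # u\<^sub>2, h)" using yc by blast
      show ?thesis
        using mult_no_cancel[of w' c f x \<one> True "(inv b\<^sub>1, False) # u\<^sub>2" h] \<open>x \<noteq> \<one>\<close> g y(4) snoc ce gw h by auto
    qed
    moreover have "\<exists>v. fst (g \<otimes>\<^bsub>adjoin G\<^esub> y) = (a, True) # (b\<^sub>2, False) # v \<or>
        fst (g \<otimes>\<^bsub>adjoin G\<^esub> y) = (\<one>, True) # (inv b\<^sub>2, False) # v" if "y \<in> {y\<^sub>1, y\<^sub>2}" for y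
    proof (cases "q > 0")
      case True
      then show ?thesis using ends(1,2) that by blast
    next
      case False
      then have "q < 0" using pq(2) by simp
      then show ?thesis using ends(3,4) that by blast
    qed
    ultimately obtain c' v v' where v': "w @ (c', True) # v = (a, True) # (b\<^sub>2, False) # v' \<or>
        w @ (c', True) # v = (\<one>, True) # (inv b\<^sub>2, False) # v'"
      by (metis insertCI)
    have "w \<noteq> []" using snoc by simp
    then obtain w'' where w'': "w = (a, True) # (b\<^sub>2, False) # w'' \<or> w = (\<one>, True) # (inv b\<^sub>2, False) # w''"
      using v' by (cases w; cases "tl w") auto
    have "\<exists>g'\<in>carrier (adjoin G). \<exists>i::int. g = ?s [^]\<^bsub>adjoin G\<^esub> i \<otimes>\<^bsub>adjoin G\<^esub> g' \<and> length (fst g') < length (fst g)"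
      using w''
    proof
      assume w: "w = (a, True) # (b\<^sub>2, False) # w''"
      have "w'' \<in> syllable_words G" using gw(2) w by (simp add: syllable_words_Cons)
      then have g': "(w'', x) \<in> carrier (adjoin G)" using gw by (simp add: carrier_adjoin)
      have "?s \<otimes>\<^bsub>adjoin G\<^esub> (w'', x) = g"
        using foldr_syllables[of "[(a, True), (b\<^sub>2, False)]" w'' "(\<otimes>)" x] w gw
          left_mul_one[OF acts_self, of "(w'', x)"] g'
        by (simp add: rho_def mult_adjoin word_act_def carrier_adjoin)
      then have "g = ?s [^]\<^bsub>adjoin G\<^esub> (1::int) \<otimes>\<^bsub>adjoin G\<^esub> (w'', x)" using s by simp
      moreover have "length (fst (w'', x)) < length (fst g)" using gw w by simp
      ultimately show ?thesis using g' by blast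
    next
      assume w: "w = (\<one>, True) # (inv b\<^sub>2, False) # w''"
      have "w'' \<in> syllable_words G" using gw(2) w by (simp add: syllable_words_Cons)
      then have g'': "(w'', x) \<in> syllable_words G \<times> carrier G" using gw by simp
      let ?g = "left_mul G (\<otimes>) a (w'', x)"
      have g': "?g \<in> carrier (adjoin G)"
        using left_mul_closed[OF acts_self a(1) g''] by (simp add: carrier_adjoin)
      have l: "left_mul G (\<otimes>) (inv a) ?g = (w'', x)"
        using left_mul_mult[OF acts_self inv_closed a(1) g'', of a] left_mul_one[OF acts_self g''] a(1) by simp
      have "inv\<^bsub>adjoin G\<^esub> ?s \<otimes>\<^bsub>adjoin G\<^esub> ?g = g"
        using foldr_syllables[of "[(\<one>, True), (inv b\<^sub>2, False)]" w'' "(\<otimes>)" x] w gw l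
        unfolding inv_rho[OF a(1) b(3,4)] mult_adjoin word_act_def by simp
      then have "g = ?s [^]\<^bsub>adjoin G\<^esub> (-1::int) \<otimes>\<^bsub>adjoin G\<^esub> ?g" using s by (simp add: K.int_pow_neg)
      moreover have "length (fst ?g) = length w''" by (cases w'') auto
      then have "length (fst ?g) < length (fst g)" using gw w by simp
      ultimately show ?thesis using g' by blast
    qed
    then obtain g' i where g': "g' \<in> carrier (adjoin G)" "g = ?s [^]\<^bsub>adjoin G\<^esub> (i::int) \<otimes>\<^bsub>adjoin G\<^esub> g'"
      "length (fst g') < length (fst g)" by blast
    have "?s [^]\<^bsub>adjoin G\<^esub> i \<otimes>\<^bsub>adjoin G\<^esub> (g' \<otimes>\<^bsub>adjoin G\<^esub> ?r [^]\<^bsub>adjoin G\<^esub> p) =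
        ?s [^]\<^bsub>adjoin G\<^esub> q \<otimes>\<^bsub>adjoin G\<^esub> ?s [^]\<^bsub>adjoin G\<^esub> i \<otimes>\<^bsub>adjoin G\<^esub> g'"
      using e r s g'(1) unfolding g'(2) by (simp add: K.m_assoc)
    also have "\<dots> = ?s [^]\<^bsub>adjoin G\<^esub> i \<otimes>\<^bsub>adjoin G\<^esub> (?s [^]\<^bsub>adjoin G\<^esub> q \<otimes>\<^bsub>adjoin G\<^esub> g')"
      using s g'(1) by (simp add: K.m_assoc[symmetric] K.int_pow_mult[symmetric] add.commute)
    finally have "g' \<otimes>\<^bsub>adjoin G\<^esub> ?r [^]\<^bsub>adjoin G\<^esub> p = ?s [^]\<^bsub>adjoin G\<^esub> q \<otimes>\<^bsub>adjoin G\<^esub> g'"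
      by (rule iffD1[OF K.Units_l_cancel, rotated 3]) (use r s g' in simp_all)
    from less(1)[OF g'(3,1) this] obtain j :: int where j: "b\<^sub>1 = b\<^sub>2" "g' = ?s [^]\<^bsub>adjoin G\<^esub> j" by blast
    then have "g = ?s [^]\<^bsub>adjoin G\<^esub> (i + j)" using g'(2) s by (simp add: K.int_pow_mult)
    then show ?thesis using j(1) by blast
  qed
qed

end

section \<open>Adding a free generator\<close>

lemma acts_int_pow_fix:
  assumes G: "group G" and act: "acts G V \<phi>" and g: "g \<in> carrier G" "v \<in> V" "\<phi> g v = v"
  shows "\<phi> (g [^]\<^bsub>G\<^esub> (i::int)) v = v"
proof -
  interpret group G by fact
  have nat: "\<phi> (x [^]\<^bsub>G\<^esub> n) v = v" if x: "x \<in> carrier G" "\<phi> x v = v" for x and n :: nat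
  proof (induction n)
    case (Suc n)
    then show ?case using actsD(3)[OF act nat_pow_closed[OF x(1)] x(1) g(2)] x(2) by simp
  qed (use actsD(2)[OF act g(2)] in simp)
  have "\<phi> (inv\<^bsub>G\<^esub> g) v = v" using acts_inv(1)[OF G act g(1,2)] g(3) by simp
  then show ?thesis using nat[OF g(1,3)] nat[of "inv\<^bsub>G\<^esub> g"] g(1)
    by (cases i rule: int_cases2) (simp_all add: int_pow_neg_int int_pow_int nat_pow_inv)
qed

text \<open>
  What legs at \<open>v\<close> stabilised by \<open>\<langle>c False\<rangle>\<close> and \<open>\<langle>c True\<rangle>\<close> require of these two subgroups: their
  non-trivial elements fix no edge at \<open>v\<close>, and the two subgroups form a malnormal family.
\<close>

definition separated ::
    "('g, 'b) monoid_scheme \<Rightarrow> 'v set set \<Rightarrow> ('g \<Rightarrow> 'v \<Rightarrow> 'v) \<Rightarrow> 'v \<Rightarrow> (bool \<Rightarrow> 'g) \<Rightarrow> bool"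
  where "separated G E \<phi> v c \<longleftrightarrow>
    (\<forall>e. c e \<in> carrier G \<and> \<phi> (c e) v = v \<and> c e \<otimes>\<^bsub>G\<^esub> c e \<noteq> \<one>\<^bsub>G\<^esub>) \<and>
    (\<forall>e (i::int) u. {v, u} \<in> E \<longrightarrow> \<phi> (c e [^]\<^bsub>G\<^esub> i) u = u \<longrightarrow> c e [^]\<^bsub>G\<^esub> i = \<one>\<^bsub>G\<^esub>) \<and>
    (\<forall>g\<in>carrier G. \<forall>e e' (i::int) (j::int).
      g \<otimes>\<^bsub>G\<^esub> c e [^]\<^bsub>G\<^esub> i = c e' [^]\<^bsub>G\<^esub> j \<otimes>\<^bsub>G\<^esub> g \<longrightarrow> c e [^]\<^bsub>G\<^esub> i \<noteq> \<one>\<^bsub>G\<^esub> \<longrightarrow>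
      e = e' \<and> (\<exists>m::int. g = c e' [^]\<^bsub>G\<^esub> m))"

definition ready ::
    "nat \<Rightarrow> nat \<Rightarrow> ('g, 'b) monoid_scheme \<Rightarrow> 'v set \<Rightarrow> 'v set set \<Rightarrow> ('g \<Rightarrow> 'v \<Rightarrow> 'v) \<Rightarrow> 'v \<Rightarrow> (bool \<Rightarrow> 'g) \<Rightarrow> bool"
  where "ready k n G V E \<phi> v c \<longleftrightarrow>
    good_action k n G V E \<phi> \<and> (\<forall>u\<in>V. branches E u) \<and> v \<in> V \<and> separated G E \<phi> v c"

text \<open>
  The vertices \<open>L False\<close> and \<open>L True\<close> can be glued by means of a new generator; all leaves
  of the tree are translates of them, so that none remains.
\<close>

definition gluable ::
    "nat \<Rightarrow> nat \<Rightarrow> ('g, 'b) monoid_scheme \<Rightarrow> 'v set \<Rightarrow> 'v set set \<Rightarrow> ('g \<Rightarrow> 'v \<Rightarrow> 'v) \<Rightarrow>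
      (bool \<Rightarrow> 'v) \<Rightarrow> (bool \<Rightarrow> 'g) \<Rightarrow> bool"
  where "gluable k n G V E \<phi> L c \<longleftrightarrow>
    good_action k n G V E \<phi> \<and>
    (\<forall>v\<in>V. branches E v \<or> (\<exists>g\<in>carrier G. \<exists>e. v = \<phi> g (L e))) \<and>
    (\<forall>e. L e \<in> V \<and> (\<exists>u. {L e, u} \<in> E) \<and> c e \<in> carrier G \<and> \<phi> (c e) (L e) = L e \<and>
      c e \<otimes>\<^bsub>G\<^esub> c e \<noteq> \<one>\<^bsub>G\<^esub>)"

lemma (in gluing) rho_fixes:
  assumes "a \<in> carrier G" "\<phi> a L = L" "b \<in> carrier G" "\<phi> b L' = L'" "b \<noteq> \<one>"
  shows "glued_act (rho a b) ([], L) = ([], L)"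
proof -
  have "word_act G \<phi> (rho a b) ([], L) = ([(a, True)] @ [(b, False)], L)"
    using assms actsD(2)[OF act L] by (simp add: rho_def word_act_def)
  moreover have "rep ([(a, True)] @ [(b, False)], L) = rep ([] @ [(a, True)], L')"
    using rep_snoc[of "[(a, True)]" b False L] assms by (simp add: att_def)
  moreover have "\<dots> = ([], L)"
    using rep_snoc[of "[]" a True L'] assms by (simp add: att_def)
  ultimately show ?thesis by (simp add: glued_act_def)
qed

text \<open>
  Gluing \<open>L\<close> to \<open>L'\<close> makes \<open>a t b t\<inverse>\<close> and \<open>a t b\<inverse> t\<inverse>\<close> available for legs at the glued vertex, where
  \<open>a\<close> and \<open>b\<close> are the given elements that fix \<open>L\<close> and \<open>L'\<close>.
\<close>

proposition ready_if_gluable: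
  fixes V :: "'v set" and G :: "('g, 'b) monoid_scheme" (structure)
  assumes J: "gluable k n G V E \<phi> L c"
  shows "\<exists>(V' :: (('g \<times> bool) list \<times> 'v) set) E' \<phi>' v c'. ready k n (adjoin G) V' E' \<phi>' v c'"
proof -
  have good: "good_action k n G V E \<phi>" and
    br: "\<And>v. v \<in> V \<Longrightarrow> branches E v \<or> (\<exists>g\<in>carrier G. \<exists>e. v = \<phi> g (L e))" and
    LL: "\<And>e. L e \<in> V" "\<And>e. \<exists>u. {L e, u} \<in> E" "\<And>e. c e \<in> carrier G" "\<And>e. \<phi> (c e) (L e) = L e"
      "\<And>e. c e \<otimes> c e \<noteq> \<one>"
    using J unfolding gluable_def by auto
  have T: "tree_acts G V E \<phi>" by (rule good_actionD(1)[OF good])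
  interpret gluing G V E \<phi> "L False" "L True"
    using tree_actsD(1)[OF T] T LL(1) by (simp add: gluing_def gluing_axioms_def)
  interpret K: group "adjoin G" by (rule group_adjoin)
  have att: "att e = L e" for e by (cases e) (simp_all add: att_def)
  have gK: "good_action k n (adjoin G) glued_vertices glued_edges glued_act" by (rule good_action_gluing[OF good])
  have brK: "branches glued_edges z" if "z \<in> glued_vertices" for z
    by (rule branches_gluing[OF _ _ that]) (use br LL(2) in \<open>simp_all add: att\<close>)
  let ?v = "([], L False) :: ('g \<times> bool) list \<times> 'v"
  have v: "?v \<in> glued_vertices" using LL(1) by (simp add: glued_vertices_def)
  \<comment> \<open>the two elements differ in the sign of \<open>b\<close>; they are distinct since \<open>b\<close> has a non-trivial square\<close>
  define b where "b e = (if e then inv c True else c True)" for e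
  have c1: "c e \<noteq> \<one>" for e using LL(5)[of e] by auto
  have b: "b e \<in> carrier G" "b e \<noteq> \<one>" "\<phi> (b e) (L True) = L True" for e
    using LL(1,3,4)[of True] c1[of True] acts_inv(1)[OF tree_actsD(1)[OF T] act LL(3)[of True] LL(1)[of True]]
    by (auto simp: b_def)
  have b_inj: "e = e'" if "b e = b e'" for e e'
  proof (rule ccontr)
    assume "e \<noteq> e'"
    then have "inv c True = c True" using that by (cases e; cases e') (auto simp: b_def)
    then show False using LL(5)[of True] LL(3)[of True] by (metis l_inv)
  qed
  define \<gamma> where "\<gamma> e = rho (c False) (b e)" for e
  have \<gamma>: "\<gamma> e \<in> carrier (adjoin G)" for e unfolding \<gamma>_def by (rule rho_closed[OF LL(3) b(1,2)])
  have fixv: "glued_act (\<gamma> e) ?v = ?v" for e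
    unfolding \<gamma>_def by (rule rho_fixes) (use LL b in auto)
  have copy: "i = 0" if "w \<in> syllable_words G" "g \<in> carrier G"
    "\<gamma> e [^]\<^bsub>adjoin G\<^esub> i \<otimes>\<^bsub>adjoin G\<^esub> (w, \<one>) = (w, g)" for i :: int and e w g
    using rho_moves_copies[OF LL(3) c1 b(1,2) that(1,2)] that(3) unfolding \<gamma>_def by blast
  have pow0: "i = 0" if "\<gamma> e [^]\<^bsub>adjoin G\<^esub> i = \<one>\<^bsub>adjoin G\<^esub>" for i :: int and e
  proof (rule copy[of "[]" "\<one>"])
    show "\<gamma> e [^]\<^bsub>adjoin G\<^esub> i \<otimes>\<^bsub>adjoin G\<^esub> ([], \<one>) = ([], \<one>)"
      unfolding that using K.l_one[OF K.one_closed] by (simp only: one_adjoin)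
  qed simp_all
  have "separated (adjoin G) glued_edges glued_act ?v \<gamma>"
    unfolding separated_def
  proof (intro conjI allI ballI impI)
    fix e :: bool
    show "\<gamma> e \<in> carrier (adjoin G)" by (rule \<gamma>)
    show "glued_act (\<gamma> e) ?v = ?v" by (rule fixv)
    have "\<gamma> e [^]\<^bsub>adjoin G\<^esub> (2::int) = \<gamma> e \<otimes>\<^bsub>adjoin G\<^esub> \<gamma> e"
      using K.int_pow_mult[OF \<gamma>[of e], of 1 1] \<gamma> by simp
    then show "\<gamma> e \<otimes>\<^bsub>adjoin G\<^esub> \<gamma> e \<noteq> \<one>\<^bsub>adjoin G\<^esub>" using pow0[of e 2] by auto
  next
    fix e :: bool and i :: int and u
    assume u: "{?v, u} \<in> glued_edges" and fu: "glued_act (\<gamma> e [^]\<^bsub>adjoin G\<^esub> i) u = u"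
    have fv: "glued_act (\<gamma> e [^]\<^bsub>adjoin G\<^esub> i) ?v = ?v"
      by (rule acts_int_pow_fix[OF K.is_group acts_glued_act \<gamma> v fixv])
    obtain w x y where w: "w \<in> syllable_words G" "{x, y} \<in> E" "{?v, u} = {rep (w, x), rep (w, y)}"
      using u unfolding glued_edges_def by blast
    have "{glued_act (\<gamma> e [^]\<^bsub>adjoin G\<^esub> i) (rep (w, x)), glued_act (\<gamma> e [^]\<^bsub>adjoin G\<^esub> i) (rep (w, y))} =
        {rep (w, x), rep (w, y)}" using w(3) fu fv by (auto simp: doubleton_eq_iff)
    then obtain g where "g \<in> carrier G" "\<gamma> e [^]\<^bsub>adjoin G\<^esub> i \<otimes>\<^bsub>adjoin G\<^esub> (w, \<one>) = (w, g)"
      by (rule edge_stabiliser[OF K.int_pow_closed[OF \<gamma>] w(1,2)])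
    then have "i = 0" by (rule copy[OF w(1)])
    then show "\<gamma> e [^]\<^bsub>adjoin G\<^esub> i = \<one>\<^bsub>adjoin G\<^esub>" by simp
  next
    fix g e e' and i j :: int
    assume g: "g \<in> carrier (adjoin G)"
      and eq: "g \<otimes>\<^bsub>adjoin G\<^esub> \<gamma> e [^]\<^bsub>adjoin G\<^esub> i = \<gamma> e' [^]\<^bsub>adjoin G\<^esub> j \<otimes>\<^bsub>adjoin G\<^esub> g"
      and ne: "\<gamma> e [^]\<^bsub>adjoin G\<^esub> i \<noteq> \<one>\<^bsub>adjoin G\<^esub>"
    have i: "i \<noteq> 0" using ne by (metis int_pow_0)
    have j: "j \<noteq> 0"
    proof
      assume "j = 0"
      then have "g \<otimes>\<^bsub>adjoin G\<^esub> \<gamma> e [^]\<^bsub>adjoin G\<^esub> i = g" using eq g by simp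
      then show False using g ne \<gamma> by simp
    qed
    have eq': "g \<otimes>\<^bsub>adjoin G\<^esub> \<gamma> e [^]\<^bsub>adjoin G\<^esub> (sgn i * i) = \<gamma> e' [^]\<^bsub>adjoin G\<^esub> (sgn i * j) \<otimes>\<^bsub>adjoin G\<^esub> g"
      using K.conj_int_pow[OF g _ _ eq, of "sgn i"] \<gamma> by (simp add: K.int_pow_pow mult.commute)
    have "b e = b e' \<and> (\<exists>m::int. g = \<gamma> e' [^]\<^bsub>adjoin G\<^esub> m)"
      unfolding \<gamma>_def
      by (rule rho_malnormal[OF LL(3,5) b(1,2) b(1,2) g _ _ eq'[unfolded \<gamma>_def]])
        (use i j in \<open>auto simp: sgn_if\<close>)
    then show "e = e'" "\<exists>m::int. g = \<gamma> e' [^]\<^bsub>adjoin G\<^esub> m" using b_inj by auto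
  qed
  then have "ready k n (adjoin G) glued_vertices glued_edges glued_act ?v \<gamma>"
    using gK brK v unfolding ready_def by blast
  then show ?thesis by blast
qed

section \<open>Hanging legs on a tree\<close>

text \<open>
  Every element \<open>l\<close> of the \<open>G\<close>-set \<open>\<Lambda>\<close> names a leg with foot \<open>\<pi> l\<close>. The foot counts as its
  vertex number 0.
\<close>

locale legs = group G for G (structure) +
  fixes V :: "'v set" and E :: "'v set set" and \<phi> :: "'a \<Rightarrow> 'v \<Rightarrow> 'v"
    and \<Lambda> :: "'l set" and \<alpha> :: "'a \<Rightarrow> 'l \<Rightarrow> 'l" and \<pi> :: "'l \<Rightarrow> 'v"
  assumes T: "tree_acts G V E \<phi>" and \<Lambda>: "acts G \<Lambda> \<alpha>"
    and \<pi>: "\<And>l. l \<in> \<Lambda> \<Longrightarrow> \<pi> l \<in> V"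
    and \<pi>_equivariant: "\<And>g l. g \<in> carrier G \<Longrightarrow> l \<in> \<Lambda> \<Longrightarrow> \<pi> (\<alpha> g l) = \<phi> g (\<pi> l)"
begin

definition on_leg :: "nat \<Rightarrow> 'l \<Rightarrow> 'v + 'l \<times> nat"
  where "on_leg i l = (if i = 0 then Inl (\<pi> l) else Inr (l, i))"

definition leg_vertices :: "nat \<Rightarrow> ('v + 'l \<times> nat) set"
  where "leg_vertices n = Inl ` V \<union> (\<lambda>(l, i). on_leg i l) ` (\<Lambda> \<times> {..n})"

definition leg_edges :: "nat \<Rightarrow> ('v + 'l \<times> nat) set set"
  where "leg_edges n = (`) Inl ` E \<union> {{on_leg i l, on_leg (Suc i) l} | l i. l \<in> \<Lambda> \<and> i < n}"

fun leg_act :: "'a \<Rightarrow> 'v + 'l \<times> nat \<Rightarrow> 'v + 'l \<times> nat"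
  where
    "leg_act g (Inl v) = Inl (\<phi> g v)"
  | "leg_act g (Inr (l, i)) = Inr (\<alpha> g l, i)"

lemma on_leg_eq_iff:
  "on_leg i l = on_leg j m \<longleftrightarrow> i = j \<and> (if i = 0 then \<pi> l = \<pi> m else l = m)"
  by (auto simp: on_leg_def)

lemma on_leg_Suc_neq [simp]: "on_leg (Suc i) l \<noteq> Inl v" "Inl v \<noteq> on_leg (Suc i) l"
  by (simp_all add: on_leg_def)

lemma leg_act_on_leg: "g \<in> carrier G \<Longrightarrow> l \<in> \<Lambda> \<Longrightarrow> leg_act g (on_leg i l) = on_leg i (\<alpha> g l)"
  by (simp add: on_leg_def \<pi>_equivariant)

lemma leg_vertices_cases:
  assumes "x \<in> leg_vertices n"
  obtains v where "v \<in> V" "x = Inl v" | l i where "l \<in> \<Lambda>" "i < n" "x = on_leg (Suc i) l"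
proof -
  from assms consider v where "v \<in> V" "x = Inl v" | l i where "l \<in> \<Lambda>" "i \<le> n" "x = on_leg i l"
    by (auto simp: leg_vertices_def)
  then show thesis
  proof cases
    case (2 l i)
    then show ?thesis using that \<pi>[of l] by (cases i) (auto simp: on_leg_def)
  qed (rule that)
qed

lemma on_leg_lvert: "l \<in> \<Lambda> \<Longrightarrow> i \<le> n \<Longrightarrow> on_leg i l \<in> leg_vertices n"
  by (auto simp: leg_vertices_def)

lemma leg_edges_legI: "l \<in> \<Lambda> \<Longrightarrow> i < n \<Longrightarrow> {on_leg i l, on_leg (Suc i) l} \<in> leg_edges n"
  unfolding leg_edges_def by blast

lemma leg_edges_oldI:
  assumes "{u, v} \<in> E"
  shows "{Inl u, Inl v} \<in> leg_edges n"
proof -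
  have "Inl ` {u, v} \<in> (`) Inl ` E" by (rule imageI[OF assms])
  then show ?thesis unfolding leg_edges_def by (intro UnI1) simp
qed

lemma E_in_V: "{u, v} \<in> E \<Longrightarrow> u \<in> V \<and> v \<in> V \<and> u \<noteq> v"
  using tree_actsD(2)[OF T] rooted_edge_cases(1-3) by metis

lemma E_pair: assumes d: "d \<in> E" shows "\<exists>u v. d = {u, v} \<and> {u, v} \<in> E"
proof -
  obtain r par where "rooted r par V E" using tree_actsD(2)[OF T] by blast
  then obtain v where "d = {v, par v}" using d by (auto simp: rooted_def)
  then show ?thesis using d by blast
qed

lemma leg_edges_cases:
  assumes "{x, y} \<in> leg_edges n"
  obtains u v where "{u, v} \<in> E" "x = Inl u" "y = Inl v"
  | l i where "l \<in> \<Lambda>" "i < n" "x = on_leg i l" "y = on_leg (Suc i) l"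
  | l i where "l \<in> \<Lambda>" "i < n" "y = on_leg i l" "x = on_leg (Suc i) l"
proof -
  from assms consider d where "d \<in> E" "{x, y} = Inl ` d"
    | l i where "l \<in> \<Lambda>" "i < n" "{x, y} = {on_leg i l, on_leg (Suc i) l}"
    unfolding leg_edges_def by blast
  then show thesis
  proof cases
    case (1 d)
    then obtain u v where "d = {u, v}" "{u, v} \<in> E" using E_pair by blast
    then show ?thesis using 1 that(1)[of u v] that(1)[of v u]
      by (auto simp: doubleton_eq_iff insert_commute)
  next
    case (2 l i)
    then show ?thesis using that(2)[of l i] that(3)[of l i] by (auto simp: doubleton_eq_iff)
  qed
qed

lemma acts_leg_act: "acts G (leg_vertices n) leg_act"
  unfolding acts_def
proof (intro conjI ballI)
  note a = tree_actsD(3)[OF T]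
  show "leg_act g x \<in> leg_vertices n" if "g \<in> carrier G" "x \<in> leg_vertices n" for g x
    using that(2) by (cases rule: leg_vertices_cases)
      (use that(1) actsD(1)[OF a] actsD(1)[OF \<Lambda>] leg_act_on_leg on_leg_lvert in \<open>auto simp: leg_vertices_def\<close>)
  show "leg_act \<one> x = x" if "x \<in> leg_vertices n" for x
    using that by (cases rule: leg_vertices_cases)
      (use actsD(2)[OF a] actsD(2)[OF \<Lambda>] leg_act_on_leg in auto)
  show "leg_act (g \<otimes> h) x = leg_act g (leg_act h x)" if "g \<in> carrier G" "h \<in> carrier G" "x \<in> leg_vertices n" for g h x
    using that(3) by (cases rule: leg_vertices_cases)
      (use that(1,2) actsD(1,3)[OF a] actsD(1,3)[OF \<Lambda>] leg_act_on_leg in auto)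
qed

lemma rooted_legs: "\<exists>r par. rooted r par (leg_vertices n) (leg_edges n)"
proof -
  obtain r par where R: "rooted r par V E" using tree_actsD(2)[OF T] by blast
  \<comment> \<open>legs are descended towards their feet\<close>
  define par' where "par' x = (case x of Inl v \<Rightarrow> Inl (par v) | Inr (l, i) \<Rightarrow> on_leg (i - 1) l)" for x
  have par'_leg: "par' (on_leg (Suc i) l) = on_leg i l" for i l
    by (simp add: par'_def on_leg_def)
  have par'_old: "par' (Inl v) = Inl (par v)" for v by (simp add: par'_def)
  have old: "\<exists>m. (par' ^^ m) (Inl v) = Inl r" if "v \<in> V" for v
    using R that
  proof (induction rule: rooted_induct)
    case root
    show ?case by (intro exI[of _ 0]) simp
  next
    case (step v)
    then obtain m where "(par' ^^ m) (Inl (par v)) = Inl r" by blast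
    then have "(par' ^^ Suc m) (Inl v) = Inl r" by (simp only: funpow_Suc_right o_apply par'_old)
    then show ?case by blast
  qed
  have leg: "\<exists>m. (par' ^^ m) (on_leg i l) = Inl r" if l: "l \<in> \<Lambda>" for i l
  proof (induction i)
    case 0
    then show ?case using old[OF \<pi>[OF l]] by (simp add: on_leg_def)
  next
    case (Suc i)
    then obtain m where "(par' ^^ m) (on_leg i l) = Inl r" by blast
    then have "(par' ^^ Suc m) (on_leg (Suc i) l) = Inl r"
      by (simp only: funpow_Suc_right o_apply par'_leg)
    then show ?case by blast
  qed
  have "rooted (Inl r) par' (leg_vertices n) (leg_edges n)"
    unfolding rooted_def
  proof (intro conjI ballI)
    show "Inl r \<in> leg_vertices n" using R by (auto simp: rooted_def leg_vertices_def)
    show "par' (Inl r) = Inl r" using R by (simp add: rooted_def par'_def)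
    show "par' \<in> leg_vertices n \<rightarrow> leg_vertices n"
    proof
      fix x assume "x \<in> leg_vertices n"
      then show "par' x \<in> leg_vertices n"
        by (cases rule: leg_vertices_cases)
          (use R in \<open>auto simp: par'_old par'_leg on_leg_lvert rooted_def leg_vertices_def[of n]\<close>)
    qed
    show "\<exists>m. (par' ^^ m) x = Inl r" if "x \<in> leg_vertices n" for x
      using that by (cases rule: leg_vertices_cases) (use old leg in auto)
    show "leg_edges n = (\<lambda>x. {x, par' x}) ` (leg_vertices n - {Inl r})"
    proof (intro equalityI subsetI)
      fix e assume "e \<in> leg_edges n"
      then consider d where "d \<in> E" "e = Inl ` d"
        | l i where "l \<in> \<Lambda>" "i < n" "e = {on_leg i l, on_leg (Suc i) l}"
        unfolding leg_edges_def by blast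
      then show "e \<in> (\<lambda>x. {x, par' x}) ` (leg_vertices n - {Inl r})"
      proof cases
        case (1 d)
        then obtain v where "v \<in> V" "v \<noteq> r" "d = {v, par v}" using R by (auto simp: rooted_def)
        then show ?thesis using 1 by (intro image_eqI[of _ _ "Inl v"]) (auto simp: par'_old leg_vertices_def)
      next
        case (2 l i)
        then show ?thesis
          by (intro image_eqI[of _ _ "on_leg (Suc i) l"])
            (auto simp: par'_leg on_leg_lvert insert_commute)
      qed
    next
      fix e assume "e \<in> (\<lambda>x. {x, par' x}) ` (leg_vertices n - {Inl r})"
      then obtain x where x: "x \<in> leg_vertices n" "x \<noteq> Inl r" "e = {x, par' x}" by blast
      from x(1) show "e \<in> leg_edges n"
      proof (cases rule: leg_vertices_cases)
        case (1 v)
        then show ?thesis using x rooted_parent_edge(1)[OF R] leg_edges_oldI by (auto simp: par'_old)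
      next
        case (2 l i)
        then show ?thesis using x leg_edges_legI by (simp add: par'_leg insert_commute)
      qed
    qed
  qed
  then show ?thesis by blast
qed

lemma tree_acts_legs: "tree_acts G (leg_vertices n) (leg_edges n) leg_act"
  unfolding tree_acts_def
proof (intro conjI ballI allI impI)
  fix g x y assume g: "g \<in> carrier G" and e: "{x, y} \<in> leg_edges n"
  show "{leg_act g x, leg_act g y} \<in> leg_edges n"
    using e
  proof (cases rule: leg_edges_cases)
    case (1 u v)
    then show ?thesis using tree_actsD(4)[OF T g] leg_edges_oldI by auto
  next
    case (2 l i)
    then show ?thesis using g leg_act_on_leg leg_edges_legI actsD(1)[OF \<Lambda>] by simp
  next
    case (3 l i)
    then show ?thesis using g leg_act_on_leg leg_edges_legI actsD(1)[OF \<Lambda>]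
      by (simp add: insert_commute)
  qed
  show "\<not> (leg_act g x = y \<and> leg_act g y = x)"
    using e
  proof (cases rule: leg_edges_cases)
    case (1 u v)
    then show ?thesis using tree_actsD(5)[OF T g] by auto
  qed (use g leg_act_on_leg in \<open>auto simp: on_leg_eq_iff\<close>)
qed (rule is_group, rule rooted_legs, rule acts_leg_act)

lemma leg_edges_Suc_new:
  assumes "{x, y} \<in> leg_edges (Suc n)" "{x, y} \<notin> leg_edges n"
  shows "\<exists>l\<in>\<Lambda>. (x = on_leg n l \<and> y = on_leg (Suc n) l) \<or> (y = on_leg n l \<and> x = on_leg (Suc n) l)"
  using assms(1)
proof (cases rule: leg_edges_cases)
  case (1 u v)
  then show ?thesis using assms(2) leg_edges_oldI by auto
next
  case (2 l i)
  then show ?thesis using assms(2) leg_edges_legI[of l i n] by (cases "i = n") auto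
next
  case (3 l i)
  then show ?thesis using assms(2) leg_edges_legI[of l i n]
    by (cases "i = n") (auto simp: insert_commute)
qed

lemma leg_edges_leaf:
  assumes "{on_leg (Suc n) l, y} \<in> leg_edges (Suc n)"
  shows "y = on_leg n l"
  using assms by (cases rule: leg_edges_cases) (auto simp: on_leg_eq_iff)

text \<open>
  The interior vertices of a path without backtracking have two neighbours, whereas the end of
  a leg has one. Hence only the first and the last vertex can be ends of legs.
\<close>

lemma no_backtrack_old_part:
  assumes p: "no_backtrack (leg_edges (Suc n)) (x # p)" "p \<noteq> []"
    and last: "\<And>l. l \<in> \<Lambda> \<Longrightarrow> last p \<noteq> on_leg (Suc n) l"
    and x: "\<And>l. l \<in> \<Lambda> \<Longrightarrow> x \<noteq> on_leg (Suc n) l"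
  shows "no_backtrack (leg_edges n) (x # p)"
  using p last x
proof (induction p arbitrary: x)
  case (Cons y p)
  have n: "{x, y} \<in> leg_edges (Suc n)" "p = [] \<or> x \<noteq> hd p" "no_backtrack (leg_edges (Suc n)) (y # p)"
    using Cons(2) by (auto simp: no_backtrack_Cons2)
  have y: "y \<noteq> on_leg (Suc n) l" if "l \<in> \<Lambda>" for l
  proof
    assume y: "y = on_leg (Suc n) l"
    then have "p \<noteq> []" using Cons(4)[OF that] by auto
    then have "{y, hd p} \<in> leg_edges (Suc n)" using n(3) by (cases p) (auto simp: no_backtrack_Cons2)
    then have "hd p = on_leg n l" using leg_edges_leaf[of n l "hd p"] y by simp
    moreover have "x = on_leg n l" using leg_edges_leaf[of n l x] n(1) y by (simp add: insert_commute)
    ultimately have "hd p = x" by simp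
    then show False using n(2) \<open>p \<noteq> []\<close> by simp
  qed
  have "{x, y} \<in> leg_edges n" using leg_edges_Suc_new[OF n(1)] Cons(5) y by blast
  moreover have "no_backtrack (leg_edges n) (y # p)"
  proof (cases "p = []")
    case False
    then show ?thesis using Cons(1)[OF n(3) False] Cons(4) y by simp
  qed (simp add: no_backtrack_def)
  ultimately show ?case using n(2) by (simp add: no_backtrack_Cons2)
qed simp

context
  fixes k n :: nat and h :: 'a
  assumes h: "h \<in> carrier G"
    and acyl: "\<And>p. no_backtrack E p \<Longrightarrow> (\<And>x. x \<in> set p \<Longrightarrow> \<phi> h x = x) \<Longrightarrow> length p \<le> Suc k"
    and acyl1: "\<And>p l. no_backtrack E p \<Longrightarrow> (\<And>x. x \<in> set p \<Longrightarrow> \<phi> h x = x) \<Longrightarrow> l \<in> \<Lambda> \<Longrightarrow> \<alpha> h l = l \<Longrightarrow>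
      p \<noteq> [] \<Longrightarrow> hd p = \<pi> l \<Longrightarrow> length p + n \<le> Suc k"
    and acyl2: "\<And>p l m. no_backtrack E p \<Longrightarrow> (\<And>x. x \<in> set p \<Longrightarrow> \<phi> h x = x) \<Longrightarrow> l \<in> \<Lambda> \<Longrightarrow> \<alpha> h l = l \<Longrightarrow>
      m \<in> \<Lambda> \<Longrightarrow> \<alpha> h m = m \<Longrightarrow> l \<noteq> m \<Longrightarrow> p \<noteq> [] \<Longrightarrow> hd p = \<pi> l \<Longrightarrow> last p = \<pi> m \<Longrightarrow>
      length p + 2 * n \<le> Suc k"
begin

definition fixes_path :: "('v + 'l \<times> nat) list \<Rightarrow> bool"
  where "fixes_path p \<longleftrightarrow> (\<forall>x\<in>set p. leg_act h x = x)"

lemma old_path: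
  assumes "no_backtrack (leg_edges 0) p" "fixes_path p" "p \<noteq> []" "length p \<ge> 2 \<or> hd p \<in> range Inl"
  shows "\<exists>q. p = map Inl q \<and> no_backtrack E q \<and> (\<forall>x\<in>set q. \<phi> h x = x)"
proof -
  have "\<exists>v. x = Inl v" if x: "x \<in> set p" for x
  proof (cases "length p \<ge> 2")
    case True
    obtain i where i: "i < length p" "x = p ! i" using x by (auto simp: in_set_conv_nth)
    define j where "j = (if Suc i < length p then i else i - 1)"
    have j: "Suc j < length p" "i = j \<or> i = Suc j" using i True by (auto simp: j_def)
    have "{p ! j, p ! Suc j} \<in> leg_edges 0" using assms(1) j(1) by (simp add: no_backtrack_def)
    then show ?thesis using i(2) j(2) by (cases rule: leg_edges_cases) auto
  next
    case False
    then have "p = [hd p]" using assms(3) by (cases p; cases "tl p") auto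
    then have "x = hd p" using x by (metis empty_iff empty_set set_ConsD)
    then show ?thesis using assms(4) False by auto
  qed
  then obtain q where q: "p = map Inl q" using ex_map_conv[of p Inl] by blast
  have "no_backtrack E q" unfolding no_backtrack_def
  proof (intro conjI allI impI)
    fix i assume i: "Suc i < length q"
    then have "{Inl (q ! i), Inl (q ! Suc i)} \<in> leg_edges 0"
      using assms(1) q unfolding no_backtrack_def by (metis length_map nth_map Suc_lessD)
    then show "{q ! i, q ! Suc i} \<in> E" by (cases rule: leg_edges_cases) auto
  next
    fix i assume i: "Suc (Suc i) < length q"
    then have "p ! i \<noteq> p ! Suc (Suc i)" using assms(1) q by (simp add: no_backtrack_def)
    then show "q ! i \<noteq> q ! Suc (Suc i)" using q i by auto
  qed
  moreover have "\<forall>x\<in>set q. \<phi> h x = x" using assms(2) q by (auto simp: fixes_path_def)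
  ultimately show ?thesis using q by blast
qed

text \<open>
  Legs of length \<open>n\<close> are grown one edge at a time. Paths that may be prolonged along one or two
  legs have a reserve of \<open>n - i\<close> or \<open>2 * (n - i)\<close> edges left when the legs have length \<open>i\<close>.
\<close>

lemma fixed_paths_on_legs:
  assumes "i \<le> n"
  shows "\<And>p. no_backtrack (leg_edges i) p \<Longrightarrow> fixes_path p \<Longrightarrow> length p \<le> Suc k"
    and "\<And>p l. no_backtrack (leg_edges i) p \<Longrightarrow> fixes_path p \<Longrightarrow> l \<in> \<Lambda> \<Longrightarrow> \<alpha> h l = l \<Longrightarrow> p \<noteq> [] \<Longrightarrow>
      hd p = on_leg i l \<Longrightarrow> length p + (n - i) \<le> Suc k"
    and "\<And>p l m. no_backtrack (leg_edges i) p \<Longrightarrow> fixes_path p \<Longrightarrow> l \<in> \<Lambda> \<Longrightarrow> \<alpha> h l = l \<Longrightarrow>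
      m \<in> \<Lambda> \<Longrightarrow> \<alpha> h m = m \<Longrightarrow> l \<noteq> m \<Longrightarrow> p \<noteq> [] \<Longrightarrow> hd p = on_leg i l \<Longrightarrow> last p = on_leg i m \<Longrightarrow>
      length p + 2 * (n - i) \<le> Suc k"
  using assms
proof (induction i)
  case 0
  {
    case (1 p)
    show ?case
    proof (cases "length p \<ge> 2")
      case True
      then obtain q where "p = map Inl q" "no_backtrack E q" "\<forall>x\<in>set q. \<phi> h x = x" using old_path[OF 1(1,2)] True by force
      then show ?thesis using acyl[of q] by simp
    qed simp
  next
    case (2 p l)
    have "hd p \<in> range Inl" using 2(6) by (simp add: on_leg_def)
    then obtain q where q: "p = map Inl q" "no_backtrack E q" "\<forall>x\<in>set q. \<phi> h x = x"
      using old_path[OF 2(1,2,5)] by auto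
    then have "hd q = \<pi> l" using 2(5,6) by (cases q) (auto simp: on_leg_def)
    then show ?case using acyl1[of q l] q 2 by simp
  next
    case (3 p l m)
    have "hd p \<in> range Inl" using 3(9) by (simp add: on_leg_def)
    then obtain q where q: "p = map Inl q" "no_backtrack E q" "\<forall>x\<in>set q. \<phi> h x = x"
      using old_path[OF 3(1,2,8)] by auto
    then have "hd q = \<pi> l" "last q = \<pi> m"
      using 3(8-10) by (cases q; auto simp: on_leg_def last_map split: if_splits)+
    then show ?case using acyl2[of q l m] q 3 by simp
  }
next
  case (Suc i)
  have i: "i \<le> n" "n - i = Suc (n - Suc i)" if "Suc i \<le> n" using that by auto
  define leaf where "leaf x l \<longleftrightarrow> l \<in> \<Lambda> \<and> x = on_leg (Suc i) l" for x l
  have fixed_leaf: "\<alpha> h l = l" if "fixes_path p" "x \<in> set p" "leaf x l" for p x l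
    using that leg_act_on_leg[OF h, of l "Suc i"] by (auto simp: fixes_path_def leaf_def on_leg_eq_iff)
  have none: "length p \<le> Suc k"
    if "Suc i \<le> n" "no_backtrack (leg_edges (Suc i)) p" "fixes_path p" "length p \<ge> 2"
      "\<And>l. \<not> leaf (hd p) l" "\<And>l. \<not> leaf (last p) l" for p
  proof -
    have len: "length p \<ge> 2" by (rule that(4))
    obtain x q where p: "p = x # q" "q \<noteq> []" using two_elems[OF len] by blast
    have "no_backtrack (leg_edges i) p" unfolding p(1)
      by (rule no_backtrack_old_part) (use that p in \<open>auto simp: leaf_def\<close>)
    then show ?thesis using Suc(1) i that by blast
  qed
  have one: "length p + (n - Suc i) \<le> Suc k"
    if "Suc i \<le> n" "no_backtrack (leg_edges (Suc i)) p" "fixes_path p" "length p \<ge> 2"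
      "leaf (hd p) l" "\<And>m. \<not> leaf (last p) m" for p l
  proof -
    have len: "length p \<ge> 2" by (rule that(4))
    obtain x y q where p: "p = x # y # q" using two_elems[OF len] by blast
    have e: "{x, y} \<in> leg_edges (Suc i)" "no_backtrack (leg_edges (Suc i)) (y # q)" using that(2) p by (auto simp: no_backtrack_Cons2)
    have y: "y = on_leg i l" using leg_edges_leaf[of i l y] e(1) that(5) p by (auto simp: leaf_def)
    have "no_backtrack (leg_edges i) (y # q)"
    proof (cases "q = []")
      case False
      show ?thesis by (rule no_backtrack_old_part[OF e(2) False]) (use that(6) p False y in \<open>auto simp: leaf_def on_leg_eq_iff\<close>)
    qed (simp add: no_backtrack_def)
    moreover have "fixes_path (y # q)" using that(3) p by (simp add: fixes_path_def)
    moreover have "\<alpha> h l = l" using fixed_leaf[OF that(3) _ that(5)] p by simp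
    ultimately have "length (y # q) + (n - i) \<le> Suc k"
      using Suc(2)[of "y # q" l] i that(1,5) y by (auto simp: leaf_def)
    then show ?thesis using i(2)[OF that(1)] p by simp
  qed
  have two: "length p + 2 * (n - Suc i) \<le> Suc k"
    if "Suc i \<le> n" "no_backtrack (leg_edges (Suc i)) p" "fixes_path p" "length p \<ge> 2"
      "leaf (hd p) l" "leaf (last p) m" for p l m
  proof -
    have len: "length p \<ge> 2" by (rule that(4))
    obtain x y q where p: "p = x # y # q" using two_elems[OF len] by blast
    have e: "{x, y} \<in> leg_edges (Suc i)" "no_backtrack (leg_edges (Suc i)) (y # q)" using that(2) p by (auto simp: no_backtrack_Cons2)
    have y: "y = on_leg i l" using leg_edges_leaf[of i l y] e(1) that(5) p by (auto simp: leaf_def)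
    have "q \<noteq> []" using that(6) p y by (auto simp: leaf_def on_leg_eq_iff)
    then obtain q' z where q: "q = q' @ [z]" by (metis rev_exhaust)
    have z: "z = on_leg (Suc i) m" using that(6) p q by (simp add: leaf_def)
    have zr: "no_backtrack (leg_edges (Suc i)) (z # rev (y # q'))" using no_backtrack_rev[OF e(2)] q by simp
    have lst: "last (y # q') = on_leg i m"
    proof -
      obtain a b where ab: "rev (y # q') = a # b" by (cases "rev (y # q')") auto
      then have "a = last (y # q')" by (metis hd_rev list.sel(1))
      then show ?thesis using zr ab z leg_edges_leaf[of i m a] by (auto simp: no_backtrack_Cons2)
    qed
    have nq: "no_backtrack (leg_edges (Suc i)) (y # q')" using no_backtrack_take[OF e(2), of "Suc (length q')"] q by simp
    have "no_backtrack (leg_edges i) (y # q')"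
    proof (cases "q' = []")
      case False
      show ?thesis
        by (rule no_backtrack_old_part[OF nq False]) (use lst False y in \<open>auto simp: on_leg_eq_iff\<close>)
    qed (simp add: no_backtrack_def)
    moreover have "fixes_path (y # q')" using that(3) p q by (simp add: fixes_path_def)
    moreover have "\<alpha> h l = l" "\<alpha> h m = m"
      using fixed_leaf[OF that(3) _ that(5)] fixed_leaf[OF that(3) _ that(6)] p by simp_all
    moreover have "l \<noteq> m"
    proof
      assume "l = m"
      then have "hd p = last p" using that(5,6) by (simp add: leaf_def)
      obtain r par where R: "rooted r par (leg_vertices (Suc i)) (leg_edges (Suc i))" using rooted_legs by blast
      have "length p = 1" by (rule no_backtrack_closed_trivial[OF R that(2) _ \<open>hd p = last p\<close>]) (use p in simp)
      then show False using that(4) by simp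
    qed
    ultimately have "length (y # q') + 2 * (n - i) \<le> Suc k"
      using Suc(3)[of "y # q'" l m] i that(1,5,6) y lst by (auto simp: leaf_def)
    then show ?thesis using i(2)[OF that(1)] p q by simp
  qed
  {
    case (1 p)
    show ?case
    proof (cases "length p \<ge> 2")
      case True
      show ?thesis
      proof (cases "\<exists>l. leaf (hd p) l")
        case l: True
        then obtain l where l: "leaf (hd p) l" by blast
        show ?thesis
        proof (cases "\<exists>m. leaf (last p) m")
          case True
          then obtain m where "leaf (last p) m" by blast
          from two[OF 1(3,1,2) \<open>length p \<ge> 2\<close> l this] show ?thesis by simp
        next
          case False
          then have "length p + (n - Suc i) \<le> Suc k"
            by (intro one[OF 1(3,1,2) \<open>length p \<ge> 2\<close> l]) blast
          then show ?thesis by simp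
        qed
      next
        case nl: False
        show ?thesis
        proof (cases "\<exists>m. leaf (last p) m")
          case m: True
          have "no_backtrack (leg_edges (Suc i)) (rev p)" "fixes_path (rev p)" "length (rev p) \<ge> 2"
            using no_backtrack_rev[OF 1(1)] 1(2) True by (auto simp: fixes_path_def)
          moreover have "hd (rev p) = last p" "last (rev p) = hd p"
            using True by (auto simp: hd_rev last_rev)
          moreover obtain m where "leaf (last p) m" using m by blast
          ultimately have "length (rev p) + (n - Suc i) \<le> Suc k"
            using nl by (intro one[OF 1(3), of "rev p" m]) auto
          then show ?thesis by simp
        next
          case False
          then show ?thesis using none[OF 1(3,1,2) True] nl by blast
        qed
      qed
    qed simp
  next
    case (2 p l)
    have l: "leaf (hd p) l" using 2(3,6) by (simp add: leaf_def)
    show ?case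
    proof (cases "length p \<ge> 2")
      case True
      show ?thesis
      proof (cases "\<exists>m. leaf (last p) m")
        case m: True
        then obtain m where "leaf (last p) m" by blast
        from two[OF 2(7,1,2) True l this] show ?thesis by simp
      next
        case False
        then show ?thesis by (intro one[OF 2(7,1,2) True l]) blast
      qed
    next
      case False
      have "\<phi> h (\<pi> l) = \<pi> l" using \<pi>_equivariant[OF h 2(3)] 2(4) by simp
      then have "length [\<pi> l] + n \<le> Suc k" using acyl1[of "[\<pi> l]" l] 2(3,4) by (simp add: no_backtrack_def)
      moreover have "length p = 1" using False 2(5) by (cases p; cases "tl p") auto
      ultimately show ?thesis by simp
    qed
  next
    case (3 p l m)
    have "length p \<ge> 2" using 3(7-10) by (cases p; cases "tl p") (auto simp: on_leg_eq_iff)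
    then show ?case using two[OF 3(11,1,2), of l m] 3 by (auto simp: leaf_def)
  }
qed

end

end

context legs
begin

lemma good_action_legs:
  assumes good: "good_action k N G V E \<phi>"
    and stab: "\<And>l. l \<in> \<Lambda> \<Longrightarrow> \<exists>g\<in>carrier G. g \<noteq> \<one> \<and> \<alpha> g l = l"
    and acyl1: "\<And>h p l. h \<in> carrier G \<Longrightarrow> h \<noteq> \<one> \<Longrightarrow> no_backtrack E p \<Longrightarrow> (\<And>x. x \<in> set p \<Longrightarrow> \<phi> h x = x) \<Longrightarrow>
      l \<in> \<Lambda> \<Longrightarrow> \<alpha> h l = l \<Longrightarrow> p \<noteq> [] \<Longrightarrow> hd p = \<pi> l \<Longrightarrow> length p + n \<le> Suc k"
    and acyl2: "\<And>h p l m. h \<in> carrier G \<Longrightarrow> h \<noteq> \<one> \<Longrightarrow> no_backtrack E p \<Longrightarrow> (\<And>x. x \<in> set p \<Longrightarrow> \<phi> h x = x) \<Longrightarrow>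
      l \<in> \<Lambda> \<Longrightarrow> \<alpha> h l = l \<Longrightarrow> m \<in> \<Lambda> \<Longrightarrow> \<alpha> h m = m \<Longrightarrow> l \<noteq> m \<Longrightarrow> p \<noteq> [] \<Longrightarrow> hd p = \<pi> l \<Longrightarrow>
      last p = \<pi> m \<Longrightarrow> length p + 2 * n \<le> Suc k"
    and R\<Lambda>: "finite R\<Lambda>" "R\<Lambda> \<subseteq> \<Lambda>" "\<And>l. l \<in> \<Lambda> \<Longrightarrow> \<exists>g\<in>carrier G. \<exists>m\<in>R\<Lambda>. l = \<alpha> g m"
      "\<And>l m g. l \<in> R\<Lambda> \<Longrightarrow> m \<in> R\<Lambda> \<Longrightarrow> g \<in> carrier G \<Longrightarrow> \<alpha> g l = m \<Longrightarrow> l = m"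
  shows "good_action k (N + card R\<Lambda> * n) G (leg_vertices n) (leg_edges n) leg_act"
  unfolding good_action_def
proof (intro conjI allI impI ballI)
  show "tree_acts G (leg_vertices n) (leg_edges n) leg_act" by (rule tree_acts_legs)
  show "\<exists>g\<in>carrier G. g \<noteq> \<one> \<and> leg_act g x = x \<and> leg_act g y = y" if "{x, y} \<in> leg_edges n" for x y
    using that
  proof (cases rule: leg_edges_cases)
    case (1 u v)
    then show ?thesis using good_actionD(2)[OF good 1(1)] by auto
  next
    case (2 l i)
    then show ?thesis using stab[OF 2(1)] leg_act_on_leg by metis
  next
    case (3 l i)
    then show ?thesis using stab[OF 3(1)] leg_act_on_leg by metis
  qed
  show "length p \<le> Suc k" if "h \<in> carrier G" "h \<noteq> \<one>" "no_backtrack (leg_edges n) p" "\<forall>x\<in>set p. leg_act h x = x" for h p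
    by (rule fixed_paths_on_legs(1)[OF that(1) good_actionD(3)[OF good that(1,2)] acyl1[OF that(1,2)]
          acyl2[OF that(1,2)] order_refl that(3)])
      (use that(4) in \<open>simp_all add: fixes_path_def[OF that(1) good_actionD(3)[OF good that(1,2)] acyl1[OF that(1,2)]
          acyl2[OF that(1,2)]]\<close>)
  obtain R where R: "finite R" "card R = N" "edge_transversal G E \<phi> R"
    using good_actionD(4)[OF good] by blast
  have RE: "R \<subseteq> E" by (rule edge_transversalD(1)[OF R(3)])
  define f where "f = (\<lambda>(l, i). {on_leg i l, on_leg (Suc i) l})"
  define R' where "R' = (`) Inl ` R \<union> f ` (R\<Lambda> \<times> {..<n})"
  have f_inj: "l = m \<and> i = j" if "f (l, i) = f (m, j)" for l m i j
    using that by (auto simp: f_def doubleton_eq_iff on_leg_eq_iff)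
  have f_old: "f (l, i) \<noteq> Inl ` d" for l i d
  proof
    assume "f (l, i) = Inl ` d"
    then have "on_leg (Suc i) l \<in> Inl ` d" by (auto simp: f_def)
    then show False by auto
  qed
  have "card ((`) Inl ` R :: ('v + 'l \<times> nat) set set) = N"
    using R(2) by (subst card_image) (auto simp: inj_on_def inj_image_eq_iff)
  moreover have "card (f ` (R\<Lambda> \<times> {..<n})) = card R\<Lambda> * n"
  proof -
    have "inj_on f (R\<Lambda> \<times> {..<n})" using f_inj by (auto intro!: inj_onI)
    then show ?thesis by (simp add: card_image card_cartesian_product)
  qed
  moreover have "(`) Inl ` R \<inter> f ` (R\<Lambda> \<times> {..<n}) = {}" using f_old by blast
  ultimately have card: "card R' = N + card R\<Lambda> * n" "finite R'"
    using R(1) R\<Lambda>(1) unfolding R'_def by (simp_all add: card_Un_disjoint)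
  have "edge_transversal G (leg_edges n) leg_act R'"
    unfolding edge_transversal_def
  proof (intro conjI ballI impI)
    show "R' \<subseteq> leg_edges n"
    proof
      fix x assume "x \<in> R'"
      then consider d where "d \<in> R" "x = Inl ` d" | l i where "l \<in> R\<Lambda>" "i < n" "x = f (l, i)"
        unfolding R'_def by blast
      then show "x \<in> leg_edges n"
      proof cases
        case (1 d)
        then show ?thesis using RE unfolding leg_edges_def by blast
      next
        case (2 l i)
        then show ?thesis using leg_edges_legI[of l i n] R\<Lambda>(2) by (auto simp: f_def)
      qed
    qed
  next
    fix x assume "x \<in> leg_edges n"
    then consider d where "d \<in> E" "x = Inl ` d" | l i where "l \<in> \<Lambda>" "i < n" "x = f (l, i)"
      unfolding leg_edges_def f_def by fastforce
    then show "\<exists>g\<in>carrier G. \<exists>d\<in>R'. x = leg_act g ` d"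
    proof cases
      case (1 d)
      then obtain g d' where g: "g \<in> carrier G" "d' \<in> R" "d = \<phi> g ` d'"
        using edge_transversalD(2)[OF R(3)] by blast
      then have "x = leg_act g ` Inl ` d'" using 1 by (simp add: image_image)
      then show ?thesis using g unfolding R'_def by blast
    next
      case (2 l i)
      then obtain g m where g: "g \<in> carrier G" "m \<in> R\<Lambda>" "l = \<alpha> g m" using R\<Lambda>(3) by blast
      then have "x = leg_act g ` f (m, i)" using 2 leg_act_on_leg[OF g(1), of m] R\<Lambda>(2) by (auto simp: f_def)
      then show ?thesis using g 2 unfolding R'_def by blast
    qed
  next
    fix d d' g assume d: "d \<in> R'" "d' \<in> R'" and g: "g \<in> carrier G" "leg_act g ` d = d'"
    have old: "leg_act g ` Inl ` x = Inl ` \<phi> g ` x" for x by (simp add: image_image)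
    have new: "leg_act g ` f (m, i) = f (\<alpha> g m, i)" if "m \<in> R\<Lambda>" for m i
      using leg_act_on_leg[OF g(1), of m] that R\<Lambda>(2) by (auto simp: f_def)
    consider x where "x \<in> R" "d = Inl ` x" | l i where "l \<in> R\<Lambda>" "i < n" "d = f (l, i)"
      using d(1) unfolding R'_def by blast
    then show "d = d'"
    proof cases
      case (1 x)
      then obtain y where y: "y \<in> R" "d' = Inl ` y"
        using d(2) g(2) old[of x] f_old[of _ _ "\<phi> g ` x"] unfolding R'_def by force
      then have "\<phi> g ` x = y" using g(2) 1 old[of x] by (simp add: inj_image_eq_iff)
      then show ?thesis using edge_transversalD(3)[OF R(3) 1(1) y(1) g(1)] 1 y by simp
    next
      case (2 l i)
      then have d'f: "d' = f (\<alpha> g l, i)" using g(2) new by simp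
      then obtain m j where m: "m \<in> R\<Lambda>" "d' = f (m, j)" using d(2) f_old unfolding R'_def by fastforce
      then have "\<alpha> g l = m" "i = j" using f_inj d'f by auto
      then show ?thesis using R\<Lambda>(4)[OF 2(1) m(1) g(1)] 2 m by simp
    qed
  qed
  then show "\<exists>R. finite R \<and> card R = N + card R\<Lambda> * n \<and> edge_transversal G (leg_edges n) leg_act R"
    using card by blast
qed

lemma branches_legs:
  assumes x: "x \<in> leg_vertices n" and n: "n > 0"
    and br: "\<And>v. v \<in> V \<Longrightarrow> branches E v \<or> (\<exists>u. {v, u} \<in> E) \<and> (\<exists>l\<in>\<Lambda>. \<pi> l = v)"
  shows "branches (leg_edges n) x \<or> (\<exists>l\<in>\<Lambda>. x = on_leg n l)"
  using x
proof (cases rule: leg_vertices_cases)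
  case (1 v)
  from br[OF 1(1)] show ?thesis
  proof
    assume "branches E v"
    then obtain u w where "u \<noteq> w" "{v, u} \<in> E" "{v, w} \<in> E" unfolding branches_def by blast
    then have "Inl u \<noteq> (Inl w :: 'v + 'l \<times> nat)" "{Inl v, Inl u} \<in> leg_edges n" "{Inl v, Inl w} \<in> leg_edges n"
      using leg_edges_oldI by auto
    then show ?thesis using 1 unfolding branches_def by blast
  next
    assume "(\<exists>u. {v, u} \<in> E) \<and> (\<exists>l\<in>\<Lambda>. \<pi> l = v)"
    then obtain u l where ul: "{v, u} \<in> E" "l \<in> \<Lambda>" "\<pi> l = v" by blast
    have "{x, Inl u} \<in> leg_edges n" using ul leg_edges_oldI 1 by simp
    moreover have "{x, on_leg (Suc 0) l} \<in> leg_edges n"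
      using leg_edges_legI[OF ul(2), of 0 n] n 1 ul by (simp add: on_leg_def)
    moreover have "Inl u \<noteq> on_leg (Suc 0) l" by simp
    ultimately show ?thesis unfolding branches_def by blast
  qed
next
  case (2 l i)
  show ?thesis
  proof (cases "Suc i = n")
    case True
    then show ?thesis using 2 by blast
  next
    case False
    have "{x, on_leg i l} \<in> leg_edges n" using leg_edges_legI[OF 2(1,2)] 2(3) by (simp add: insert_commute)
    moreover have "{x, on_leg (Suc (Suc i)) l} \<in> leg_edges n"
      using leg_edges_legI[OF 2(1), of "Suc i" n] 2 False by simp
    moreover have "on_leg i l \<noteq> on_leg (Suc (Suc i)) l" by (simp add: on_leg_eq_iff)
    ultimately show ?thesis unfolding branches_def by blast
  qed
qed

end

context group
begin

text \<open>
  Legs are named by elements of the cosets of \<open>\<langle>c\<rangle>\<close>, rather than by the cosets, to keep the type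
  of vertices countable.
\<close>

definition coset_rep :: "'a \<Rightarrow> 'a \<Rightarrow> 'a"
  where "coset_rep c g = (SOME x. \<exists>i::int. x = g \<otimes> c [^] i)"

lemma coset_rep_in:
  assumes "c \<in> carrier G" "g \<in> carrier G"
  shows "\<exists>i::int. coset_rep c g = g \<otimes> c [^] i" "coset_rep c g \<in> carrier G"
proof -
  show "\<exists>i::int. coset_rep c g = g \<otimes> c [^] i"
    unfolding coset_rep_def by (rule someI_ex) blast
  then show "coset_rep c g \<in> carrier G" using assms by auto
qed

lemma coset_rep_shift:
  assumes "c \<in> carrier G" "g \<in> carrier G"
  shows "coset_rep c (g \<otimes> c [^] (i::int)) = coset_rep c g"
proof -
  have "(\<exists>j::int. x = g \<otimes> c [^] i \<otimes> c [^] j) \<longleftrightarrow> (\<exists>j::int. x = g \<otimes> c [^] j)" for x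
  proof
    assume "\<exists>j::int. x = g \<otimes> c [^] i \<otimes> c [^] j"
    then obtain j :: int where "x = g \<otimes> c [^] i \<otimes> c [^] j" by blast
    then have "x = g \<otimes> c [^] (i + j)" using assms by (simp add: int_pow_mult m_assoc)
    then show "\<exists>j::int. x = g \<otimes> c [^] j" by blast
  next
    assume "\<exists>j::int. x = g \<otimes> c [^] j"
    then obtain j :: int where "x = g \<otimes> c [^] j" by blast
    then have "x = g \<otimes> c [^] (i + (j - i))" by simp
    then have "x = g \<otimes> c [^] i \<otimes> c [^] (j - i)" using assms by (simp only: int_pow_mult m_assoc int_pow_closed)
    then show "\<exists>j::int. x = g \<otimes> c [^] i \<otimes> c [^] j" by blast
  qed
  then show ?thesis unfolding coset_rep_def by presburger
qed

lemma coset_rep_eqD: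
  assumes "c \<in> carrier G" "g \<in> carrier G" "g' \<in> carrier G" "coset_rep c g = coset_rep c g'"
  shows "\<exists>i::int. g' = g \<otimes> c [^] i"
proof -
  obtain i j :: int where "g \<otimes> c [^] i = g' \<otimes> c [^] j"
    using coset_rep_in(1)[OF assms(1,2)] coset_rep_in(1)[OF assms(1,3)] assms(4) by metis
  then have "g' \<otimes> c [^] j \<otimes> c [^] (- j) = g \<otimes> c [^] i \<otimes> c [^] (- j)" by simp
  then have "g' = g \<otimes> c [^] (i - j)"
    using assms(1-3) by (simp add: m_assoc int_pow_mult[symmetric])
  then show ?thesis by blast
qed

end

text \<open>
  Two orbits of legs of length \<open>n\<close>, with feet \<open>v e\<close> and stabilisers \<open>\<langle>c e\<rangle>\<close>. An element \<open>h\<close>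
  fixes the leg at \<open>\<phi> y (v e)\<close> that belongs to the coset \<open>y\<langle>c e\<rangle>\<close> when it is a conjugate by \<open>y\<close> of
  a power of \<open>c e\<close>; so the last two hypotheses bound the fixed paths that start at the foot
  of a fixed leg, and those that join the feet of two different fixed legs.
\<close>

proposition gluable_if_legs:
  fixes V :: "'v set" and G :: "('g, 'b) monoid_scheme" (structure)
  assumes good: "good_action k N G V E \<phi>" and n: "n > 0"
    and c: "\<And>e. c e \<in> carrier G" "\<And>e. c e \<otimes> c e \<noteq> \<one>"
    and v: "\<And>e. v e \<in> V" "\<And>e. \<phi> (c e) (v e) = v e"
    and br: "\<And>u. u \<in> V \<Longrightarrow> branches E u \<or> (\<exists>w. {u, w} \<in> E) \<and> (\<exists>e. u = v e)"
    and acyl1: "\<And>h q e y i. h \<in> carrier G \<Longrightarrow> h \<noteq> \<one> \<Longrightarrow> no_backtrack E q \<Longrightarrow> (\<And>x. x \<in> set q \<Longrightarrow> \<phi> h x = x) \<Longrightarrow>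
      y \<in> carrier G \<Longrightarrow> h \<otimes> y = y \<otimes> c e [^] (i::int) \<Longrightarrow> q \<noteq> [] \<Longrightarrow> hd q = \<phi> y (v e) \<Longrightarrow>
      length q + n \<le> Suc k"
    and acyl2: "\<And>h q e e' y y' i j. h \<in> carrier G \<Longrightarrow> h \<noteq> \<one> \<Longrightarrow> no_backtrack E q \<Longrightarrow>
      (\<And>x. x \<in> set q \<Longrightarrow> \<phi> h x = x) \<Longrightarrow> y \<in> carrier G \<Longrightarrow> y' \<in> carrier G \<Longrightarrow>
      h \<otimes> y = y \<otimes> c e [^] (i::int) \<Longrightarrow> h \<otimes> y' = y' \<otimes> c e' [^] (j::int) \<Longrightarrow>
      \<not> (e = e' \<and> (\<exists>m::int. y' = y \<otimes> c e [^] m)) \<Longrightarrow> q \<noteq> [] \<Longrightarrow> hd q = \<phi> y (v e) \<Longrightarrow>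
      last q = \<phi> y' (v e') \<Longrightarrow> length q + 2 * n \<le> Suc k"
  shows "\<exists>(V' :: ('v + (bool \<times> 'g) \<times> nat) set) E' \<phi>' L. gluable k (N + 2 * n) G V' E' \<phi>' L c"
proof -
  have T: "tree_acts G V E \<phi>" by (rule good_actionD(1)[OF good])
  have act: "acts G V \<phi>" by (rule tree_actsD(3)[OF T])
  interpret group G by (rule tree_actsD(1)[OF T])
  define \<Lambda> where "\<Lambda> = {(e, coset_rep (c e) g) | e g. g \<in> carrier G}"
  define \<alpha> where "\<alpha> h l = (fst l, coset_rep (c (fst l)) (h \<otimes> snd l))" for h and l :: "bool \<times> 'g"
  define \<pi> where "\<pi> l = \<phi> (snd l) (v (fst l))" for l
  have \<Lambda>D: "snd l \<in> carrier G" "coset_rep (c (fst l)) (snd l) = snd l" if l: "l \<in> \<Lambda>" for l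
  proof -
    obtain e g where eg: "l = (e, coset_rep (c e) g)" "g \<in> carrier G" using l unfolding \<Lambda>_def by blast
    obtain i :: int where "coset_rep (c e) g = g \<otimes> c e [^] i" using coset_rep_in(1)[OF c(1) eg(2)] by blast
    then have "coset_rep (c e) (coset_rep (c e) g) = coset_rep (c e) g"
      using coset_rep_shift[OF c(1) eg(2), of e i] by simp
    then show "snd l \<in> carrier G" "coset_rep (c (fst l)) (snd l) = snd l"
      using eg coset_rep_in(2)[OF c(1) eg(2)] by simp_all
  qed
  have \<alpha>_mk: "\<alpha> h (e, coset_rep (c e) g) = (e, coset_rep (c e) (h \<otimes> g))"
    if hg: "h \<in> carrier G" "g \<in> carrier G" for h e g
  proof -
    obtain i :: int where "coset_rep (c e) g = g \<otimes> c e [^] i" using coset_rep_in(1)[OF c(1) hg(2)] by blast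
    then show ?thesis using coset_rep_shift[OF c(1), of "h \<otimes> g" e i] hg c(1)
      by (simp add: \<alpha>_def m_assoc)
  qed
  have \<pi>_mk: "\<pi> (e, coset_rep (c e) g) = \<phi> g (v e)" if g: "g \<in> carrier G" for e g
  proof -
    obtain i :: int where "coset_rep (c e) g = g \<otimes> c e [^] i" using coset_rep_in(1)[OF c(1) g] by blast
    moreover have "\<phi> (c e [^] i) (v e) = v e"
      by (rule acts_int_pow_fix[OF is_group act c(1) v(1) v(2)])
    ultimately show ?thesis using actsD(3)[OF act g, of "c e [^] i" "v e"] v(1) c(1) by (simp add: \<pi>_def)
  qed
  have acts\<Lambda>: "acts G \<Lambda> \<alpha>"
    unfolding acts_def
  proof (intro conjI ballI)
    fix l assume l: "l \<in> \<Lambda>"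
    then obtain e g where eg: "l = (e, coset_rep (c e) g)" "g \<in> carrier G" unfolding \<Lambda>_def by blast
    show "\<alpha> \<one> l = l" using eg \<alpha>_mk by simp
    fix h assume h: "h \<in> carrier G"
    show "\<alpha> h l \<in> \<Lambda>" using eg h \<alpha>_mk[OF h eg(2)] unfolding \<Lambda>_def by auto
    fix h' assume "h' \<in> carrier G"
    then show "\<alpha> (h' \<otimes> h) l = \<alpha> h' (\<alpha> h l)" using eg h \<alpha>_mk by (simp add: m_assoc)
  qed
  interpret legs G V E \<phi> \<Lambda> \<alpha> \<pi>
  proof
    show "\<pi> l \<in> V" if "l \<in> \<Lambda>" for l using actsD(1)[OF act \<Lambda>D(1)[OF that] v(1)] by (simp add: \<pi>_def)
    show "\<pi> (\<alpha> g l) = \<phi> g (\<pi> l)" if g: "g \<in> carrier G" and l: "l \<in> \<Lambda>" for g l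
    proof -
      obtain e x where ex: "l = (e, coset_rep (c e) x)" "x \<in> carrier G" using l unfolding \<Lambda>_def by blast
      then show ?thesis using \<alpha>_mk[OF g ex(2)] \<pi>_mk g actsD(3)[OF act g ex(2) v(1)] by simp
    qed
  qed (rule T, rule acts\<Lambda>)
  have fixed: "\<exists>i::int. h \<otimes> snd l = snd l \<otimes> c (fst l) [^] i"
    if h: "h \<in> carrier G" and l: "l \<in> \<Lambda>" "\<alpha> h l = l" for h l
  proof -
    have "coset_rep (c (fst l)) (snd l) = coset_rep (c (fst l)) (h \<otimes> snd l)"
      using l \<Lambda>D(2)[OF l(1)] by (simp add: \<alpha>_def prod_eq_iff)
    then show ?thesis using coset_rep_eqD[OF c(1) \<Lambda>D(1)[OF l(1)]] h \<Lambda>D(1)[OF l(1)] by simp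
  qed
  define l\<^sub>0 where "l\<^sub>0 e = (e, coset_rep (c e) \<one>)" for e
  have l0: "l\<^sub>0 e \<in> \<Lambda>" for e unfolding l\<^sub>0_def \<Lambda>_def by blast
  have c1: "c e \<noteq> \<one>" for e using c(2)[of e] by auto
  have \<alpha>c: "\<alpha> (c e) (l\<^sub>0 e) = l\<^sub>0 e" for e
    using \<alpha>_mk[OF c(1) one_closed] coset_rep_shift[OF c(1) one_closed, of e 1] c(1) by (simp add: l\<^sub>0_def)
  have orb: "\<exists>g\<in>carrier G. l = \<alpha> g (l\<^sub>0 (fst l))" if l: "l \<in> \<Lambda>" for l
  proof -
    obtain e x where ex: "l = (e, coset_rep (c e) x)" "x \<in> carrier G" using l unfolding \<Lambda>_def by blast
    then have "l = \<alpha> x (l\<^sub>0 (fst l))" using \<alpha>_mk[OF ex(2) one_closed] by (simp add: l\<^sub>0_def)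
    then show ?thesis using ex(2) by blast
  qed
  have "card (range l\<^sub>0) = card (UNIV :: bool set)"
    by (rule card_image) (auto simp: inj_def l\<^sub>0_def)
  then have card: "card (range l\<^sub>0) = 2" by simp
  have "good_action k (N + card (range l\<^sub>0) * n) G (leg_vertices n) (leg_edges n) leg_act"
  proof (rule good_action_legs[OF good])
    show "\<exists>g\<in>carrier G. g \<noteq> \<one> \<and> \<alpha> g l = l" if l: "l \<in> \<Lambda>" for l
    proof -
      let ?y = "snd l" and ?c = "c (fst l)"
      have y: "?y \<in> carrier G" by (rule \<Lambda>D(1)[OF l])
      let ?g = "?y \<otimes> ?c \<otimes> inv ?y"
      have "?g \<otimes> ?y = ?y \<otimes> ?c [^] (1::int)" using y c(1) by (simp add: m_assoc)
      then have "\<alpha> ?g l = l" using coset_rep_shift[OF c(1) y, of "fst l" 1] \<Lambda>D(2)[OF l] by (simp add: \<alpha>_def)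
      moreover have "?g \<noteq> \<one>"
      proof
        assume "?g = \<one>"
        then have "?g \<otimes> ?y = ?y" using y by simp
        then have "?y \<otimes> ?c = ?y" using y c(1) by (simp add: m_assoc)
        then show False using y c(1) c1 by simp
      qed
      ultimately show ?thesis using y c(1) by (intro bexI[of _ ?g]) auto
    qed
    show "length p + n \<le> Suc k" if "h \<in> carrier G" "h \<noteq> \<one>" "no_backtrack E p" "\<And>x. x \<in> set p \<Longrightarrow> \<phi> h x = x"
      "l \<in> \<Lambda>" "\<alpha> h l = l" "p \<noteq> []" "hd p = \<pi> l" for h p l
    proof -
      note H = that
      obtain i :: int where "h \<otimes> snd l = snd l \<otimes> c (fst l) [^] i" using fixed[OF H(1,5,6)] by blast
      then show ?thesis using acyl1[OF H(1-4) \<Lambda>D(1)[OF H(5)], of "fst l" i] H(7,8) by (simp add: \<pi>_def)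
    qed
    show "length p + 2 * n \<le> Suc k" if "h \<in> carrier G" "h \<noteq> \<one>" "no_backtrack E p" "\<And>x. x \<in> set p \<Longrightarrow> \<phi> h x = x"
      "l \<in> \<Lambda>" "\<alpha> h l = l" "m \<in> \<Lambda>" "\<alpha> h m = m" "l \<noteq> m" "p \<noteq> []" "hd p = \<pi> l" "last p = \<pi> m" for h p l m
    proof -
      note H = that
      obtain i :: int where i: "h \<otimes> snd l = snd l \<otimes> c (fst l) [^] i" using fixed[OF H(1,5,6)] by blast
      obtain j :: int where j: "h \<otimes> snd m = snd m \<otimes> c (fst m) [^] j" using fixed[OF H(1,7,8)] by blast
      have "\<not> (fst l = fst m \<and> (\<exists>z::int. snd m = snd l \<otimes> c (fst l) [^] z))"
      proof
        assume "fst l = fst m \<and> (\<exists>z::int. snd m = snd l \<otimes> c (fst l) [^] z)"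
        then obtain z :: int where z: "fst l = fst m" "snd m = snd l \<otimes> c (fst l) [^] z" by blast
        then have "coset_rep (c (fst l)) (snd m) = coset_rep (c (fst l)) (snd l)"
          using coset_rep_shift[OF c(1) \<Lambda>D(1)[OF H(5)]] by simp
        then have "l = m" using z(1) \<Lambda>D(2)[OF H(5)] \<Lambda>D(2)[OF H(7)] by (simp add: prod_eq_iff)
        then show False using H(9) by simp
      qed
      from acyl2[OF H(1-4) \<Lambda>D(1)[OF H(5)] \<Lambda>D(1)[OF H(7)] i j this H(10)]
      show ?thesis using H(11,12) by (simp add: \<pi>_def)
    qed
    show "finite (range l\<^sub>0)" by simp
    show "range l\<^sub>0 \<subseteq> \<Lambda>" using l0 by blast
    show "\<exists>g\<in>carrier G. \<exists>m\<in>range l\<^sub>0. l = \<alpha> g m" if "l \<in> \<Lambda>" for l using orb[OF that] by blast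
    show "l = m" if "l \<in> range l\<^sub>0" "m \<in> range l\<^sub>0" "g \<in> carrier G" "\<alpha> g l = m" for l m g
      using that by (auto simp: \<alpha>_def l\<^sub>0_def)
  qed
  then have G1: "good_action k (N + 2 * n) G (leg_vertices n) (leg_edges n) leg_act" using card by simp
  have "gluable k (N + 2 * n) G (leg_vertices n) (leg_edges n) leg_act (\<lambda>e. on_leg n (l\<^sub>0 e)) c"
    unfolding gluable_def
  proof (intro conjI allI ballI)
    fix x assume "x \<in> leg_vertices n"
    then have "branches (leg_edges n) x \<or> (\<exists>l\<in>\<Lambda>. x = on_leg n l)"
    proof (rule branches_legs[OF _ n])
      fix u assume "u \<in> V"
      have "\<pi> (l\<^sub>0 e) = v e" for e
        using \<pi>_mk[OF one_closed] actsD(2)[OF act v(1)] by (simp add: l\<^sub>0_def)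
      then show "branches E u \<or> (\<exists>w. {u, w} \<in> E) \<and> (\<exists>l\<in>\<Lambda>. \<pi> l = u)"
        using br[OF \<open>u \<in> V\<close>] l0 by metis
    qed
    then show "branches (leg_edges n) x \<or> (\<exists>g\<in>carrier G. \<exists>e. x = leg_act g (on_leg n (l\<^sub>0 e)))"
      using orb leg_act_on_leg l0 by metis
  next
    fix e
    show "on_leg n (l\<^sub>0 e) \<in> leg_vertices n" by (rule on_leg_lvert[OF l0 order_refl])
    show "\<exists>u. {on_leg n (l\<^sub>0 e), u} \<in> leg_edges n"
      using leg_edges_legI[OF l0[of e], of "n - 1" n] n
      by (intro exI[of _ "on_leg (n - 1) (l\<^sub>0 e)"]) (simp add: insert_commute)
    show "leg_act (c e) (on_leg n (l\<^sub>0 e)) = on_leg n (l\<^sub>0 e)"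
      using leg_act_on_leg[OF c(1) l0] \<alpha>c by simp
  qed (rule G1, rule c(1), rule c(2))
  then show ?thesis by blast
qed

text \<open>
  A non-trivial element that fixes a leg fixes no edge at its foot and no other leg, so
  \<open>gluable_if_legs\<close> applies with legs of the full length \<open>k\<close>.
\<close>

proposition gluable_if_ready:
  fixes V :: "'v set" and G :: "('g, 'b) monoid_scheme" (structure)
  assumes R: "ready k N G V E \<phi> v c" and k: "k > 0"
  shows "\<exists>(V' :: ('v + (bool \<times> 'g) \<times> nat) set) E' \<phi>' L. gluable k (N + 2 * k) G V' E' \<phi>' L c"
proof -
  have good: "good_action k N G V E \<phi>" and br: "\<And>u. u \<in> V \<Longrightarrow> branches E u" and v: "v \<in> V"
    and S: "separated G E \<phi> v c" using R unfolding ready_def by auto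
  have T: "tree_acts G V E \<phi>" by (rule good_actionD(1)[OF good])
  have act: "acts G V \<phi>" by (rule tree_actsD(3)[OF T])
  interpret group G by (rule tree_actsD(1)[OF T])
  have c: "c e \<in> carrier G" "\<phi> (c e) v = v" "c e \<otimes> c e \<noteq> \<one>" for e
    using S unfolding separated_def by simp_all
  have sep1: "c e [^] i = \<one>" if "{v, u} \<in> E" "\<phi> (c e [^] i) u = u" for e u and i :: int
    using S that unfolding separated_def by blast
  have sep2: "e = e' \<and> (\<exists>m::int. g = c e' [^] m)" if "g \<in> carrier G"
    "g \<otimes> c e [^] i = c e' [^] j \<otimes> g" "c e [^] i \<noteq> \<one>" for g e e' and i j :: int
    using S that unfolding separated_def by blast
  have nontriv: "c e [^] i \<noteq> \<one>"
    if "h \<in> carrier G" "h \<noteq> \<one>" "y \<in> carrier G" "h \<otimes> y = y \<otimes> c e [^] i" for h y e and i :: int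
  proof
    assume "c e [^] i = \<one>"
    then have "h \<otimes> y = y" using that by simp
    then show False using that by simp
  qed
  have short: "length q = 1"
    if h: "h \<in> carrier G" "h \<noteq> \<one>" and q: "no_backtrack E q" "\<And>x. x \<in> set q \<Longrightarrow> \<phi> h x = x"
      and y: "y \<in> carrier G" "h \<otimes> y = y \<otimes> c e [^] i" and hd: "q \<noteq> []" "hd q = \<phi> y v"
    for h q e y and i :: int
  proof (rule ccontr)
    assume "length q \<noteq> 1"
    then obtain u p where p: "q = \<phi> y v # u # p" using hd by (cases q; cases "tl q") auto
    have "Suc 0 < length q" using p by simp
    then have e: "{\<phi> y v, u} \<in> E" using q(1) p unfolding no_backtrack_def by (metis nth_Cons_0 nth_Cons_Suc)
    have "u \<in> V" using tree_actsD(2)[OF T] rooted_edge_cases(2) e by metis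
    have iy: "inv y \<in> carrier G" using y by simp
    have "{\<phi> (inv y) (\<phi> y v), \<phi> (inv y) u} \<in> E" by (rule tree_actsD(4)[OF T iy e])
    then have e': "{v, \<phi> (inv y) u} \<in> E" using acts_inv(1)[OF is_group act y(1) v] by simp
    have "inv y \<otimes> h = c e [^] i \<otimes> inv y"
    proof -
      have "inv y \<otimes> h = inv y \<otimes> (h \<otimes> y) \<otimes> inv y" using y(1) h(1) by (simp add: m_assoc)
      also have "\<dots> = c e [^] i \<otimes> inv y"
        unfolding y(2) using y(1) c(1) by (simp add: m_assoc[symmetric])
      finally show ?thesis .
    qed
    then have "\<phi> (c e [^] i) (\<phi> (inv y) u) = \<phi> (inv y) (\<phi> h u)"
      using actsD(3)[OF act _ iy \<open>u \<in> V\<close>, of "c e [^] i"] actsD(3)[OF act iy h(1) \<open>u \<in> V\<close>] c(1) by simp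
    then have "\<phi> (c e [^] i) (\<phi> (inv y) u) = \<phi> (inv y) u" using q(2) p by simp
    then show False using sep1[OF e'] nontriv[OF h y] by blast
  qed
  show ?thesis
  proof (rule gluable_if_legs[OF good k c(1,3), where v = "\<lambda>_. v"])
    fix h q e y and i :: int
    assume a: "h \<in> carrier G" "h \<noteq> \<one>" "no_backtrack E q" "\<And>x. x \<in> set q \<Longrightarrow> \<phi> h x = x" "y \<in> carrier G"
      "h \<otimes> y = y \<otimes> c e [^] i" "q \<noteq> []" "hd q = \<phi> y v"
    show "length q + k \<le> Suc k" using short[OF a] by simp
  next
    fix h q e e' y y' and i j :: int
    assume a: "h \<in> carrier G" "h \<noteq> \<one>" "y \<in> carrier G" "y' \<in> carrier G"
      "h \<otimes> y = y \<otimes> c e [^] i" "h \<otimes> y' = y' \<otimes> c e' [^] j"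
      and ne: "\<not> (e = e' \<and> (\<exists>m::int. y' = y \<otimes> c e [^] m))"
    let ?g = "inv y \<otimes> y'"
    have "y \<otimes> (?g \<otimes> c e' [^] j) = h \<otimes> y'" using a c(1) by (simp add: m_assoc[symmetric])
    also have "\<dots> = y \<otimes> (c e [^] i \<otimes> ?g)"
    proof -
      have "y \<otimes> (c e [^] i \<otimes> ?g) = y \<otimes> c e [^] i \<otimes> ?g"
        using a(3,4) c(1) by (simp add: m_assoc)
      also have "\<dots> = h \<otimes> y \<otimes> ?g" unfolding a(5) ..
      also have "\<dots> = h \<otimes> (y \<otimes> ?g)" using a(1,3,4) by (simp add: m_assoc)
      also have "y \<otimes> ?g = y'" using a by (simp add: m_assoc[symmetric])
      finally show ?thesis ..
    qed
    finally have "?g \<otimes> c e' [^] j = c e [^] i \<otimes> ?g"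
      by (rule iffD1[OF Units_l_cancel, rotated 3]) (use a c(1) in simp_all)
    then obtain m :: int where m: "e' = e" "?g = c e [^] m"
      using sep2[of ?g e' j e i] nontriv[OF a(1,2,4,6)] a by auto
    have "y' = y \<otimes> ?g" using a by (simp add: m_assoc[symmetric])
    then have "y' = y \<otimes> c e [^] m" unfolding m(2) .
    then have False using ne m(1) by blast
    then show "length q + 2 * k \<le> Suc k" ..
  qed (use v c br in auto)
qed

section \<open>Change of labels\<close>

text \<open>
  Each gluing changes the types of group elements and of vertices. Renaming both by natural
  numbers allows the constructions to be iterated.
\<close>

definition image_group :: "('g \<Rightarrow> 'h) \<Rightarrow> ('g, 'b) monoid_scheme \<Rightarrow> 'h monoid"
  where "image_group \<theta> G =
    \<lparr>carrier = \<theta> ` carrier G, monoid.mult = (\<lambda>x y. \<theta> (inv_into UNIV \<theta> x \<otimes>\<^bsub>G\<^esub> inv_into UNIV \<theta> y)),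
     one = \<theta> \<one>\<^bsub>G\<^esub>\<rparr>"

lemma carrier_image_group: "carrier (image_group \<theta> G) = \<theta> ` carrier G"
  by (simp add: image_group_def)

lemma image_group_iso:
  assumes G: "group G" and \<theta>: "inj \<theta>"
  shows "group (image_group \<theta> G)" "\<theta> \<in> iso G (image_group \<theta> G)"
proof -
  interpret group G by fact
  show "group (image_group \<theta> G)"
  proof (rule groupI)
    fix x assume "x \<in> carrier (image_group \<theta> G)"
    then obtain g where g: "g \<in> carrier G" "x = \<theta> g" by (auto simp: image_group_def)
    then show "\<exists>y\<in>carrier (image_group \<theta> G). y \<otimes>\<^bsub>image_group \<theta> G\<^esub> x = \<one>\<^bsub>image_group \<theta> G\<^esub>"
      using \<theta> by (intro bexI[of _ "\<theta> (inv\<^bsub>G\<^esub> g)"]) (auto simp: image_group_def)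
  qed (use \<theta> in \<open>auto simp: image_group_def m_assoc\<close>)
  show "\<theta> \<in> iso G (image_group \<theta> G)"
    using \<theta> by (auto simp: iso_def hom_def image_group_def bij_betw_def inj_on_def)
qed

locale relabelling =
  fixes G :: "('g, 'b) monoid_scheme" (structure) and \<theta> :: "'g \<Rightarrow> 'h" and f :: "'v \<Rightarrow> 'w"
    and V E and \<phi> :: "'g \<Rightarrow> 'v \<Rightarrow> 'v"
  assumes T: "tree_acts G V E \<phi>" and \<theta>: "inj \<theta>" and f: "inj f"
begin

abbreviation (input) "G' \<equiv> image_group \<theta> G"

definition \<phi>' where "\<phi>' x u = f (\<phi> (inv_into UNIV \<theta> x) (inv_into UNIV f u))"

abbreviation (input) "V' \<equiv> f ` V"
abbreviation (input) "E' \<equiv> (`) f ` E"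

lemma \<phi>'_eq [simp]: "\<phi>' (\<theta> g) (f v) = f (\<phi> g v)"
  using \<theta> f by (simp add: \<phi>'_def)

lemma edge_iff: "{f u, f v} \<in> E' \<longleftrightarrow> {u, v} \<in> E"
proof
  assume "{f u, f v} \<in> E'"
  then obtain e where "e \<in> E" "f ` e = f ` {u, v}" by (metis image_empty image_iff image_insert)
  then show "{u, v} \<in> E" using inj_image_eq_iff[OF f] by metis
next
  assume "{u, v} \<in> E"
  then have "f ` {u, v} \<in> E'" by (rule imageI)
  then show "{f u, f v} \<in> E'" by simp
qed

lemma edgeE:
  assumes "{x, y} \<in> E'"
  obtains u v where "x = f u" "y = f v" "{u, v} \<in> E"
proof -
  obtain e where e: "e \<in> E" "{x, y} = f ` e" using assms by blast
  then obtain u v where uv: "x = f u" "y = f v" by blast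
  then have "{u, v} \<in> E" using assms edge_iff by simp
  then show thesis using that uv by blast
qed

lemma group: "group G" and group': "group G'" and iso: "\<theta> \<in> iso G G'"
  using tree_actsD(1)[OF T] image_group_iso[OF tree_actsD(1)[OF T] \<theta>] by auto

lemma carrier': "carrier G' = \<theta> ` carrier G" and one': "\<one>\<^bsub>G'\<^esub> = \<theta> \<one>"
  by (simp_all add: image_group_def)

lemma mult': "\<theta> g \<otimes>\<^bsub>G'\<^esub> \<theta> h = \<theta> (g \<otimes> h)"
  using \<theta> by (simp add: image_group_def)

lemma int_pow': "g \<in> carrier G \<Longrightarrow> \<theta> g [^]\<^bsub>G'\<^esub> (i::int) = \<theta> (g [^] i)"
  using hom_int_pow[of \<theta> G G'] iso group group' by (simp add: iso_def)

lemma tree_acts': "tree_acts G' V' E' \<phi>'"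
  unfolding tree_acts_def
proof (intro conjI ballI allI impI)
  show "group G'" by (rule group')
  obtain r par where R: "rooted r par V E" using tree_actsD(2)[OF T] by blast
  define par' where "par' u = f (par (inv_into UNIV f u))" for u
  have par': "par' (f v) = f (par v)" for v using f by (simp add: par'_def)
  have "(par' ^^ n) (f v) = f ((par ^^ n) v)" for n v
    by (induction n) (simp_all add: par')
  then have "rooted (f r) par' V' E'"
    using R f unfolding rooted_def
    by (auto simp: par' image_image inj_eq inj_image_mem_iff image_set_diff[symmetric])
  then show "\<exists>r par. rooted r par V' E'" by blast
  show "acts G' V' \<phi>'"
    using actsD[OF tree_actsD(3)[OF T]] unfolding acts_def carrier' one' by (auto simp: mult')
  fix x u v assume x: "x \<in> carrier G'" and e: "{u, v} \<in> E'"
  obtain g where g: "g \<in> carrier G" "x = \<theta> g" using x carrier' by auto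
  obtain a b where ab: "u = f a" "v = f b" "{a, b} \<in> E" using e by (rule edgeE)
  show "{\<phi>' x u, \<phi>' x v} \<in> E'" using tree_actsD(4)[OF T g(1) ab(3)] g ab by (simp add: edge_iff)
  show "\<not> (\<phi>' x u = v \<and> \<phi>' x v = u)" using tree_actsD(5)[OF T g(1) ab(3)] g ab f by (simp add: inj_eq)
qed

lemma good_action':
  assumes good: "good_action k n G V E \<phi>"
  shows "good_action k n G' V' E' \<phi>'"
  unfolding good_action_def
proof (intro conjI allI impI ballI)
  show "tree_acts G' V' E' \<phi>'" by (rule tree_acts')
  show "\<exists>x\<in>carrier G'. x \<noteq> \<one>\<^bsub>G'\<^esub> \<and> \<phi>' x u = u \<and> \<phi>' x v = v" if uv: "{u, v} \<in> E'" for u v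
  proof -
    obtain a b where ab: "u = f a" "v = f b" "{a, b} \<in> E" using uv by (rule edgeE)
    obtain g where "g \<in> carrier G" "g \<noteq> \<one>" "\<phi> g a = a" "\<phi> g b = b"
      using good_actionD(2)[OF good ab(3)] by blast
    then show ?thesis using ab \<theta> by (intro bexI[of _ "\<theta> g"]) (auto simp: carrier' one' inj_eq)
  qed
  show "length p \<le> Suc k" if x: "x \<in> carrier G'" "x \<noteq> \<one>\<^bsub>G'\<^esub>" and p: "no_backtrack E' p" "\<forall>u\<in>set p. \<phi>' x u = u" for x p
  proof (cases "length p \<le> 1")
    case False
    obtain g where g: "g \<in> carrier G" "x = \<theta> g" using x(1) carrier' by auto
    have "u \<in> range f" if u: "u \<in> set p" for u
    proof -
      obtain i where i: "i < length p" "u = p ! i" using u by (auto simp: in_set_conv_nth)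
      define j where "j = (if Suc i < length p then i else i - 1)"
      have j: "Suc j < length p" "i = j \<or> i = Suc j" using i False by (auto simp: j_def)
      have "{p ! j, p ! Suc j} \<in> E'" using p(1) j(1) by (simp add: no_backtrack_def)
      then show ?thesis by (rule edgeE) (use i(2) j(2) in auto)
    qed
    then obtain q where q: "p = map f q" using ex_map_conv[of p f] by blast
    have "no_backtrack E q" unfolding no_backtrack_def
    proof (intro conjI allI impI)
      fix i assume i: "Suc i < length q"
      then have "{p ! i, p ! Suc i} \<in> E'" using p(1) q by (simp add: no_backtrack_def)
      then show "{q ! i, q ! Suc i} \<in> E" using q i by (simp add: edge_iff)
    next
      fix i assume i: "Suc (Suc i) < length q"
      then have "p ! i \<noteq> p ! Suc (Suc i)" using p(1) q by (simp add: no_backtrack_def)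
      then show "q ! i \<noteq> q ! Suc (Suc i)" using q i by auto
    qed
    moreover have "\<phi> g v = v" if "v \<in> set q" for v
      using p(2) q g that f by (auto simp: inj_eq)
    ultimately have "length q \<le> Suc k"
      using good_actionD(3)[OF good g(1), of q] x(2) g(2) by (auto simp: one')
    then show ?thesis using q by simp
  qed simp
  obtain R where R: "finite R" "card R = n" "edge_transversal G E \<phi> R"
    using good_actionD(4)[OF good] by blast
  have im: "\<phi>' (\<theta> g) ` f ` d = f ` \<phi> g ` d" for g d by (simp add: image_image)
  have eq: "f ` d = f ` d' \<longleftrightarrow> d = d'" for d d' by (rule inj_image_eq_iff[OF f])
  have "edge_transversal G' E' \<phi>' ((`) f ` R)"
    unfolding edge_transversal_def
  proof (intro conjI ballI impI)
    show "(`) f ` R \<subseteq> E'" using edge_transversalD(1)[OF R(3)] by (rule image_mono)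
    fix e assume "e \<in> E'"
    then obtain e\<^sub>0 where "e\<^sub>0 \<in> E" "e = f ` e\<^sub>0" by blast
    moreover obtain g d where "g \<in> carrier G" "d \<in> R" "e\<^sub>0 = \<phi> g ` d"
      using edge_transversalD(2)[OF R(3) calculation(1)] by blast
    ultimately show "\<exists>g\<in>carrier G'. \<exists>d\<in>(`) f ` R. e = \<phi>' g ` d"
      unfolding carrier' using im by blast
  next
    fix d d' x assume d: "d \<in> (`) f ` R" "d' \<in> (`) f ` R" and x: "x \<in> carrier G'" "\<phi>' x ` d = d'"
    obtain c c' g where c: "d = f ` c" "c \<in> R" "d' = f ` c'" "c' \<in> R" and g: "x = \<theta> g" "g \<in> carrier G"
      using d x(1) carrier' by auto
    have "\<phi> g ` c = c'" using x(2) c g im eq by simp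
    then show "d = d'" using edge_transversalD(3)[OF R(3) c(2,4) g(2)] c by simp
  qed
  moreover have "card ((`) f ` R) = n" using R(2) eq by (subst card_image) (auto intro: inj_onI)
  ultimately show "\<exists>R. finite R \<and> card R = n \<and> edge_transversal G' E' \<phi>' R" using R(1) by blast
qed

lemma ready':
  assumes r: "ready k n G V E \<phi> v c"
  shows "ready k n G' V' E' \<phi>' (f v) (\<lambda>e. \<theta> (c e))"
proof -
  have S: "separated G E \<phi> v c" using r by (simp add: ready_def)
  have c: "c e \<in> carrier G" for e using S unfolding separated_def by simp
  have br: "branches E' (f u)" if "branches E u" for u
    using that edge_iff f unfolding branches_def by (meson injD)
  have "separated G' E' \<phi>' (f v) (\<lambda>e. \<theta> (c e))"
    unfolding separated_def int_pow'[OF c]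
  proof (intro conjI allI ballI impI)
    fix e :: bool
    show "\<theta> (c e) \<in> carrier G'" "\<phi>' (\<theta> (c e)) (f v) = f v" "\<theta> (c e) \<otimes>\<^bsub>G'\<^esub> \<theta> (c e) \<noteq> \<one>\<^bsub>G'\<^esub>"
      using S \<theta> unfolding separated_def by (simp_all add: carrier' mult' one' inj_eq)
  next
    fix e :: bool and i :: int and u
    assume e: "{f v, u} \<in> E'" and fu: "\<phi>' (\<theta> (c e [^] i)) u = u"
    obtain a b where ab: "f v = f a" "u = f b" "{a, b} \<in> E" using e by (rule edgeE)
    then have "{v, b} \<in> E" "\<phi> (c e [^] i) b = b" using fu f by (auto simp: inj_eq)
    then have "c e [^] i = \<one>" using S unfolding separated_def by blast
    then show "\<theta> (c e [^] i) = \<one>\<^bsub>G'\<^esub>" by (simp add: one')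
  next
    fix x e e' and i j :: int
    assume x: "x \<in> carrier G'" and eq: "x \<otimes>\<^bsub>G'\<^esub> \<theta> (c e [^] i) = \<theta> (c e' [^] j) \<otimes>\<^bsub>G'\<^esub> x"
      and ne: "\<theta> (c e [^] i) \<noteq> \<one>\<^bsub>G'\<^esub>"
    obtain g where g: "g \<in> carrier G" "x = \<theta> g" using x carrier' by auto
    have "g \<otimes> c e [^] i = c e' [^] j \<otimes> g" "c e [^] i \<noteq> \<one>"
      using eq ne g \<theta> by (auto simp: mult' one' inj_eq)
    then have "e = e' \<and> (\<exists>m::int. g = c e' [^] m)" using S g(1) unfolding separated_def by blast
    then show "e = e'" "\<exists>m::int. x = \<theta> (c e' [^] m)" using g by auto
  qed
  then show ?thesis using r br good_action' unfolding ready_def by blast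
qed

end

section \<open>Presentations and rank\<close>

text \<open>
  The group \<open>G\<close> with generators \<open>x 0, \<dots>, x (r - 1)\<close> and the single relation \<open>x 0 ^ m = 1\<close> (none if
  \<open>m = 0\<close>), characterised by its homomorphisms to groups with elements of type \<open>'q\<close>. The type
  \<open>int\<close> serves for the group of order 3, and sets of words for the quotient of the free group.
\<close>

definition presented ::
    "'q itself \<Rightarrow> nat \<Rightarrow> nat \<Rightarrow> ('g, 'b) monoid_scheme \<Rightarrow> (nat \<Rightarrow> 'g) \<Rightarrow> bool"
  where "presented _ m r G x \<longleftrightarrow>
    group G \<and> x ` {..<r} \<subseteq> carrier G \<and> generate G (x ` {..<r}) = carrier G \<and> x 0 [^]\<^bsub>G\<^esub> m = \<one>\<^bsub>G\<^esub> \<and>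
    (\<forall>(Q :: 'q monoid) q. group Q \<longrightarrow> (\<forall>i<r. q i \<in> carrier Q) \<longrightarrow> q 0 [^]\<^bsub>Q\<^esub> m = \<one>\<^bsub>Q\<^esub> \<longrightarrow>
      (\<exists>\<psi>\<in>hom G Q. \<forall>i<r. \<psi> (x i) = q i))"

lemma presentedD:
  assumes "presented TYPE('q) m r G x"
  shows "group G" "x ` {..<r} \<subseteq> carrier G" "generate G (x ` {..<r}) = carrier G" "x 0 [^]\<^bsub>G\<^esub> m = \<one>\<^bsub>G\<^esub>"
    "\<And>(Q :: 'q monoid) q. group Q \<Longrightarrow> (\<And>i. i < r \<Longrightarrow> q i \<in> carrier Q) \<Longrightarrow> q 0 [^]\<^bsub>Q\<^esub> m = \<one>\<^bsub>Q\<^esub> \<Longrightarrow>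
      \<exists>\<psi>\<in>hom G Q. \<forall>i<r. \<psi> (x i) = q i"
proof -
  note D = assms[unfolded presented_def]
  show "group G" "x ` {..<r} \<subseteq> carrier G" "generate G (x ` {..<r}) = carrier G" "x 0 [^]\<^bsub>G\<^esub> m = \<one>\<^bsub>G\<^esub>"
    using D by simp_all
  show "\<exists>\<psi>\<in>hom G Q. \<forall>i<r. \<psi> (x i) = q i"
    if "group Q" "\<And>i. i < r \<Longrightarrow> q i \<in> carrier Q" "q 0 [^]\<^bsub>Q\<^esub> m = \<one>\<^bsub>Q\<^esub>" for Q :: "'q monoid" and q
    using D[THEN conjunct2, THEN conjunct2, THEN conjunct2, THEN conjunct2, rule_format, of Q q] that by blast
qed

lemma presented_adjoin:
  assumes P: "presented TYPE('q) m r G x" and r: "r > 0"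
  defines "x' \<equiv> \<lambda>i. if i < r then ([], x i) else ([(\<one>\<^bsub>G\<^esub>, True)], \<one>\<^bsub>G\<^esub>)"
  shows "presented TYPE('q) m (Suc r) (adjoin G) x'"
  unfolding presented_def
proof (intro conjI allI impI)
  note D = presentedD[OF P]
  interpret group G by (rule D(1))
  show "group (adjoin G)" by (rule group_adjoin)
  have x': "x' ` {..<Suc r} = (\<lambda>g. ([], g)) ` x ` {..<r} \<union> {([(\<one>\<^bsub>G\<^esub>, True)], \<one>\<^bsub>G\<^esub>)}"
    by (auto simp: x'_def lessThan_Suc image_image)
  show "x' ` {..<Suc r} \<subseteq> carrier (adjoin G)"
    using D(2) unfolding x' by (auto simp: carrier_adjoin syllable_words_Cons)
  show "generate (adjoin G) (x' ` {..<Suc r}) = carrier (adjoin G)"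
    unfolding x' by (rule adjoin_generate[OF D(1-3)])
  have "x 0 \<in> carrier G" using D(2) r by auto
  then show "x' 0 [^]\<^bsub>adjoin G\<^esub> m = \<one>\<^bsub>adjoin G\<^esub>"
    using hom_nat_pow[OF embed_hom _ is_group group_adjoin, of "x 0" m] D(4) r by (simp add: x'_def one_adjoin)
  fix Q :: "'q monoid" and q
  assume Q: "group Q" and q: "\<forall>i<Suc r. q i \<in> carrier Q" "q 0 [^]\<^bsub>Q\<^esub> m = \<one>\<^bsub>Q\<^esub>"
  obtain \<psi> where \<psi>: "\<psi> \<in> hom G Q" "\<forall>i<r. \<psi> (x i) = q i" using D(5)[of Q q] Q q by auto
  have qr: "q r \<in> carrier Q" using q(1) by simp
  have "lift Q \<psi> (q r) (x' i) = q i" if "i < Suc r" for i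
    using that \<psi>(2) qr hom_one[OF \<psi>(1) is_group Q] group.is_monoid[OF Q]
    by (cases "i < r") (auto simp: x'_def lift_simps less_Suc_eq monoid.l_one monoid.r_one)
  then show "\<exists>\<psi>\<in>hom (adjoin G) Q. \<forall>i<Suc r. \<psi> (x' i) = q i"
    using lift_hom[OF is_group Q \<psi>(1) qr] by blast
qed

lemma presented_image:
  assumes P: "presented TYPE('q) m r G x" and r: "r > 0" and \<theta>: "inj \<theta>"
  shows "presented TYPE('q) m r (image_group \<theta> G) (\<lambda>i. \<theta> (x i))"
  unfolding presented_def
proof (intro conjI allI impI)
  note D = presentedD[OF P]
  let ?G = "image_group \<theta> G"
  show g: "group ?G" by (rule image_group_iso[OF D(1) \<theta>])
  have iso: "\<theta> \<in> iso G ?G" by (rule image_group_iso[OF D(1) \<theta>])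
  then have hom: "\<theta> \<in> hom G ?G" by (simp add: iso_def)
  interpret group_hom G ?G \<theta> using D(1) g hom by (simp add: group_hom_def group_hom_axioms_def)
  have im: "(\<lambda>i. \<theta> (x i)) ` {..<r} = \<theta> ` x ` {..<r}" by (simp add: image_image)
  show "(\<lambda>i. \<theta> (x i)) ` {..<r} \<subseteq> carrier ?G" unfolding im carrier_image_group using D(2) by blast
  show "generate ?G ((\<lambda>i. \<theta> (x i)) ` {..<r}) = carrier ?G"
    unfolding im carrier_image_group using generate_img[OF D(2)] D(3) by metis
  have "x 0 \<in> carrier G" using D(2) r by auto
  from hom_nat_pow[OF this, of m] show "\<theta> (x 0) [^]\<^bsub>?G\<^esub> m = \<one>\<^bsub>?G\<^esub>"
    unfolding D(4) hom_one ..
  fix Q :: "'q monoid" and q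
  assume Q: "group Q" and q: "\<forall>i<r. q i \<in> carrier Q" "q 0 [^]\<^bsub>Q\<^esub> m = \<one>\<^bsub>Q\<^esub>"
  obtain \<psi> where \<psi>: "\<psi> \<in> hom G Q" "\<forall>i<r. \<psi> (x i) = q i" using D(5)[of Q q] Q q by auto
  have "(\<lambda>y. \<psi> (inv_into UNIV \<theta> y)) \<in> hom ?G Q"
  proof (rule homI; unfold carrier_image_group)
    fix y z assume "y \<in> \<theta> ` carrier G" "z \<in> \<theta> ` carrier G"
    then obtain g h where g: "g \<in> carrier G" "y = \<theta> g" "h \<in> carrier G" "z = \<theta> h" by blast
    have yz: "y \<otimes>\<^bsub>?G\<^esub> z = \<theta> (g \<otimes>\<^bsub>G\<^esub> h)" unfolding g by (rule hom_mult[OF g(1,3), symmetric])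
    then show "\<psi> (inv_into UNIV \<theta> (y \<otimes>\<^bsub>?G\<^esub> z)) =
        \<psi> (inv_into UNIV \<theta> y) \<otimes>\<^bsub>Q\<^esub> \<psi> (inv_into UNIV \<theta> z)"
      unfolding yz unfolding g(2,4) inv_into_f_f[OF \<theta> UNIV_I] using g(1,3) \<psi>(1) by (simp add: hom_def)
  next
    fix y assume "y \<in> \<theta> ` carrier G"
    then show "\<psi> (inv_into UNIV \<theta> y) \<in> carrier Q"
      using \<theta> \<psi>(1) inv_into_f_f[OF \<theta>] by (auto simp: hom_def)
  qed
  then show "\<exists>\<psi>\<in>hom ?G Q. \<forall>i<r. \<psi> (\<theta> (x i)) = q i"
    using \<psi>(2) \<theta> by (intro bexI[of _ "\<lambda>y. \<psi> (inv_into UNIV \<theta> y)"]) auto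
qed

definition word_value :: "('g, 'b) monoid_scheme \<Rightarrow> ('a \<Rightarrow> 'g) \<Rightarrow> ('a \<times> bool) list \<Rightarrow> 'g"
  where "word_value G x w =
    foldr (\<lambda>(a, e) y. (if e then x a else inv\<^bsub>G\<^esub> x a) \<otimes>\<^bsub>G\<^esub> y) w \<one>\<^bsub>G\<^esub>"

lemma word_value_simps [simp]:
  "word_value G x [] = \<one>\<^bsub>G\<^esub>"
  "word_value G x ((a, e) # w) = (if e then x a else inv\<^bsub>G\<^esub> x a) \<otimes>\<^bsub>G\<^esub> word_value G x w"
  by (simp_all add: word_value_def)

lemma carrier_free_group: "carrier (free_group S) = {w. reduced_word w \<and> fst ` set w \<subseteq> S}"
  by (simp add: free_group_def)

lemma one_free_group: "\<one>\<^bsub>free_group S\<^esub> = []"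
  by (simp add: free_group_def)

lemma mult_free_group: "v \<otimes>\<^bsub>free_group S\<^esub> w = foldr push_letter v w"
  by (simp add: free_group_def)

lemma word_value_hom:
  assumes G: "group G" and x: "x ` S \<subseteq> carrier G"
  shows "word_value G x \<in> hom (free_group S) G"
proof -
  interpret group G by fact
  let ?s = "\<lambda>a e. if e then x a else inv\<^bsub>G\<^esub> x a"
  have s: "?s a e \<in> carrier G" if "a \<in> S" for a e using that x by auto
  have cl: "word_value G x w \<in> carrier G" if "fst ` set w \<subseteq> S" for w
    using that
  proof (induction w)
    case (Cons l w)
    then show ?case using s[of "fst l" "snd l"] by (cases l) auto
  qed simp
  have cancel: "?s a e \<otimes>\<^bsub>G\<^esub> (?s a (\<not> e) \<otimes>\<^bsub>G\<^esub> y) = y" if "a \<in> S" "y \<in> carrier G" for a e y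
    using that x by (auto simp: m_assoc[symmetric])
  have push: "word_value G x (push_letter (a, e) w) = ?s a e \<otimes>\<^bsub>G\<^esub> word_value G x w"
    if a: "a \<in> S" and w: "fst ` set w \<subseteq> S" for a e w
  proof (cases w)
    case (Cons l u)
    show ?thesis
    proof (cases "l = inv_letter (a, e)")
      case True
      then have "l = (a, \<not> e)" by (simp add: inv_letter_def)
      moreover have "word_value G x u \<in> carrier G" using w Cons by (intro cl) auto
      ultimately show ?thesis using cancel[OF a, of "word_value G x u" e] Cons True
        by (simp del: if_split)
    next
      case False
      then show ?thesis using Cons by (cases l) simp
    qed
  qed simp
  show ?thesis
  proof (rule homI)
    fix v w assume v: "v \<in> carrier (free_group S)" and w: "w \<in> carrier (free_group S)"
    have "word_value G x (foldr push_letter v w) = word_value G x v \<otimes>\<^bsub>G\<^esub> word_value G x w"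
      if "fst ` set v \<subseteq> S" using that
    proof (induction v)
      case Nil
      then show ?case using cl[of w] w by (simp add: carrier_free_group)
    next
      case (Cons l v)
      obtain a e where l: "l = (a, e)" by fastforce
      have "fst ` set (foldr push_letter v w) \<subseteq> S"
        by (rule subset_trans[OF set_mult]) (use Cons(2) w in \<open>auto simp: carrier_free_group\<close>)
      then have "word_value G x (foldr push_letter (l # v) w) =
          ?s a e \<otimes>\<^bsub>G\<^esub> (word_value G x v \<otimes>\<^bsub>G\<^esub> word_value G x w)"
        using push[of a "foldr push_letter v w" e] Cons l by simp
      moreover have "a \<in> S" using Cons(2) l by auto
      ultimately show ?case using Cons(2) l s[of a e] cl[of v] cl[of w] w
        by (simp add: m_assoc carrier_free_group del: if_split)
    qed
    then show "word_value G x (v \<otimes>\<^bsub>free_group S\<^esub> w) = word_value G x v \<otimes>\<^bsub>G\<^esub> word_value G x w"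
      using v by (simp add: mult_free_group carrier_free_group)
  qed (use cl in \<open>auto simp: carrier_free_group\<close>)
qed

lemma word_value_surj:
  assumes G: "group G" and x: "x ` S \<subseteq> carrier G" "generate G (x ` S) = carrier G"
  shows "word_value G x ` carrier (free_group S) = carrier G"
proof -
  interpret group_hom "free_group S" G "word_value G x"
    using G group_free_group word_value_hom[OF G x(1)] by (simp add: group_hom_def group_hom_axioms_def)
  have "x ` S \<subseteq> word_value G x ` carrier (free_group S)"
  proof
    fix y assume "y \<in> x ` S"
    then obtain a where a: "a \<in> S" "y = x a" by blast
    then have "[(a, True)] \<in> carrier (free_group S)" by (simp add: carrier_free_group reduced_word_def)
    moreover have "word_value G x [(a, True)] = y" using a x(1) by auto
    ultimately show "y \<in> word_value G x ` carrier (free_group S)" by force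
  qed
  then have "generate G (x ` S) \<subseteq> word_value G x ` carrier (free_group S)"
    by (rule H.generate_subgroup_incl[OF _ img_is_subgroup])
  then show ?thesis using x(2) hom_closed by auto
qed

lemma normal_closure_normal:
  assumes G: "group G" and R: "R \<subseteq> carrier G"
  shows "normal_closure G R \<lhd> G" "R \<subseteq> normal_closure G R"
    "\<And>N. N \<lhd> G \<Longrightarrow> R \<subseteq> N \<Longrightarrow> normal_closure G R \<subseteq> N"
proof -
  interpret group G by fact
  have ex: "carrier G \<in> {N. N \<lhd> G \<and> R \<subseteq> N}"
    using R by (auto intro!: normal_invI subgroup_self)
  show "R \<subseteq> normal_closure G R" unfolding normal_closure_def by blast
  show "\<And>N. N \<lhd> G \<Longrightarrow> R \<subseteq> N \<Longrightarrow> normal_closure G R \<subseteq> N" unfolding normal_closure_def by blast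
  show "normal_closure G R \<lhd> G"
  proof (rule normal_invI)
    show "subgroup (normal_closure G R) G"
      unfolding normal_closure_def
      by (rule subgroups_Inter) (use ex in \<open>auto simp: normal_def\<close>)
    fix x h assume x: "x \<in> carrier G" and h: "h \<in> normal_closure G R"
    show "x \<otimes>\<^bsub>G\<^esub> h \<otimes>\<^bsub>G\<^esub> inv\<^bsub>G\<^esub> x \<in> normal_closure G R"
      unfolding normal_closure_def
    proof (rule InterI)
      fix N assume N: "N \<in> {N. N \<lhd> G \<and> R \<subseteq> N}"
      then have "h \<in> N" using h unfolding normal_closure_def by blast
      moreover have "N \<lhd> G" using N by simp
      ultimately show "x \<otimes>\<^bsub>G\<^esub> h \<otimes>\<^bsub>G\<^esub> inv\<^bsub>G\<^esub> x \<in> N" using x by (intro normal.inv_op_closed2)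
    qed
  qed
qed

lemma replicate_in_free_group: "a \<in> S \<Longrightarrow> replicate m (a, True) \<in> carrier (free_group S)"
proof -
  assume "a \<in> S"
  moreover have "reduced_word (replicate m (a, True))"
    unfolding reduced_word_def by (induction m) (auto simp: successively_Cons inv_letter_def)
  ultimately show ?thesis by (auto simp: carrier_free_group)
qed

lemma replicate_pow: "a \<in> S \<Longrightarrow> replicate m (a, True) = [(a, True)] [^]\<^bsub>free_group S\<^esub> m"
proof (induction m)
  case 0
  then show ?case by (simp add: one_free_group)
next
  case (Suc m)
  interpret group "free_group S" by (rule group_free_group)
  have a: "[(a, True)] \<in> carrier (free_group S)" using replicate_in_free_group[OF Suc(2), of 1] by simp
  have "[(a, True)] [^]\<^bsub>free_group S\<^esub> Suc m = [(a, True)] \<otimes>\<^bsub>free_group S\<^esub> replicate m (a, True)"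
    using Suc by (simp only: nat_pow_Suc2[OF a])
  also have "\<dots> = replicate (Suc m) (a, True)"
    by (cases m) (simp_all add: mult_free_group inv_letter_def)
  finally show ?case ..
qed

text \<open>
  The universal property yields a map \<open>\<psi>\<close> from \<open>G\<close> to the quotient, and its composition with
  the evaluation of words is the canonical projection, as both agree on the generators.
\<close>

lemma presented_iso:
  fixes G :: "('g, 'b) monoid_scheme"
  assumes P: "presented TYPE((nat \<times> bool) list set) m r G x" and r: "r > 0"
  defines "F \<equiv> free_group {..<r}" and "N \<equiv> normal_closure (free_group {..<r}) {replicate m (0, True)}"
  shows "G \<cong> F Mod N" "kernel F G (word_value G x) = N"
proof -
  note D = presentedD[OF P]
  interpret F: group F unfolding F_def by (rule group_free_group)
  interpret G: group G by (rule D(1))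
  let ?R = "{replicate m (0, True)} :: (nat \<times> bool) list set"
  have RF: "?R \<subseteq> carrier F" using replicate_in_free_group[of 0 "{..<r}" m] r by (auto simp: F_def)
  note NC = normal_closure_normal[OF F.is_group RF]
  have NC': "N \<lhd> F" "?R \<subseteq> N" "\<And>M. M \<lhd> F \<Longrightarrow> ?R \<subseteq> M \<Longrightarrow> N \<subseteq> M"
    using NC unfolding N_def F_def by auto
  interpret N: normal N F by (rule NC')
  let ?v = "word_value G x"
  interpret v: group_hom F G ?v
    using word_value_hom[OF D(1,2)] F.is_group G.is_group by (simp add: group_hom_def group_hom_axioms_def F_def)
  have surj: "?v ` carrier F = carrier G" unfolding F_def by (rule word_value_surj[OF D(1-3)])
  have x0: "x 0 \<in> carrier G" using D(2) r by auto
  have gen: "[(i, e)] \<in> carrier F" if "i < r" for i e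
    using that by (simp add: F_def carrier_free_group reduced_word_def)
  have v1: "?v [(i, True)] = x i" if "i < r" for i using that D(2) by auto
  have "?v (replicate m (0, True)) = \<one>\<^bsub>G\<^esub>"
    using v.hom_nat_pow[OF gen[OF r, of True], of m] v1[OF r] D(4) replicate_pow[of 0 "{..<r}" m] r
    by (simp add: F_def)
  then have Nker: "N \<subseteq> kernel F G ?v"
    using NC'(3)[OF v.normal_kernel] RF by (auto simp: kernel_def)
  let ?q = "\<lambda>i. N #>\<^bsub>F\<^esub> [(i, True)]"
  have Q: "group (F Mod N)" by (rule N.factorgroup_is_group)
  have rh: "(\<lambda>w. N #>\<^bsub>F\<^esub> w) \<in> hom F (F Mod N)" by (rule N.r_coset_hom_Mod)
  interpret rc: group_hom F "F Mod N" "\<lambda>w. N #>\<^bsub>F\<^esub> w"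
    using rh Q F.is_group by (simp add: group_hom_def group_hom_axioms_def)
  have "?q 0 [^]\<^bsub>F Mod N\<^esub> m = N #>\<^bsub>F\<^esub> (replicate m (0, True))"
    using rc.hom_nat_pow[OF gen[OF r, of True], of m] replicate_pow[of 0 "{..<r}" m] r by (simp add: F_def)
  also have "\<dots> = N"
    by (rule F.coset_join2[OF _ N.is_subgroup]) (use RF NC'(2) in auto)
  finally have q0: "?q 0 [^]\<^bsub>F Mod N\<^esub> m = \<one>\<^bsub>F Mod N\<^esub>" by simp
  obtain \<psi> where \<psi>: "\<psi> \<in> hom G (F Mod N)" "\<forall>i<r. \<psi> (x i) = ?q i"
    using D(5)[of "F Mod N" ?q] Q q0 rc.hom_closed[OF gen] by blast
  interpret \<psi>: group_hom G "F Mod N" \<psi>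
    using \<psi>(1) Q G.is_group by (simp add: group_hom_def group_hom_axioms_def)
  have comp: "\<psi> (?v w) = N #>\<^bsub>F\<^esub> w" if "w \<in> carrier F" for w
    using that
  proof (induction w)
    case Nil
    then show ?case using rc.hom_one \<psi>.hom_one by (simp add: F_def one_free_group)
  next
    case (Cons l w)
    obtain i e where l: "l = (i, e)" by fastforce
    have i: "i < r" and w: "w \<in> carrier F"
      using Cons(2) l by (auto simp: F_def carrier_free_group reduced_word_def successively_Cons)
    have xi: "x i \<in> carrier G" using D(2) i by auto
    have lw: "l # w = [l] \<otimes>\<^bsub>F\<^esub> w"
      using Cons(2) by (cases w) (auto simp: F_def carrier_free_group mult_free_group reduced_word_def)
    have inv: "[(i, False)] = inv\<^bsub>F\<^esub> [(i, True)]"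
      by (rule F.inv_equality[symmetric, OF _ gen[OF i] gen[OF i]])
        (simp add: F_def mult_free_group one_free_group inv_letter_def)
    have "\<psi> (?v [l]) = N #>\<^bsub>F\<^esub> [l]"
    proof (cases e)
      case True
      then show ?thesis using \<psi>(2) i l v1 by simp
    next
      case False
      have "\<psi> (?v [l]) = inv\<^bsub>F Mod N\<^esub> \<psi> (x i)" using False l xi by simp
      also have "\<dots> = N #>\<^bsub>F\<^esub> [l]" using \<psi>(2) i l False inv rc.hom_inv[OF gen[OF i, of True]] by simp
      finally show ?thesis .
    qed
    moreover have "\<psi> (?v (l # w)) = \<psi> (?v [l]) \<otimes>\<^bsub>F Mod N\<^esub> \<psi> (?v w)"
      unfolding lw using v.hom_mult[of "[l]" w] gen[OF i] w l v.hom_closed by (simp del: word_value_simps)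
    ultimately have "\<psi> (?v (l # w)) = (N #>\<^bsub>F\<^esub> [l]) \<otimes>\<^bsub>F Mod N\<^esub> (N #>\<^bsub>F\<^esub> w)"
      using Cons(1)[OF w] by (simp only:)
    then show ?case unfolding lw using rc.hom_mult[of "[l]" w] gen[OF i] w l by (simp del: word_value_simps)
  qed
  have inN: "w \<in> N" if "w \<in> carrier F" "?v w = \<one>\<^bsub>G\<^esub>" for w
  proof -
    have "N #>\<^bsub>F\<^esub> w = N" using comp[OF that(1)] that(2) \<psi>.hom_one by simp
    then show ?thesis using F.coset_join1[OF _ that(1) N.is_subgroup] N.subset by blast
  qed
  then show "kernel F G ?v = N" using Nker by (auto simp: kernel_def)
  have "inj_on \<psi> (carrier G)"
  proof (rule \<psi>.inj_on_one_iff[THEN iffD2], intro allI impI)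
    fix g assume g: "g \<in> carrier G" "\<psi> g = \<one>\<^bsub>F Mod N\<^esub>"
    then obtain w where w: "w \<in> carrier F" "g = ?v w" using surj by blast
    then have "N #>\<^bsub>F\<^esub> w = N" using comp g by simp
    then have "w \<in> N" using F.coset_join1[OF _ w(1) N.is_subgroup] N.subset by blast
    then show "g = \<one>\<^bsub>G\<^esub>" using Nker w by (auto simp: kernel_def)
  qed
  moreover have "\<psi> ` carrier G = carrier (F Mod N)"
    unfolding carrier_FactGroup surj[symmetric] image_image using comp by simp
  ultimately have "\<psi> \<in> iso G (F Mod N)" using \<psi>(1) by (simp add: iso_def bij_betw_def)
  then show "G \<cong> F Mod N" unfolding is_iso_def by blast
qed

lemma presented_free_iso:
  assumes P: "presented TYPE((nat \<times> bool) list set) 0 r G x" and r: "r > 0"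
  shows "word_value G x \<in> iso (free_group {..<r}) G"
proof -
  note D = presentedD[OF P]
  interpret F: group "free_group {..<r}" by (rule group_free_group)
  interpret v: group_hom "free_group {..<r}" G "word_value G x"
    using word_value_hom[OF D(1,2)] D(1) by (simp add: group_hom_def group_hom_axioms_def F.is_group)
  have "{[]} \<lhd> free_group {..<r}" using F.one_is_normal by (simp add: one_free_group)
  then have "normal_closure (free_group {..<r}) {replicate 0 (0, True)} \<subseteq> {[]}"
    using normal_closure_normal(3)[OF F.is_group, of "{[]}" "{[]}"] F.one_closed by (simp add: one_free_group)
  then have "kernel (free_group {..<r}) G (word_value G x) \<subseteq> {\<one>\<^bsub>free_group {..<r}\<^esub>}"
    unfolding presented_iso(2)[OF P r] one_free_group .
  then have "inj_on (word_value G x) (carrier (free_group {..<r}))"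
    by (intro v.inj_on_one_iff[THEN iffD2]) (auto simp: kernel_def)
  then show ?thesis using word_value_surj[OF D(1-3)] v.homh by (simp add: iso_def bij_betw_def)
qed

lemma finitely_presented_if_presented:
  assumes P: "presented TYPE((nat \<times> bool) list set) m r G x" and r: "r > 0"
  shows "finitely_presented G"
  unfolding finitely_presented_def
  using presented_iso(1)[OF P r] replicate_in_free_group[of 0 "{..<r}" m] r
  by (intro exI[of _ r] exI[of _ "{replicate m (0, True)}"]) auto

lemma hom_eq_on_generate:
  assumes "group G" "group Q" "\<psi> \<in> hom G Q" "\<psi>' \<in> hom G Q" "S \<subseteq> carrier G"
    and "\<And>s. s \<in> S \<Longrightarrow> \<psi> s = \<psi>' s" "g \<in> generate G S"
  shows "\<psi> g = \<psi>' g"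
  using assms(7)
proof induction
  case (inv h)
  then show ?case using assms(1-6) group_hom.hom_inv[of G Q] 
    by (metis (no_types, lifting) group_hom.intro group_hom_axioms.intro subsetD)
next
  case (eng h1 h2)
  have "generate G S \<subseteq> carrier G" using group.generate_incl[OF assms(1,5)] .
  then show ?case using eng assms(3,4) by (simp add: hom_def subset_iff)
qed (use assms(6) hom_one[OF assms(3,1,2)] hom_one[OF assms(4,1,2)] in auto)

text \<open>
  There are \<open>p ^ r\<close> homomorphisms to the group of order \<open>p\<close>, and they are determined by
  their values on any generating set \<open>S\<close>; hence \<open>p ^ r \<le> p ^ card S\<close>.
\<close>

lemma rank_presented:
  fixes G :: "('g, 'b) monoid_scheme"
  assumes P: "presented TYPE(int) m r G x" and p: "p > 1" "p dvd m"
  shows "group_rank G = r"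
proof -
  note D = presentedD[OF P]
  let ?Q = "integer_mod_group p"
  have Qc: "carrier ?Q = {0..<int p}" using p(1) by (simp add: carrier_integer_mod_group)
  have lower: "r \<le> card S" if S: "S \<subseteq> carrier G" "finite S" "generate G S = carrier G" for S
  proof -
    have "\<exists>\<psi>\<in>hom G ?Q. \<forall>i<r. \<psi> (x i) = q i" if q: "q \<in> {..<r} \<rightarrow>\<^sub>E carrier ?Q" for q
    proof (rule D(5))
      have "int m * q 0 mod int p = 0" using p(2) by (simp add: mod_eq_0_iff_dvd)
      then show "q 0 [^]\<^bsub>?Q\<^esub> m = \<one>\<^bsub>?Q\<^esub>"
        by (simp add: int_pow_int[symmetric] int_pow_integer_mod_group del: pow_integer_mod_group)
    qed (use q in auto)
    then obtain \<Psi> where \<Psi>: "\<And>q. q \<in> {..<r} \<rightarrow>\<^sub>E carrier ?Q \<Longrightarrow> \<Psi> q \<in> hom G ?Q"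
      "\<And>q i. q \<in> {..<r} \<rightarrow>\<^sub>E carrier ?Q \<Longrightarrow> i < r \<Longrightarrow> \<Psi> q (x i) = q i" by metis
    let ?f = "\<lambda>q. restrict (\<Psi> q) S"
    have "inj_on ?f ({..<r} \<rightarrow>\<^sub>E carrier ?Q)"
    proof (rule inj_onI)
      fix q q' assume q: "q \<in> {..<r} \<rightarrow>\<^sub>E carrier ?Q" and q': "q' \<in> {..<r} \<rightarrow>\<^sub>E carrier ?Q" and eq: "?f q = ?f q'"
      have "\<Psi> q s = \<Psi> q' s" if "s \<in> S" for s using eq that by (metis restrict_apply')
      then have "\<Psi> q g = \<Psi> q' g" if "g \<in> carrier G" for g
        using hom_eq_on_generate[OF D(1) group_integer_mod_group \<Psi>(1)[OF q] \<Psi>(1)[OF q'] S(1), of g] that S(3)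
        by blast
      then show "q = q'" using \<Psi>(2)[OF q] \<Psi>(2)[OF q'] D(2) q q'
        by (intro PiE_ext[OF q q']) (metis imageI lessThan_iff subsetD)
    qed
    moreover have "?f ` ({..<r} \<rightarrow>\<^sub>E carrier ?Q) \<subseteq> S \<rightarrow>\<^sub>E carrier ?Q"
    proof (intro image_subsetI)
      fix q assume q: "q \<in> {..<r} \<rightarrow>\<^sub>E carrier ?Q"
      have "\<Psi> q s \<in> carrier ?Q" if "s \<in> S" for s using hom_in_carrier[OF \<Psi>(1)[OF q]] S(1) that by blast
      then show "?f q \<in> S \<rightarrow>\<^sub>E carrier ?Q" by simp
    qed
    moreover have "finite (S \<rightarrow>\<^sub>E carrier ?Q)" using S(2) Qc by (intro finite_PiE) auto
    ultimately have le: "card ({..<r} \<rightarrow>\<^sub>E carrier ?Q) \<le> card (S \<rightarrow>\<^sub>E carrier ?Q)" by (rule card_inj_on_le)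
    have c: "card (carrier ?Q) = p" unfolding Qc by simp
    have "card ({..<r} \<rightarrow>\<^sub>E carrier ?Q) = p ^ r" using card_funcsetE[of "{..<r}" "carrier ?Q"] unfolding c by simp
    moreover have "card (S \<rightarrow>\<^sub>E carrier ?Q) = p ^ card S" using card_funcsetE[OF S(2), of "carrier ?Q"] unfolding c .
    ultimately have "p ^ r \<le> p ^ card S" using le by simp
    then show ?thesis by (rule power_le_imp_le_exp[OF p(1)])
  qed
  let ?P = "\<lambda>n. \<exists>S\<subseteq>carrier G. finite S \<and> card S = n \<and> generate G S = carrier G"
  have "?P (card (x ` {..<r}))" using D(2,3) by blast
  moreover have "card (x ` {..<r}) \<le> r" using card_image_le[of "{..<r}" x] by simp
  moreover have "r \<le> n" if "?P n" for n using that lower by blast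
  ultimately have "?P r" by (metis le_antisym)
  then show ?thesis unfolding group_rank_def using lower by (intro Least_equality) auto
qed

section \<open>The starting trees and the theorem\<close>

definition segment :: "nat \<Rightarrow> nat set set"
  where "segment l = (\<lambda>i. {i, Suc i}) ` {..<l}"

lemma segment_rooted: "rooted 0 (\<lambda>i. i - 1) {..l} (segment l)"
  unfolding rooted_def
proof (intro conjI ballI)
  have "((\<lambda>i::nat. i - 1) ^^ n) m = m - n" for n m by (induction n) auto
  then show "\<exists>n. ((\<lambda>i. i - 1) ^^ n) v = 0" for v :: nat by (intro exI[of _ v]) simp
  show "segment l = (\<lambda>i. {i, i - 1}) ` ({..l} - {0})"
  proof (intro equalityI subsetI)
    fix e assume "e \<in> segment l"
    then obtain i where "i < l" "e = {i, Suc i}" by (auto simp: segment_def)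
    then show "e \<in> (\<lambda>i. {i, i - 1}) ` ({..l} - {0})" by (intro image_eqI[of _ _ "Suc i"]) auto
  next
    fix e assume "e \<in> (\<lambda>i. {i, i - 1}) ` ({..l} - {0})"
    then obtain i where "i \<le> l" "i \<noteq> 0" "e = {i, i - 1}" by auto
    then show "e \<in> segment l" unfolding segment_def by (intro image_eqI[of _ _ "i - 1"]) auto
  qed
qed auto

lemma segment_path_length:
  assumes "no_backtrack (segment l) p" "p \<noteq> []" "hd p \<le> l"
  shows "length p \<le> Suc l"
proof -
  have "p ! i \<le> l" if "i < length p" for i
  proof (cases i)
    case 0
    then show ?thesis using assms(2,3) by (simp add: hd_conv_nth)
  next
    case (Suc j)
    then have "{p ! j, p ! i} \<in> segment l" using assms(1) that by (simp add: no_backtrack_def)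
    then show ?thesis using rooted_edge_cases(2)[OF segment_rooted] by blast
  qed
  then have "set p \<subseteq> {..l}" by (auto simp: in_set_conv_nth)
  then have "card (set p) \<le> Suc l" using card_mono[of "{..l}" "set p"] by simp
  then show ?thesis using no_backtrack_distinct[OF segment_rooted assms(1)] by (simp add: distinct_card)
qed

lemma segment_branches:
  assumes "u \<le> l"
  shows "branches (segment l) u \<or> u = 0 \<or> u = l"
proof (cases "u = 0 \<or> u = l")
  case False
  then have "{u, u - 1} \<in> segment l" "{u, Suc u} \<in> segment l"
    using assms unfolding segment_def
    by (auto intro!: image_eqI[of _ _ "u - 1"])
  moreover have "u - 1 \<noteq> Suc u" by simp
  ultimately show ?thesis unfolding branches_def by blast
qed auto

lemma good_action_segment:
  assumes G: "group G" and g: "g \<in> carrier G" "g \<noteq> \<one>\<^bsub>G\<^esub>" and l: "l \<le> k"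
  shows "good_action k l G {..l} (segment l) (\<lambda>_ v. v)"
  unfolding good_action_def
proof (intro conjI allI impI ballI)
  show "tree_acts G {..l} (segment l) (\<lambda>_ v. v)"
    unfolding tree_acts_def
  proof (intro conjI allI impI ballI)
    show "\<exists>r par. rooted r par {..l} (segment l)" using segment_rooted by blast
    fix u v assume "{u, v} \<in> segment l"
    then show "\<not> (u = v \<and> v = u)" using rooted_edge_cases(3)[OF segment_rooted] by blast
  qed (use G in \<open>auto simp: acts_def\<close>)
  show "\<exists>g\<in>carrier G. g \<noteq> \<one>\<^bsub>G\<^esub> \<and> u = u \<and> v = v" for u v :: nat using g by blast
  show "length p \<le> Suc k" if p: "no_backtrack (segment l) p" for p
  proof (cases "length p \<le> 1")
    case False
    then obtain x y q where xy: "p = x # y # q" by (cases p; cases "tl p") auto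
    have "Suc 0 < length p" using xy by simp
    then have "{p ! 0, p ! Suc 0} \<in> segment l" using p unfolding no_backtrack_def by blast
    then have "hd p \<le> l" using rooted_edge_cases(1)[OF segment_rooted] xy by fastforce
    then show ?thesis using segment_path_length[OF p] xy l by fastforce
  qed simp
  have inj: "inj_on (\<lambda>i. {i, Suc i}) {..<l}" by (auto simp: inj_on_def doubleton_eq_iff)
  have "edge_transversal G (segment l) (\<lambda>_ v. v) (segment l)"
    using group.is_monoid[OF G] monoid.one_closed unfolding edge_transversal_def by fastforce
  moreover have "card (segment l) = l" unfolding segment_def using card_image[OF inj] by simp
  moreover have "finite (segment l)" unfolding segment_def by simp
  ultimately show "\<exists>R. finite R \<and> card R = l \<and> edge_transversal G (segment l) (\<lambda>_ v. v) R" by blast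
qed

lemma segment_ends:
  assumes "l > 0"
  shows "\<exists>u. {0, u} \<in> segment l" "\<exists>u. {l, u} \<in> segment l"
proof -
  have "{0, Suc 0} \<in> segment l" using assms by (auto simp: segment_def)
  then show "\<exists>u. {0, u} \<in> segment l" by blast
  have "{l, l - 1} \<in> segment l" using assms unfolding segment_def by (intro image_eqI[of _ _ "l - 1"]) auto
  then show "\<exists>u. {l, u} \<in> segment l" by blast
qed

lemma gluable_segment:
  assumes m: "m = 0 \<or> m \<ge> 3" and k: "k > 0"
  shows "gluable k k (integer_mod_group m) {..k} (segment k) (\<lambda>_ v. v) (\<lambda>e. if e then k else 0) (\<lambda>_. 1)"
  unfolding gluable_def
proof (intro conjI allI ballI)
  let ?G = "integer_mod_group m"
  have one: "1 \<in> carrier ?G" using m by auto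
  show "good_action k k ?G {..k} (segment k) (\<lambda>_ v. v)"
    by (rule good_action_segment[OF group_integer_mod_group one]) auto
  show "branches (segment k) v \<or> (\<exists>g\<in>carrier ?G. \<exists>e. v = (if e then k else 0))" if "v \<in> {..k}" for v
    using segment_branches[of v k] that one by (metis (full_types) atMost_iff)
  show "1 \<otimes>\<^bsub>?G\<^esub> 1 \<noteq> \<one>\<^bsub>?G\<^esub>" using m zdvd_imp_le[of "int m" 2] by auto
  fix e
  show "(if e then k else 0) \<in> {..k}" by simp
  show "\<exists>u. {if e then k else 0, u} \<in> segment k" using segment_ends[OF k] by simp
  show "1 \<in> carrier ?G" by (rule one)
qed simp

text \<open>
  The elements 5 and 3 of the cyclic group of order 15 generate its subgroups of order 3 and 5.
  Since these meet trivially, two legs fixed by the same non-trivial element hang at the same end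
  of the segment.
\<close>

lemma gluable_segment_with_legs:
  assumes k: "k \<ge> 2"
  shows "\<exists>(V :: (nat + (bool \<times> int) \<times> nat) set) E \<phi> L c.
    gluable k (k + k div 2) (integer_mod_group 15) V E \<phi> L c"
proof -
  let ?G = "integer_mod_group 15"
  define n l where "n = k div 2" and "l = k - n"
  have nl: "n > 0" "l > 0" "l + n = k" "2 * n \<le> k" "l + 2 * n = k + k div 2"
    using k by (auto simp: n_def l_def)
  define c :: "bool \<Rightarrow> int" where "c e = (if e then 3 else 5)" for e
  define v where "v e = (if e then l else 0)" for e
  interpret comm_group ?G by (rule abelian_integer_mod_group)
  have c: "c e \<in> carrier ?G" "c e \<otimes>\<^bsub>?G\<^esub> c e \<noteq> \<one>\<^bsub>?G\<^esub>" for e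
    by (auto simp: c_def carrier_integer_mod_group)
  have pow: "h = c e [^]\<^bsub>?G\<^esub> i"
    if "h \<in> carrier ?G" "y \<in> carrier ?G" "h \<otimes>\<^bsub>?G\<^esub> y = y \<otimes>\<^bsub>?G\<^esub> c e [^]\<^bsub>?G\<^esub> i" for h y e and i :: int
  proof -
    have "h \<otimes>\<^bsub>?G\<^esub> y = c e [^]\<^bsub>?G\<^esub> i \<otimes>\<^bsub>?G\<^esub> y"
      unfolding that(3) by (rule m_comm) (use that c in auto)
    then show ?thesis by (rule iffD1[OF right_cancel, rotated 3]) (use that c in auto)
  qed
  have "\<exists>(V' :: (nat + (bool \<times> int) \<times> nat) set) E' \<phi>' L. gluable k (l + 2 * n) ?G V' E' \<phi>' L c"
  proof (rule gluable_if_legs[where v = v])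
    show "good_action k l ?G {..l} (segment l) (\<lambda>_ v. v)"
      by (rule good_action_segment[OF is_group c(1)[of True]]) (use nl in \<open>auto simp: c_def\<close>)
    show "v e \<in> {..l}" for e by (simp add: v_def)
    show "branches (segment l) u \<or> (\<exists>w. {u, w} \<in> segment l) \<and> (\<exists>e. u = v e)" if "u \<in> {..l}" for u
      using segment_branches[of u l] that segment_ends[OF nl(2)] unfolding v_def by (metis atMost_iff)
  next
    fix h :: int and q e
    assume "no_backtrack (segment l) q" "q \<noteq> []" "hd q = v e"
    then have "length q \<le> Suc l" by (intro segment_path_length) (auto simp: v_def)
    then show "length q + n \<le> Suc k" using nl by simp
  next
    fix h y y' q e e' and i j :: int
    assume h: "h \<in> carrier ?G" "h \<noteq> \<one>\<^bsub>?G\<^esub>" and q: "no_backtrack (segment l) q" "q \<noteq> []" "hd q = v e" "last q = v e'"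
      and y: "y \<in> carrier ?G" "y' \<in> carrier ?G" "h \<otimes>\<^bsub>?G\<^esub> y = y \<otimes>\<^bsub>?G\<^esub> c e [^]\<^bsub>?G\<^esub> i"
        "h \<otimes>\<^bsub>?G\<^esub> y' = y' \<otimes>\<^bsub>?G\<^esub> c e' [^]\<^bsub>?G\<^esub> j"
    have "e = e'"
    proof (rule ccontr)
      assume "e \<noteq> e'"
      have hh: "h = i * c e mod 15" "h = j * c e' mod 15"
        using pow[OF h(1) y(1,3)] pow[OF h(1) y(2,4)] by (simp_all add: int_pow_integer_mod_group)
      have "c e dvd h" unfolding hh(1) by (rule dvd_mod) (simp_all add: c_def)
      moreover have "c e' dvd h" unfolding hh(2) by (rule dvd_mod) (simp_all add: c_def)
      ultimately have "3 dvd h" "5 dvd h" using \<open>e \<noteq> e'\<close> by (cases e; cases e'; simp add: c_def)+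
      then have "15 dvd h" by presburger
      then show False using h zdvd_imp_le[of 15 h] by (auto simp: carrier_integer_mod_group)
    qed
    then have "length q = 1" using no_backtrack_closed_trivial[OF segment_rooted q(1,2)] q(3,4) by simp
    then show "length q + 2 * n \<le> Suc k" using nl by simp
  qed (use nl c in auto)
  then show ?thesis unfolding nl(5) by blast
qed

lemma presented_cyclic:
  assumes m: "m \<noteq> 1"
  shows "presented TYPE('q) m 1 (integer_mod_group m) (\<lambda>_. 1)"
  unfolding presented_def
proof (intro conjI allI impI)
  let ?G = "integer_mod_group m"
  interpret group ?G by simp
  have one: "1 \<in> carrier ?G" using m by simp
  show "group ?G" by simp
  show "(\<lambda>_. 1) ` {..<1::nat} \<subseteq> carrier ?G" using one by auto
  have im: "(\<lambda>_. 1::int) ` {..<1::nat} = {1}" by auto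
  interpret S: subgroup "generate ?G {1}" ?G by (rule generate_is_subgroup) (use one in auto)
  have "z \<in> generate ?G {1}" if z: "z \<in> carrier ?G" for z
  proof -
    have "1 [^]\<^bsub>?G\<^esub> z \<in> generate ?G {1}"
      by (rule subgroup_int_pow_closed[OF S.subgroup_axioms generate.incl]) simp
    moreover have "1 [^]\<^bsub>?G\<^esub> z = z"
      using z by (auto simp: int_pow_integer_mod_group carrier_integer_mod_group split: if_splits)
    ultimately show ?thesis by simp
  qed
  then show "generate ?G ((\<lambda>_. 1) ` {..<1::nat}) = carrier ?G"
    unfolding im using S.subset by blast
  show "1 [^]\<^bsub>?G\<^esub> m = \<one>\<^bsub>?G\<^esub>" by simp
  fix Q :: "'q monoid" and q
  assume Q: "group Q" and q: "\<forall>i<1. q i \<in> carrier Q" "q (0::nat) [^]\<^bsub>Q\<^esub> m = \<one>\<^bsub>Q\<^esub>"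
  interpret Q: group Q by fact
  have q0: "q 0 \<in> carrier Q" using q(1) by simp
  have red: "q 0 [^]\<^bsub>Q\<^esub> (z mod int m) = q 0 [^]\<^bsub>Q\<^esub> z" for z :: int
  proof -
    have "q 0 [^]\<^bsub>Q\<^esub> z = q 0 [^]\<^bsub>Q\<^esub> (int m * (z div int m) + z mod int m)" by simp
    also have "\<dots> = (q 0 [^]\<^bsub>Q\<^esub> int m) [^]\<^bsub>Q\<^esub> (z div int m) \<otimes>\<^bsub>Q\<^esub> q 0 [^]\<^bsub>Q\<^esub> (z mod int m)"
      using q0 by (simp only: Q.int_pow_mult Q.int_pow_pow)
    also have "\<dots> = q 0 [^]\<^bsub>Q\<^esub> (z mod int m)" using q(2) q0 by (simp add: int_pow_int Q.int_pow_one)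
    finally show ?thesis ..
  qed
  have "(\<lambda>z. q 0 [^]\<^bsub>Q\<^esub> z) \<in> hom ?G Q"
    by (rule homI) (use q0 in \<open>simp_all add: red Q.int_pow_mult\<close>)
  moreover have "q 0 [^]\<^bsub>Q\<^esub> (1::int) = q 0" using q0 by simp
  ultimately show "\<exists>\<psi>\<in>hom ?G Q. \<forall>i<1. \<psi> 1 = q i" by (intro bexI[of _ "\<lambda>z. q 0 [^]\<^bsub>Q\<^esub> z"]) auto
qed

text \<open>
  One gluing, with the new group and tree renamed by natural numbers.
\<close>

lemma glue_step:
  fixes G :: "'g::countable monoid" and V :: "'v::countable set"
  assumes J: "gluable k n G V E \<phi> L c" and r: "r > 0"
    and P: "presented TYPE(int) m r G x" "presented TYPE((nat \<times> bool) list set) m r G x"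
  shows "\<exists>(G' :: nat monoid) (V' :: nat set) E' \<phi>' v c' x'. ready k n G' V' E' \<phi>' v c' \<and>
    presented TYPE(int) m (Suc r) G' x' \<and> presented TYPE((nat \<times> bool) list set) m (Suc r) G' x'"
proof -
  obtain V' :: "(('g \<times> bool) list \<times> 'v) set" and E' \<phi>' v c' where R: "ready k n (adjoin G) V' E' \<phi>' v c'"
    using ready_if_gluable[OF J] by blast
  have T: "tree_acts (adjoin G) V' E' \<phi>'"
    using R good_actionD(1) unfolding ready_def by blast
  interpret relabelling "adjoin G" "to_nat :: _ \<Rightarrow> nat" "to_nat :: _ \<Rightarrow> nat" V' E' \<phi>'
    by unfold_locales (use T in auto)
  show ?thesis
    using ready'[OF R] presented_image[OF presented_adjoin[OF P(1) r] _ inj_to_nat]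
      presented_image[OF presented_adjoin[OF P(2) r] _ inj_to_nat] by blast
qed

text \<open>
  The first gluing yields rank 2; each of the \<open>j\<close> further generators costs \<open>2k\<close> edges for the legs
  that are hung before it is added.
\<close>

lemma tower:
  fixes V :: "'v::countable set"
  assumes J: "gluable k n (integer_mod_group m) V E \<phi> L c" and m: "m \<noteq> 1" and k: "k > 0"
  shows "\<exists>(G' :: nat monoid) (V' :: nat set) E' \<phi>' v c' x'. ready k (n + 2 * k * j) G' V' E' \<phi>' v c' \<and>
    presented TYPE(int) m (j + 2) G' x' \<and> presented TYPE((nat \<times> bool) list set) m (j + 2) G' x'"
proof (induction j)
  case 0
  show ?case using glue_step[OF J zero_less_one presented_cyclic[OF m] presented_cyclic[OF m]]
    by (simp add: numeral_2_eq_2)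
next
  case (Suc j)
  then obtain G' :: "nat monoid" and V' :: "nat set" and E' \<phi>' v c' x'
    where R: "ready k (n + 2 * k * j) G' V' E' \<phi>' v c'"
      "presented TYPE(int) m (j + 2) G' x'" "presented TYPE((nat \<times> bool) list set) m (j + 2) G' x'" by blast
  obtain V'' :: "(nat + (bool \<times> nat) \<times> nat) set" and E'' \<phi>'' L'' c''
    where "gluable k (n + 2 * k * j + 2 * k) G' V'' E'' \<phi>'' L'' c''"
    using gluable_if_ready[OF R(1) k] by blast
  from glue_step[OF this _ R(2,3)] show ?case by (simp add: algebra_simps)
qed

lemma floor_count:
  assumes "r \<ge> 2"
  shows "int (k + k div 2 + 2 * k * (r - 2)) = \<lfloor>(2 * real r - 5 / 2) * real k\<rfloor>"
proof -
  \<comment> \<open>the remainder \<open>b\<close> contributes \<open>b / 2 < 1\<close>, which the floor removes\<close>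
  obtain q b where qb: "k = 2 * q + b" "b < 2" by (metis mod_less_divisor mult_div_mod_eq pos2)
  obtain j where j: "r = j + 2" using assms by (metis add.commute le_Suc_ex)
  have "k div 2 = q" using qb by simp
  then have n: "int (k + k div 2 + 2 * k * (r - 2)) = int k + int q + 2 * int k * int j" using j by simp
  have "(2 * real r - 5 / 2) * real k = real k + real q + 2 * real k * real j + real b / 2"
    using qb j by (simp add: algebra_simps)
  also have "\<lfloor>\<dots>\<rfloor> = int k + int q + 2 * int k * int j"
    using qb(2) by (intro floor_unique) auto
  finally show ?thesis using n by simp
qed

theorem theorem1p20:
  fixes k r :: nat
  assumes "k > 0" and "r \<ge> 2"
  shows "(\<exists>(G :: nat monoid) (V :: nat set) E \<phi>.
            finitely_presented G \<and> group_rank G = r \<and>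
            tree_action G V E \<phi> \<and> acylindrical k G V E \<phi> \<and> minimal_tree G V E \<phi> \<and>
            (\<forall>e\<in>E. stabilizer G (edge_action \<phi>) e \<noteq> {\<one>\<^bsub>G\<^esub>}) \<and>
            finite (quotient_edges G E \<phi>) \<and>
            int (card (quotient_edges G E \<phi>)) = \<lfloor>(2 * real (group_rank G) - 5 / 2) * real k\<rfloor>)
       \<and> (\<exists>(V :: nat set) E \<phi>.
            tree_action (free_group {..<r}) V E \<phi> \<and>
            acylindrical k (free_group {..<r}) V E \<phi> \<and>
            minimal_tree (free_group {..<r}) V E \<phi> \<and>
            (\<forall>e\<in>E. stabilizer (free_group {..<r}) (edge_action \<phi>) e \<noteq> {\<one>\<^bsub>free_group {..<r}\<^esub>}) \<and>
            finite (quotient_edges (free_group {..<r}) E \<phi>) \<and>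
            int (card (quotient_edges (free_group {..<r}) E \<phi>)) = (2 * int r - 3) * int k)"
proof -
  have r: "r - 2 + 2 = r" "r > 0" using assms(2) by auto
  have "\<exists>(G :: nat monoid) (V :: nat set) E \<phi> v c x. ready k (k + k div 2 + 2 * k * (r - 2)) G V E \<phi> v c \<and>
    presented TYPE(int) 15 r G x \<and> presented TYPE((nat \<times> bool) list set) 15 r G x"
  proof (cases "k = 1")
    case True
    then show ?thesis using tower[OF gluable_segment[of 15 k], of "r - 2"] r by simp
  next
    case False
    then have "k \<ge> 2" using assms(1) by simp
    then obtain V :: "(nat + (bool \<times> int) \<times> nat) set" and E \<phi> L c
      where "gluable k (k + k div 2) (integer_mod_group 15) V E \<phi> L c"
      using gluable_segment_with_legs by blast
    from tower[OF this _ assms(1), of "r - 2"] show ?thesis unfolding r by simp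
  qed
  then obtain G :: "nat monoid" and V :: "nat set" and E \<phi> v c x
    where R: "ready k (k + k div 2 + 2 * k * (r - 2)) G V E \<phi> v c"
      and P: "presented TYPE(int) 15 r G x" "presented TYPE((nat \<times> bool) list set) 15 r G x" by blast
  have good: "good_action k (k + k div 2 + 2 * k * (r - 2)) G V E \<phi>" and br: "\<And>u. u \<in> V \<Longrightarrow> branches E u"
    using R unfolding ready_def by auto
  have G: "group G" by (rule presentedD(1)[OF P(1)])
  have "id \<in> iso G G" by (simp add: iso_def hom_def)
  note real = realise[OF good br G this]
  have rank: "group_rank G = r" by (rule rank_presented[OF P(1), of 3]) auto
  have "finitely_presented G" by (rule finitely_presented_if_presented[OF P(2) r(2)])
  then have first: "\<exists>(G :: nat monoid) (V :: nat set) E \<phi>.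
            finitely_presented G \<and> group_rank G = r \<and>
            tree_action G V E \<phi> \<and> acylindrical k G V E \<phi> \<and> minimal_tree G V E \<phi> \<and>
            (\<forall>e\<in>E. stabilizer G (edge_action \<phi>) e \<noteq> {\<one>\<^bsub>G\<^esub>}) \<and>
            finite (quotient_edges G E \<phi>) \<and>
            int (card (quotient_edges G E \<phi>)) = \<lfloor>(2 * real (group_rank G) - 5 / 2) * real k\<rfloor>"
    using real rank floor_count[OF assms(2), of k] by (intro exI conjI) auto
  obtain G' :: "nat monoid" and V' :: "nat set" and E' \<phi>' v' c' x'
    where R': "ready k (k + 2 * k * (r - 2)) G' V' E' \<phi>' v' c'"
      and P': "presented TYPE((nat \<times> bool) list set) 0 r G' x'"
    using tower[OF gluable_segment[of 0 k], of "r - 2"] assms(1) unfolding r by auto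
  have good': "good_action k (k + 2 * k * (r - 2)) G' V' E' \<phi>'" and br': "\<And>u. u \<in> V' \<Longrightarrow> branches E' u"
    using R' unfolding ready_def by auto
  note real' = realise[OF good' br' group_free_group presented_free_iso[OF P' r(2)]]
  have "int (k + 2 * k * (r - 2)) = (2 * int r - 3) * int k"
    using assms(2) by (simp add: of_nat_diff algebra_simps)
  with real' first show ?thesis by (intro conjI) (assumption, intro exI conjI, auto)
qed

end
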